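(* Let $A$ be a local ring with residue field $k$. If a finite direct sum of syzygy modules of $k$ maps onto a semidualizing $A$-module (that is, there is a surjective $A$-module homomorphism $\bigoplus_{n\in\Lambda}\left(\Omega_n^A(k)\right)^{j_n}\to L$ with $\Lambda$ a finite collection of non-negative integers, $j_n\ge1$ for each $n\in\Lambda$, and $L$ a semidualizing $A$-module), then $A$ is regular.
   Context: All rings are commutative Noetherian with identity. For $n\ge0$, $\Omega_n^A(k)$ denotes the $n$th syzygy module of $k$ in a minimal free resolution of $k$ over $A$, with $\Omega_0^A(k)=k$. A finitely generated $A$-module $C$ is semidualizing if (i) the natural homomorphism $A\to\mathrm{Hom}_A(C,C)$ is an isomorphism and (ii) $\mathrm{Ext}_A^i(C,C)=0$ for all $i\ge1$. *)

theory Defs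
  imports "HOL-Algebra.Ring_Divisibility" "HOL-Algebra.Module" "HOL-Library.Extended_Nat"
begin

section \<open>Noetherian local rings and regularity\<close>

locale noetherian_local_ring = cring R + noetherian_ring R for R (structure) +
  assumes ex1_maximalideal: "\<exists>!m. maximalideal m R"

definition max_ideal :: "('a, 'r) ring_scheme \<Rightarrow> 'a set" where
  "max_ideal R = (THE m. maximalideal m R)"

definition krull_dim :: "('a, 'r) ring_scheme \<Rightarrow> enat" where
  "krull_dim R = (SUP n \<in> {n. \<exists>p :: nat \<Rightarrow> 'a set.
     (\<forall>i\<le>n. primeideal (p i) R) \<and> (\<forall>i<n. p i \<subset> p (Suc i))}. enat n)"

text \<open>The embedding dimension is the minimal number of generators of the maximal ideal.\<close>

definition embedding_dim :: "('a, 'r) ring_scheme \<Rightarrow> nat" where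
  "embedding_dim R = (LEAST n. \<exists>S \<subseteq> carrier R. finite S \<and> card S = n \<and> Idl\<^bsub>R\<^esub> S = max_ideal R)"

definition regular_local_ring :: "('a, 'r) ring_scheme \<Rightarrow> bool" where
  "regular_local_ring R \<longleftrightarrow>
     noetherian_local_ring R \<and> enat (embedding_dim R) = krull_dim R"


section \<open>Modules\<close>

text \<open>
  A \<^typ>\<open>('a, 'b) module\<close> record extends a ring record, so it carries fields \<^const>\<open>mult\<close> and
  \<^const>\<open>one\<close>; the locale \<^locale>\<open>module\<close> does not constrain them, and they are junk in all the
  module constructions below.
\<close>

definition mod_hom ::
    "('a, 'r) ring_scheme \<Rightarrow> ('a, 'b, 'm) module_scheme \<Rightarrow> ('a, 'c, 'n) module_scheme \<Rightarrow> ('b \<Rightarrow> 'c) set"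
  where "mod_hom R M N =
    {f \<in> carrier M \<rightarrow> carrier N.
       (\<forall>x\<in>carrier M. \<forall>y\<in>carrier M. f (x \<oplus>\<^bsub>M\<^esub> y) = f x \<oplus>\<^bsub>N\<^esub> f y) \<and>
       (\<forall>a\<in>carrier R. \<forall>x\<in>carrier M. f (a \<odot>\<^bsub>M\<^esub> x) = a \<odot>\<^bsub>N\<^esub> f x)}"

definition mod_iso ::
    "('a, 'r) ring_scheme \<Rightarrow> ('a, 'b, 'm) module_scheme \<Rightarrow> ('a, 'c, 'n) module_scheme \<Rightarrow> ('b \<Rightarrow> 'c) set"
  where "mod_iso R M N = {f \<in> mod_hom R M N. bij_betw f (carrier M) (carrier N)}"

definition finitely_generated_module ::
    "('a, 'r) ring_scheme \<Rightarrow> ('a, 'b, 'm) module_scheme \<Rightarrow> bool"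
  where "finitely_generated_module R M \<longleftrightarrow>
    (\<exists>S \<subseteq> carrier M. finite S \<and> \<Inter>{N. submodule N R M \<and> S \<subseteq> N} = carrier M)"

definition regular_module :: "('a, 'r) ring_scheme \<Rightarrow> ('a, 'a) module" where
  "regular_module R =
     \<lparr>carrier = carrier R, mult = mult R, one = one R, zero = zero R, add = add R, smult = mult R\<rparr>"

definition quotient_module :: "('a, 'b, 'm) module_scheme \<Rightarrow> 'b set \<Rightarrow> ('a, 'b set) module" where
  "quotient_module M N =
     \<lparr>carrier = a_rcosets\<^bsub>M\<^esub> N, mult = undefined, one = undefined, zero = N, add = set_add M,
      smult = (\<lambda>a X. \<Union>x\<in>X. N +>\<^bsub>M\<^esub> (a \<odot>\<^bsub>M\<^esub> x))\<rparr>"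

definition residue_field :: "('a, 'r) ring_scheme \<Rightarrow> ('a, 'a set) module" where
  "residue_field R = quotient_module (regular_module R) (max_ideal R)"

text \<open>For a finite index set the direct sum is the direct product.\<close>

definition finite_direct_sum :: "'i set \<Rightarrow> ('i \<Rightarrow> ('a, 'b, 'm) module_scheme) \<Rightarrow> ('a, 'i \<Rightarrow> 'b) module"
  where "finite_direct_sum I M =
     \<lparr>carrier = (\<Pi>\<^sub>E i\<in>I. carrier (M i)), mult = undefined, one = undefined,
      zero = (\<lambda>i\<in>I. \<zero>\<^bsub>M i\<^esub>), add = (\<lambda>x y. \<lambda>i\<in>I. x i \<oplus>\<^bsub>M i\<^esub> y i),
      smult = (\<lambda>a x. \<lambda>i\<in>I. a \<odot>\<^bsub>M i\<^esub> x i)\<rparr>"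

definition free_module :: "('a, 'r) ring_scheme \<Rightarrow> nat \<Rightarrow> ('a, nat \<Rightarrow> 'a) module" where
  "free_module R n = finite_direct_sum {..<n} (\<lambda>_. regular_module R)"

text \<open>
  Elements of the Hom module are taken extensional, so that two of them are equal as soon as they
  agree on \<^term>\<open>carrier M\<close>.
\<close>

definition Hom_module ::
    "('a, 'r) ring_scheme \<Rightarrow> ('a, 'b, 'm) module_scheme \<Rightarrow> ('a, 'c, 'n) module_scheme \<Rightarrow>
     ('a, 'b \<Rightarrow> 'c) module"
  where "Hom_module R M N =
     \<lparr>carrier = mod_hom R M N \<inter> extensional (carrier M), mult = undefined, one = undefined,
      zero = (\<lambda>x\<in>carrier M. \<zero>\<^bsub>N\<^esub>), add = (\<lambda>f g. \<lambda>x\<in>carrier M. f x \<oplus>\<^bsub>N\<^esub> g x),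
      smult = (\<lambda>a f. \<lambda>x\<in>carrier M. a \<odot>\<^bsub>N\<^esub> f x)\<rparr>"


section \<open>Free resolutions, syzygies and Ext\<close>

text \<open>
  A resolution \<open>\<dots> \<rightarrow> F 2 \<rightarrow> F 1 \<rightarrow> F 0 \<rightarrow> M \<rightarrow> 0\<close> by free modules \<open>F n\<close> of finite rank \<open>b n\<close>, with
  augmentation \<open>\<epsilon>\<close> and differentials \<open>d n : F (n + 1) \<rightarrow> F n\<close>. Over a Noetherian ring every
  finitely generated module has one.
\<close>

definition free_resolution ::
    "('a, 'r) ring_scheme \<Rightarrow> ('a, 'b, 'm) module_scheme \<Rightarrow> (nat \<Rightarrow> nat) \<Rightarrow>
     (nat \<Rightarrow> (nat \<Rightarrow> 'a) \<Rightarrow> (nat \<Rightarrow> 'a)) \<Rightarrow> ((nat \<Rightarrow> 'a) \<Rightarrow> 'b) \<Rightarrow> bool"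
  where "free_resolution R M b d \<epsilon> \<longleftrightarrow>
    (let F = (\<lambda>n. free_module R (b n)) in
       \<epsilon> \<in> mod_hom R (F 0) M \<and> \<epsilon> ` carrier (F 0) = carrier M \<and>
       (\<forall>n. d n \<in> mod_hom R (F (Suc n)) (F n)) \<and>
       d 0 ` carrier (F 1) = a_kernel (F 0) M \<epsilon> \<and>
       (\<forall>n. d (Suc n) ` carrier (F (Suc (Suc n))) = a_kernel (F (Suc n)) (F n) (d n)))"

text \<open>
  Minimality means \<open>d n (F (n + 1)) \<subseteq> m F n\<close> for the maximal ideal \<open>m\<close>; in the free module \<open>F n\<close>
  the submodule \<open>m F n\<close> consists of the vectors with all coordinates in \<open>m\<close>.
\<close>

definition minimal_free_resolution ::
    "('a, 'r) ring_scheme \<Rightarrow> ('a, 'b, 'm) module_scheme \<Rightarrow> (nat \<Rightarrow> nat) \<Rightarrow>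
     (nat \<Rightarrow> (nat \<Rightarrow> 'a) \<Rightarrow> (nat \<Rightarrow> 'a)) \<Rightarrow> ((nat \<Rightarrow> 'a) \<Rightarrow> 'b) \<Rightarrow> bool"
  where "minimal_free_resolution R M b d \<epsilon> \<longleftrightarrow>
    free_resolution R M b d \<epsilon> \<and>
    (\<forall>n. \<forall>x\<in>carrier (free_module R (b (Suc n))). \<forall>i<b n. d n x i \<in> max_ideal R)"

text \<open>
  Syzygy modules are only determined up to isomorphism, so \<open>X\<close> being an \<open>n\<close>-th syzygy module of
  \<open>M\<close> is a predicate: \<open>X\<close> is isomorphic to \<open>M\<close> if \<open>n = 0\<close>, and to the image of \<open>F n \<rightarrow> F (n - 1)\<close>
  in a minimal free resolution of \<open>M\<close> if \<open>n \<ge> 1\<close>. In this way \<open>M\<close> itself and submodules of free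
  modules, whose elements have different types, can be handled uniformly.
\<close>

definition syzygy_module ::
    "('a, 'r) ring_scheme \<Rightarrow> ('a, 'b, 'm) module_scheme \<Rightarrow> nat \<Rightarrow> ('a, 'c, 'n) module_scheme \<Rightarrow> bool"
  where "syzygy_module R M n X \<longleftrightarrow>
    module R X \<and>
    (\<exists>b d \<epsilon>. minimal_free_resolution R M b d \<epsilon> \<and>
       (case n of
          0 \<Rightarrow> mod_iso R X M \<noteq> {}
        | Suc k \<Rightarrow> mod_iso R X
            ((free_module R (b k))\<lparr>carrier := d k ` carrier (free_module R (b (Suc k)))\<rparr>) \<noteq> {}))"

text \<open>
  The \<open>i\<close>-th cohomology of the complex \<open>Hom(F, N)\<close>, whose differentials \<open>\<delta> n\<close> are given by
  precomposition with \<open>d n\<close>.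
\<close>

definition Hom_cohomology ::
    "('a, 'r) ring_scheme \<Rightarrow> (nat \<Rightarrow> nat) \<Rightarrow> (nat \<Rightarrow> (nat \<Rightarrow> 'a) \<Rightarrow> (nat \<Rightarrow> 'a)) \<Rightarrow>
     ('a, 'c, 'n) module_scheme \<Rightarrow> nat \<Rightarrow> ('a, ((nat \<Rightarrow> 'a) \<Rightarrow> 'c) set) module"
  where "Hom_cohomology R b d N i =
    (let H = (\<lambda>n. Hom_module R (free_module R (b n)) N);
         \<delta> = (\<lambda>n f. compose (carrier (free_module R (b (Suc n)))) f (d n));
         Z = a_kernel (H i) (H (Suc i)) (\<delta> i);
         B = (case i of 0 \<Rightarrow> {\<zero>\<^bsub>H 0\<^esub>} | Suc k \<Rightarrow> \<delta> k ` carrier (H k))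
     in quotient_module ((H i)\<lparr>carrier := Z\<rparr>) B)"

text \<open>
  \<open>Ext\<^sup>i\<^sub>R(M, N)\<close> for a finitely generated module \<open>M\<close> over a Noetherian ring, computed from a chosen
  resolution of \<open>M\<close>; up to isomorphism the result does not depend on the choice.
\<close>

definition Ext_module ::
    "('a, 'r) ring_scheme \<Rightarrow> nat \<Rightarrow> ('a, 'b, 'm) module_scheme \<Rightarrow> ('a, 'c, 'n) module_scheme \<Rightarrow>
     ('a, ((nat \<Rightarrow> 'a) \<Rightarrow> 'c) set) module"
  where "Ext_module R i M N =
    (let (b, d, \<epsilon>) = (SOME F. case F of (b, d, \<epsilon>) \<Rightarrow> free_resolution R M b d \<epsilon>)
     in Hom_cohomology R b d N i)"


section \<open>Semidualizing modules\<close>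

definition homothety :: "('a, 'b, 'm) module_scheme \<Rightarrow> 'a \<Rightarrow> 'b \<Rightarrow> 'b" where
  "homothety C a = (\<lambda>x\<in>carrier C. a \<odot>\<^bsub>C\<^esub> x)"

definition semidualizing :: "('a, 'r) ring_scheme \<Rightarrow> ('a, 'b, 'm) module_scheme \<Rightarrow> bool" where
  "semidualizing R C \<longleftrightarrow>
     module R C \<and> finitely_generated_module R C \<and>
     homothety C \<in> mod_iso R (regular_module R) (Hom_module R C C) \<and>
     (\<forall>i\<ge>1. carrier (Ext_module R i C C) = {\<zero>\<^bsub>Ext_module R i C C\<^esub>})"

end

theory Submission
  imports Defs "HOL-Algebra.Ideal_Product"
begin

text \<open>
  Let \<open>x1, \<dots>, xr\<close> be regular on both \<open>R\<close> and \<open>L\<close>, linearly independent modulo \<open>\<mm>\<^sup>2\<close>, and such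
  that the ideal \<open>I\<close> they generate is maximal. If \<open>I = \<mm>\<close>, then \<open>R\<close> is regular. Otherwise prime avoidance
  and maximality show that \<open>\<mm>\<close> annihilates a nonzero element of \<open>R/I\<close> or of \<open>L/IL\<close>; since the vanishing
  of \<open>Ext(L, L)\<close> gives \<open>Hom(L, L/IL) = R/I\<close>, in both cases there is \<open>s \<notin> I\<close> with \<open>s\<mm> \<subseteq> I\<close>, and \<open>s \<in> \<mm>\<close>.
  In a minimal resolution \<open>F\<close> of \<open>k\<close>, an element of \<open>\<mm>F\<close> that is a cycle modulo \<open>I\<close> is a boundary
  modulo \<open>I\<close>. Applied to \<open>sF\<close> this yields \<open>s\<Omega> \<subseteq> I\<Omega>\<close> for every syzygy module \<open>\<Omega>\<close> of \<open>k\<close>, hence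
  \<open>sL \<subseteq> IL\<close>. But \<open>R/I\<close> acts faithfully on \<open>L/IL\<close>, so \<open>s \<in> I\<close>, a contradiction.
\<close>

text \<open>The obstacle is that passing to R/(x1) would change the ring, its element type and the
  resolution at every step of an induction on the sequence. Quotients by I and localizations are
  therefore never formed: a statement about R/I, L/IL or F/IF becomes a membership in
  \<open>seq_mult\<close>, and localization at a prime is replaced by \<open>saturation\<close>.
  Inductions run along the list and trade an element x for a division by x, which regularity
  permits. Independence modulo the square of the maximal ideal is what makes the claim about cycles
  true. From d w = x u the argument continues with u, and this is possible only if u again has its
  coordinates in the maximal ideal. Regularity on L is demanded alongside regularity on R because
  the final contradiction compares s in R/I with its action on L/IL. That a regular sequence
  generating the maximal ideal yields the dimension equality in \<open>regular_local_ring\<close>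
  rests on Krull's height theorem, which is derived here from the principal ideal theorem.\<close>

locale noetherian_cring = cring R + noetherian_ring R for R (structure)

sublocale noetherian_local_ring \<subseteq> noetherian_cring ..

section \<open>Noetherian rings and prime ideals\<close>

lemma (in noetherian_ring) ex_maximal_ideal_in:
  assumes "S \<noteq> {}" and "\<And>I. I \<in> S \<Longrightarrow> ideal I R"
  shows "\<exists>M\<in>S. \<forall>I\<in>S. M \<subseteq> I \<longrightarrow> I = M"
proof (rule subset_Zorn_nonempty[OF assms(1)])
  fix C assume C: "C \<noteq> {}" "subset.chain S C"
  then have "subset.chain {I. ideal I R} C"
    using assms(2) by (auto simp: subset_chain_def)
  then have "\<Union>C \<in> C" using ideal_chain_is_trivial C(1) by blast
  then show "\<Union>C \<in> S" using C(2) by (auto simp: subset_chain_def)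
qed

lemma (in noetherian_ring) obtain_maximal_ideal:
  assumes "ideal J R" "Q J"
  obtains M where "ideal M R" "Q M" "\<And>I. ideal I R \<Longrightarrow> Q I \<Longrightarrow> M \<subseteq> I \<Longrightarrow> I = M"
proof -
  have "\<exists>M\<in>{I. ideal I R \<and> Q I}. \<forall>I\<in>{I. ideal I R \<and> Q I}. M \<subseteq> I \<longrightarrow> I = M"
    by (rule ex_maximal_ideal_in) (use assms in auto)
  then show ?thesis using that by blast
qed

text \<open>Tailored to \<open>saturated_chain_stabilizes\<close>, where a non-prime ideal is
  handled through two strictly larger ideals.\<close>

lemma (in noetherian_ring) ideal_induct [consumes 1, case_names step]:
  assumes "ideal I R"
    and step: "\<And>I. ideal I R \<Longrightarrow> (\<And>J. ideal J R \<Longrightarrow> I \<subset> J \<Longrightarrow> Q J) \<Longrightarrow> Q I"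
  shows "Q I"
proof (rule ccontr)
  assume "\<not> Q I"
  then obtain M where "ideal M R" "\<not> Q M" "\<And>J. ideal J R \<Longrightarrow> \<not> Q J \<Longrightarrow> M \<subseteq> J \<Longrightarrow> J = M"
    using obtain_maximal_ideal[OF assms(1), of "\<lambda>I. \<not> Q I"] by metis
  then show False using step[of M] by blast
qed

lemma (in cring) colon_ideal:
  assumes "ideal K R" "a \<in> carrier R"
  shows "ideal {u \<in> carrier R. u \<otimes> a \<in> K} R"
proof -
  have "{u \<in> carrier R. u \<otimes> a \<in> K} = {u \<in> carrier R. a \<otimes> u \<in> K}"
    using assms(2) by (auto simp: m_comm)
  then show ?thesis using ideal.helper_max_prime[OF assms(1) is_cring assms(2)] by simp
qed

text \<open>Written by elements rather than as a generated ideal, so that a membership immediately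
  yields the two summands that the chain arguments manipulate.\<close>

definition ideal_adjoin :: "('a, 'r) ring_scheme \<Rightarrow> 'a set \<Rightarrow> 'a \<Rightarrow> 'a set" where
  "ideal_adjoin R I x = {v \<oplus>\<^bsub>R\<^esub> c \<otimes>\<^bsub>R\<^esub> x | v c. v \<in> I \<and> c \<in> carrier R}"

lemma (in cring) ideal_adjoin:
  assumes "ideal I R" "x \<in> carrier R"
  shows "ideal (ideal_adjoin R I x) R" "I \<subseteq> ideal_adjoin R I x" "x \<in> ideal_adjoin R I x"
proof -
  interpret I: ideal I R by fact
  have "ideal_adjoin R I x = set_add R I (PIdl x)"
    unfolding ideal_adjoin_def set_add_def' cgenideal_def by blast
  then show "ideal (ideal_adjoin R I x) R" by (simp add: add_ideals assms cgenideal_ideal)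
  show "I \<subseteq> ideal_adjoin R I x"
  proof
    fix i assume i: "i \<in> I"
    then have "i = i \<oplus> \<zero> \<otimes> x" using assms(2) I.Icarr by simp
    then show "i \<in> ideal_adjoin R I x" unfolding ideal_adjoin_def using i by blast
  qed
  have "x = \<zero> \<oplus> \<one> \<otimes> x" using assms(2) by simp
  then show "x \<in> ideal_adjoin R I x" unfolding ideal_adjoin_def using I.zero_closed by blast
qed

text \<open>An ideal p maximal among those disjoint from \<open>S\<close> is prime: if a and b lie
  outside p, then p + Ra and p + Rb both meet \<open>S\<close>, and the product of the two elements
  found lies in \<open>S\<close>, and also in p whenever a b does.\<close>

lemma (in noetherian_cring) ex_prime_disjoint:
  assumes J: "ideal J R" and S: "S \<subseteq> carrier R" "\<one> \<in> S" "\<And>s t. s \<in> S \<Longrightarrow> t \<in> S \<Longrightarrow> s \<otimes> t \<in> S"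
    and disj: "J \<inter> S = {}"
  shows "\<exists>p. primeideal p R \<and> J \<subseteq> p \<and> p \<inter> S = {}"
proof -
  obtain p where p0: "ideal p R" "J \<subseteq> p \<and> p \<inter> S = {}"
    and mx0: "\<And>I. ideal I R \<Longrightarrow> J \<subseteq> I \<and> I \<inter> S = {} \<Longrightarrow> p \<subseteq> I \<Longrightarrow> I = p"
    by (rule obtain_maximal_ideal[OF J, of "\<lambda>I. J \<subseteq> I \<and> I \<inter> S = {}"]) (use disj in auto)
  then have p: "ideal p R" "J \<subseteq> p" "p \<inter> S = {}"
    and mx: "\<And>I. ideal I R \<Longrightarrow> I \<inter> S = {} \<Longrightarrow> p \<subseteq> I \<Longrightarrow> I = p"
    by (simp_all add: subset_trans[of J p])
  interpret p: ideal p R by fact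
  have key: "\<exists>v\<in>p. \<exists>c\<in>carrier R. v \<oplus> c \<otimes> x \<in> S" if x: "x \<in> carrier R" "x \<notin> p" for x
  proof -
    have "ideal_adjoin R p x \<inter> S \<noteq> {}"
      using mx[of "ideal_adjoin R p x"] ideal_adjoin[OF p(1) x(1)] x(2) by blast
    then show ?thesis unfolding ideal_adjoin_def by auto
  qed
  have "primeideal p R"
  proof (rule primeidealI[OF p(1) is_cring])
    show "carrier R \<noteq> p" using S(2) p(3) by auto
    fix a b assume ab: "a \<in> carrier R" "b \<in> carrier R" "a \<otimes> b \<in> p"
    show "a \<in> p \<or> b \<in> p"
    proof (rule ccontr)
      assume "\<not> ?thesis"
      then obtain v c w e where v: "v \<in> p" "c \<in> carrier R" "v \<oplus> c \<otimes> a \<in> S"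
        and w: "w \<in> p" "e \<in> carrier R" "w \<oplus> e \<otimes> b \<in> S" using key ab by meson
      have vw: "v \<in> carrier R" "w \<in> carrier R" using v w p.Icarr by auto
      have "(v \<oplus> c \<otimes> a) \<otimes> (w \<oplus> e \<otimes> b) = (w \<oplus> e \<otimes> b) \<otimes> v \<oplus> ((c \<otimes> a) \<otimes> w \<oplus> (c \<otimes> e) \<otimes> (a \<otimes> b))"
        using vw v w ab(1,2) by algebra
      also have "\<dots> \<in> p"
        using p.a_closed[OF p.I_l_closed[OF v(1), of "w \<oplus> e \<otimes> b"]
            p.a_closed[OF p.I_l_closed[OF w(1), of "c \<otimes> a"] p.I_l_closed[OF ab(3), of "c \<otimes> e"]]]
          vw v w ab(1,2) by simp
      finally show False using S(3)[OF v(3) w(3)] p(3) by auto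
    qed
  qed
  then show ?thesis using p by blast
qed

lemma (in noetherian_cring) ex_maximalideal_ge:
  assumes J: "ideal J R" "\<one> \<notin> J"
  shows "\<exists>p. maximalideal p R \<and> J \<subseteq> p"
proof -
  obtain p where p0: "ideal p R" "J \<subseteq> p \<and> \<one> \<notin> p"
    and mx0: "\<And>I. ideal I R \<Longrightarrow> J \<subseteq> I \<and> \<one> \<notin> I \<Longrightarrow> p \<subseteq> I \<Longrightarrow> I = p"
    by (rule obtain_maximal_ideal[OF J(1), of "\<lambda>I. J \<subseteq> I \<and> \<one> \<notin> I"]) (use J in auto)
  then have p: "ideal p R" "J \<subseteq> p" "\<one> \<notin> p"
    and mx: "\<And>I. ideal I R \<Longrightarrow> \<one> \<notin> I \<Longrightarrow> p \<subseteq> I \<Longrightarrow> I = p"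
    by (simp_all add: subset_trans[of J p])
  have "maximalideal p R"
  proof (rule maximalidealI[OF p(1)])
    show "carrier R \<noteq> p" using p(3) by auto
    fix I assume I: "ideal I R" "p \<subseteq> I" "I \<subseteq> carrier R"
    show "I = p \<or> I = carrier R"
    proof (cases "\<one> \<in> I")
      case True then show ?thesis using ideal.one_imp_carrier[OF I(1)] by blast
    next
      case False then show ?thesis using mx I by blast
    qed
  qed
  then show ?thesis using p by blast
qed

lemma (in noetherian_local_ring) max_ideal_maximal: "maximalideal (max_ideal R) R"
  unfolding max_ideal_def using theI'[OF ex1_maximalideal] .

lemma (in noetherian_local_ring) max_ideal_prime: "primeideal (max_ideal R) R"
  using maximalideal_prime[OF max_ideal_maximal] .

lemma (in noetherian_local_ring) proper_ideal_le_max: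
  assumes "ideal J R" "\<one> \<notin> J"
  shows "J \<subseteq> max_ideal R"
  using ex_maximalideal_ge[OF assms] ex1_maximalideal max_ideal_maximal by blast

lemma (in noetherian_local_ring) unit_of_not_max:
  assumes "a \<in> carrier R" "a \<notin> max_ideal R"
  shows "\<exists>b\<in>carrier R. b \<otimes> a = \<one>"
proof -
  have "\<one> \<in> PIdl a"
    using proper_ideal_le_max[OF cgenideal_ideal[OF assms(1)]] cgenideal_self[OF assms(1)] assms(2) by blast
  then show ?thesis unfolding cgenideal_def by auto
qed

lemma (in primeideal) prod_notin:
  assumes "a \<in> carrier R - I" "b \<in> carrier R - I"
  shows "a \<otimes> b \<in> carrier R - I"
  using assms I_prime by auto

lemma (in primeideal) one_notin: "\<one> \<notin> I"
  using one_imp_carrier I_notcarr by blast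

lemma (in primeideal) pow_mem:
  assumes "a \<in> carrier R" "a [^] (n::nat) \<in> I"
  shows "a \<in> I"
  using assms(2)
proof (induction n)
  case 0 then show ?case using one_notin by simp
next
  case (Suc n) then show ?case using I_prime[of "a [^] n" a] assms(1) by auto
qed

section \<open>Saturation at a prime\<close>

text \<open>For a prime \<open>P\<close> and an ideal \<open>J\<close> this is the contraction to R
  of the extension of \<open>J\<close> to the localization at \<open>P\<close>. The lemmas below ask
  only that the complement of \<open>P\<close> be multiplicative, since the principal ideal theorem
  also inverts powers of an element.\<close>

definition saturation :: "('a, 'r) ring_scheme \<Rightarrow> 'a set \<Rightarrow> 'a set \<Rightarrow> 'a set" where
  "saturation R P J = {u \<in> carrier R. \<exists>s\<in>carrier R - P. s \<otimes>\<^bsub>R\<^esub> u \<in> J}"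

lemma saturationI: "u \<in> carrier R \<Longrightarrow> s \<in> carrier R - P \<Longrightarrow> s \<otimes>\<^bsub>R\<^esub> u \<in> J \<Longrightarrow> u \<in> saturation R P J"
  unfolding saturation_def by blast

lemma saturation_mono: "J \<subseteq> K \<Longrightarrow> saturation R P J \<subseteq> saturation R P K"
  unfolding saturation_def by blast

context cring
begin

context
  fixes I :: "'a set"
  assumes one_notin: "\<one> \<notin> I"
    and prod_notin: "\<And>a b. a \<in> carrier R - I \<Longrightarrow> b \<in> carrier R - I \<Longrightarrow> a \<otimes> b \<in> carrier R - I"
begin

lemma saturation_ideal:
  assumes "ideal J R"
  shows "ideal (saturation R I J) R"
proof -
  interpret J: ideal J R by fact
  show ?thesis
  proof (rule idealI[OF ring_axioms])
    show "subgroup (saturation R I J) (add_monoid R)"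
    proof (rule add.subgroupI)
      show "saturation R I J \<subseteq> carrier R" unfolding saturation_def by auto
      have "\<zero> \<in> saturation R I J"
        by (rule saturationI[of _ _ \<one>]) (auto simp: one_notin)
      then show "saturation R I J \<noteq> {}" by blast
      fix a assume a: "a \<in> saturation R I J"
      then obtain s where s: "s \<in> carrier R - I" "s \<otimes> a \<in> J" "a \<in> carrier R"
        unfolding saturation_def by blast
      then have "s \<otimes> (\<ominus> a) = \<ominus> (s \<otimes> a)" by (simp add: r_minus)
      then show "\<ominus> a \<in> saturation R I J" using s by (intro saturationI[of _ _ s]) auto
      fix b assume b: "b \<in> saturation R I J"
      then obtain t where t: "t \<in> carrier R - I" "t \<otimes> b \<in> J" "b \<in> carrier R"
        unfolding saturation_def by blast
      have "s \<otimes> t \<otimes> (a \<oplus> b) = t \<otimes> (s \<otimes> a) \<oplus> s \<otimes> (t \<otimes> b)"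
        using s(1,3) t(1,3) by (simp, algebra)
      also have "\<dots> \<in> J" using s t J.a_closed[OF J.I_l_closed[OF s(2)] J.I_l_closed[OF t(2)]] by auto
      finally show "a \<oplus> b \<in> saturation R I J"
        using s t prod_notin by (intro saturationI[of _ _ "s \<otimes> t"]) auto
    qed
    fix a x assume a: "a \<in> saturation R I J" and x: "x \<in> carrier R"
    then obtain s where s: "s \<in> carrier R - I" "s \<otimes> a \<in> J" "a \<in> carrier R"
      unfolding saturation_def by blast
    have "s \<otimes> (x \<otimes> a) = x \<otimes> (s \<otimes> a)" using s(1,3) x by (simp, algebra)
    also have "\<dots> \<in> J" using s x J.I_l_closed by auto
    finally show "x \<otimes> a \<in> saturation R I J" using s x by (intro saturationI[of _ _ s]) auto
    then show "a \<otimes> x \<in> saturation R I J" using s x by (simp add: m_comm)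
  qed
qed

lemma saturation_ge:
  assumes "ideal J R"
  shows "J \<subseteq> saturation R I J"
proof
  interpret J: ideal J R by fact
  fix j assume "j \<in> J" then show "j \<in> saturation R I J"
    using J.Icarr one_notin by (intro saturationI[of _ _ \<one>]) auto
qed

lemma saturation_idem:
  assumes "ideal J R"
  shows "saturation R I (saturation R I J) = saturation R I J"
proof
  show "saturation R I (saturation R I J) \<subseteq> saturation R I J"
  proof
    fix a assume "a \<in> saturation R I (saturation R I J)"
    then obtain s t where "s \<in> carrier R - I" "t \<in> carrier R - I" "t \<otimes> (s \<otimes> a) \<in> J" "a \<in> carrier R"
      unfolding saturation_def by blast
    then show "a \<in> saturation R I J"
      using prod_notin[of t s] by (intro saturationI[of _ _ "t \<otimes> s"]) (auto simp: m_assoc)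
  qed
qed (rule saturation_ge[OF saturation_ideal[OF assms]])

end

end

lemmas (in primeideal) saturation_ideal' = saturation_ideal[OF one_notin, rotated, OF _ prod_notin]
  and saturation_ge' = saturation_ge[OF one_notin, rotated, OF _ prod_notin]
  and saturation_idem' = saturation_idem[OF one_notin, rotated, OF _ prod_notin]

section \<open>Krull's height theorem for maximal ideals\<close>

text \<open>The coefficient set is a parameter because Nakayama's lemma compares the span over the
  whole ring with the span whose coefficients lie in a prime.\<close>

primrec lin_span :: "'a set \<Rightarrow> ('a, 'b, 'm) module_scheme \<Rightarrow> 'b list \<Rightarrow> 'b set" where
  "lin_span P M [] = {\<zero>\<^bsub>M\<^esub>}"
| "lin_span P M (u # us) = {(p \<odot>\<^bsub>M\<^esub> u) \<oplus>\<^bsub>M\<^esub> k | p k. p \<in> P \<and> k \<in> lin_span P M us}"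

lemma lin_span_ConsI:
  "p \<in> P \<Longrightarrow> k \<in> lin_span P M us \<Longrightarrow> p \<odot>\<^bsub>M\<^esub> u \<oplus>\<^bsub>M\<^esub> k \<in> lin_span P M (u # us)"
  by auto

lemma (in module) lin_span_closed:
  assumes "P \<subseteq> carrier R" "set us \<subseteq> carrier M"
  shows "lin_span P M us \<subseteq> carrier M"
  using assms(2) by (induction us) (use assms(1) in \<open>auto simp: subset_iff\<close>)

lemma (in module) lin_span_add:
  assumes "ideal P R" "set us \<subseteq> carrier M" "v \<in> lin_span P M us" "w \<in> lin_span P M us"
  shows "v \<oplus>\<^bsub>M\<^esub> w \<in> lin_span P M us"
  using assms(2-)
proof (induction us arbitrary: v w)
  case Nil then show ?case by simp
next
  case (Cons u us)
  interpret P: ideal P R by fact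
  obtain p k q l where v: "v = p \<odot>\<^bsub>M\<^esub> u \<oplus>\<^bsub>M\<^esub> k" "p \<in> P" "k \<in> lin_span P M us"
    and w: "w = q \<odot>\<^bsub>M\<^esub> u \<oplus>\<^bsub>M\<^esub> l" "q \<in> P" "l \<in> lin_span P M us"
    using Cons.prems(2,3) by auto
  have c: "k \<in> carrier M" "l \<in> carrier M" "p \<in> carrier R" "q \<in> carrier R" "u \<in> carrier M"
    using v w lin_span_closed[OF P.a_subset, of us] Cons.prems(1) P.Icarr by auto
  have "v \<oplus>\<^bsub>M\<^esub> w = (p \<oplus> q) \<odot>\<^bsub>M\<^esub> u \<oplus>\<^bsub>M\<^esub> (k \<oplus>\<^bsub>M\<^esub> l)"
    unfolding v(1) w(1) smult_l_distr[OF c(3-5)] using c by (simp add: M.a_ac)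
  moreover have "k \<oplus>\<^bsub>M\<^esub> l \<in> lin_span P M us" using Cons v w by simp
  ultimately show ?case using v(2) w(2) by auto
qed

lemma (in module) lin_span_smult:
  assumes "ideal P R" "set us \<subseteq> carrier M" "v \<in> lin_span P M us" "a \<in> carrier R"
  shows "a \<odot>\<^bsub>M\<^esub> v \<in> lin_span P M us"
  using assms(2-)
proof (induction us arbitrary: v)
  case Nil then show ?case by simp
next
  case (Cons u us)
  interpret P: ideal P R by fact
  obtain p k where v: "v = p \<odot>\<^bsub>M\<^esub> u \<oplus>\<^bsub>M\<^esub> k" "p \<in> P" "k \<in> lin_span P M us"
    using Cons.prems(2) by auto
  have c: "k \<in> carrier M" "p \<in> carrier R" "u \<in> carrier M"
    using v lin_span_closed[OF P.a_subset, of us] Cons.prems(1) P.Icarr by auto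
  have "a \<odot>\<^bsub>M\<^esub> v = (a \<otimes> p) \<odot>\<^bsub>M\<^esub> u \<oplus>\<^bsub>M\<^esub> (a \<odot>\<^bsub>M\<^esub> k)"
    unfolding v(1) using c Cons.prems(3) by (simp add: smult_r_distr smult_assoc1)
  moreover have "a \<odot>\<^bsub>M\<^esub> k \<in> lin_span P M us" using Cons v by simp
  ultimately show ?case using lin_span_ConsI[of "a \<otimes> p" P] v(2) Cons.prems(3) P.I_l_closed by metis
qed

lemma (in module) lin_span_submodule:
  assumes "ideal P R" "set us \<subseteq> carrier M"
  shows "submodule (lin_span P M us) R M"
proof (rule submoduleI)
  interpret P: ideal P R by fact
  show sub: "lin_span P M us \<subseteq> carrier M"
    using lin_span_closed assms(2) P.a_subset by blast
  show "\<zero>\<^bsub>M\<^esub> \<in> lin_span P M us" using assms(2)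
  proof (induction us)
    case (Cons u us)
    then show ?case using lin_span_ConsI[OF P.zero_closed, of "\<zero>\<^bsub>M\<^esub>" M us u] by simp
  qed simp
  fix v assume v: "v \<in> lin_span P M us"
  then have "\<ominus>\<^bsub>M\<^esub> v = (\<ominus> \<one>) \<odot>\<^bsub>M\<^esub> v"
    using sub by (simp add: smult_l_minus subset_iff)
  then show "\<ominus>\<^bsub>M\<^esub> v \<in> lin_span P M us" using lin_span_smult[OF assms v, of "\<ominus> \<one>"] by simp
qed (use lin_span_add lin_span_smult assms in auto)

lemma (in module) lin_span_least:
  assumes N: "submodule N R M" and "P \<subseteq> carrier R" "set us \<subseteq> N"
  shows "lin_span P M us \<subseteq> N"
  using assms(3)
proof (induction us)
  case Nil
  interpret N: submodule N R M by fact
  show ?case using N.one_closed by simp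
next
  case (Cons u us)
  show ?case
  proof
    fix v assume "v \<in> lin_span P M (u # us)"
    then obtain p k where "v = p \<odot>\<^bsub>M\<^esub> u \<oplus>\<^bsub>M\<^esub> k" "p \<in> P" "k \<in> lin_span P M us" by auto
    then show "v \<in> N" using Cons assms(2) submoduleE(4,5)[OF N] by (auto simp: subset_iff)
  qed
qed

lemma (in module) lin_span_gens:
  assumes "ideal P R" "\<one> \<in> P" "set us \<subseteq> carrier M"
  shows "set us \<subseteq> lin_span P M us"
  using assms(3)
proof (induction us)
  case (Cons u us)
  interpret P: ideal P R by fact
  have sm: "submodule (lin_span P M us) R M" using lin_span_submodule[OF assms(1)] Cons.prems by simp
  interpret L: submodule "lin_span P M us" R M by fact
  have z: "\<zero>\<^bsub>M\<^esub> \<in> lin_span P M us" using L.one_closed by simp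
  have "u = \<one> \<odot>\<^bsub>M\<^esub> u \<oplus>\<^bsub>M\<^esub> \<zero>\<^bsub>M\<^esub>" using Cons.prems by simp
  then have u: "u \<in> lin_span P M (u # us)" using z assms(2) by auto
  have "v \<in> lin_span P M (u # us)" if v: "v \<in> set us" for v
  proof -
    have "v = \<zero> \<odot>\<^bsub>M\<^esub> u \<oplus>\<^bsub>M\<^esub> v" "v \<in> lin_span P M us" using Cons v by auto
    then show ?thesis using lin_span_ConsI[OF P.zero_closed, of v M us u] by simp
  qed
  then show ?case using u by auto
qed simp

section \<open>The ring as a module over itself, and Nakayama's lemma\<close>

lemma regular_module_simps [simp]:
  "carrier (regular_module R) = carrier R" "mult (regular_module R) = mult R"
  "one (regular_module R) = one R" "zero (regular_module R) = zero R"
  "add (regular_module R) = add R" "smult (regular_module R) = mult R"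
  by (simp_all add: regular_module_def)

lemma (in cring) regular_module_module: "module R (regular_module R)"
proof (rule moduleI[OF is_cring])
  show "abelian_group (regular_module R)"
    by (rule abelian_groupI) (auto simp: a_ac intro: add.l_inv_ex)
qed (auto simp: l_distr r_distr m_assoc)

lemma regular_module_a_inv [simp]: "a_inv (regular_module R) = a_inv R"
  by (simp add: a_inv_def m_inv_def fun_eq_iff)

text \<open>Lets results proved once for submodules, such as those on \<open>lin_span\<close> and
  \<open>seq_mult\<close>, be read as results on ideals.\<close>

lemma (in cring) submodule_regular_iff_ideal: "submodule N R (regular_module R) \<longleftrightarrow> ideal N R"
proof
  interpret M: module R "regular_module R" by (rule regular_module_module)
  assume N: "submodule N R (regular_module R)"
  interpret N: submodule N R "regular_module R" by fact
  show "ideal N R"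
  proof (rule idealI[OF ring_axioms])
    show "subgroup N (add_monoid R)"
      using N.m_closed N.one_closed N.m_inv_closed N.subset
      by (intro add.subgroupI) (auto simp: m_inv_def a_inv_def)
    fix a x assume a: "a \<in> N" and x: "x \<in> carrier R"
    show "x \<otimes> a \<in> N" using N.smult_closed[OF x a] by simp
    then show "a \<otimes> x \<in> N" using x a M.submoduleE(1)[OF N] by (auto simp: m_comm subset_iff)
  qed
next
  interpret M: module R "regular_module R" by (rule regular_module_module)
  assume N: "ideal N R"
  interpret N: ideal N R by fact
  show "submodule N R (regular_module R)"
    by (rule M.submoduleI) (auto simp: N.I_l_closed N.Icarr)
qed

lemma (in cring) lin_span_ideal:
  assumes "ideal P R" "set us \<subseteq> carrier R"
  shows "ideal (lin_span P (regular_module R) us) R"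
  using module.lin_span_submodule[OF regular_module_module assms(1), of us] assms(2)
  by (simp add: submodule_regular_iff_ideal)

lemma (in noetherian_cring) ideal_gens:
  assumes "ideal J R"
  obtains us where "set us \<subseteq> carrier R" "J = Idl (set us)"
  using finetely_gen[OF assms] finite_list by metis

lemma (in cring) Idl_eq_lin_span:
  assumes "set us \<subseteq> carrier R"
  shows "Idl (set us) = lin_span (carrier R) (regular_module R) us"
proof
  interpret M: module R "regular_module R" by (rule regular_module_module)
  show "Idl (set us) \<subseteq> lin_span (carrier R) (regular_module R) us"
    using M.lin_span_gens[OF oneideal] assms
    by (intro genideal_minimal lin_span_ideal oneideal) auto
  show "lin_span (carrier R) (regular_module R) us \<subseteq> Idl (set us)"
    by (rule M.lin_span_least)
      (use assms genideal_ideal genideal_self in \<open>auto simp: submodule_regular_iff_ideal\<close>)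
qed

text \<open>For \<^term>\<open>I\<close> the maximal ideal of a local ring this is the usual Nakayama lemma.\<close>

lemma (in primeideal) nakayama:
  assumes "ideal K R" "saturation R I K \<subseteq> K" "set us \<subseteq> carrier R"
    and "\<And>u. u \<in> set us \<Longrightarrow>
      u \<in> saturation R I {k \<oplus> q | k q. k \<in> K \<and> q \<in> lin_span I (regular_module R) us}"
  shows "set us \<subseteq> K"
  using assms(3,4)
proof (induction us)
  case (Cons u us)
  interpret K: ideal K R by fact
  interpret S: ideal "lin_span I (regular_module R) us" R
    using lin_span_ideal[OF is_ideal] Cons.prems(1) by simp
  have u: "u \<in> carrier R" using Cons.prems(1) by simp
  have dec: "\<exists>s\<in>carrier R - I. \<exists>k\<in>K. \<exists>p\<in>I. \<exists>q\<in>lin_span I (regular_module R) us. s \<otimes> v = k \<oplus> (p \<otimes> u \<oplus> q)"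
    if "v \<in> set (u # us)" for v
    using Cons.prems(2)[OF that] unfolding saturation_def by (auto; blast)
  obtain s k p q where s: "s \<in> carrier R - I" "k \<in> K" "p \<in> I" "q \<in> lin_span I (regular_module R) us"
    "s \<otimes> u = k \<oplus> (p \<otimes> u \<oplus> q)" using dec[of u] by auto
  have c: "s \<in> carrier R" "k \<in> carrier R" "p \<in> carrier R" "q \<in> carrier R"
    using s K.Icarr Icarr S.Icarr by auto
  \<comment> \<open>\<open>s\<close> is outside the prime and \<open>p\<close> inside, so
    \<open>s \<ominus> p\<close> is again outside: the relation can be solved for \<open>u\<close>
    up to a factor that saturation removes.\<close>
  have "(s \<ominus> p) \<otimes> u = s \<otimes> u \<ominus> p \<otimes> u" using c u by algebra
  also have "\<dots> = k \<oplus> q" unfolding s(5) using c u by algebra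
  finally have spu: "(s \<ominus> p) \<otimes> u = k \<oplus> q" .
  have sp: "s \<ominus> p \<in> carrier R - I"
  proof -
    have "s \<in> I" if "s \<ominus> p \<in> I"
    proof -
      have "s = (s \<ominus> p) \<oplus> p" using c by algebra
      then show ?thesis using additive_subgroup.a_closed[OF additive_subgroup_axioms that s(3)] by simp
    qed
    then show ?thesis using s c by auto
  qed
  \<comment> \<open>Multiplying the relation for \<open>v\<close> by \<open>s \<ominus> p\<close>
    and substituting eliminates \<open>u\<close>, which leaves the hypothesis of the induction for
    the shorter list.\<close>
  have usK: "set us \<subseteq> K"
  proof (rule Cons.IH)
    show "set us \<subseteq> carrier R" using Cons.prems by simp
    fix v assume v: "v \<in> set us"
    then have vc: "v \<in> carrier R" using Cons.prems by auto
    obtain s' k' p' q' where s': "s' \<in> carrier R - I" "k' \<in> K" "p' \<in> I"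
      "q' \<in> lin_span I (regular_module R) us" "s' \<otimes> v = k' \<oplus> (p' \<otimes> u \<oplus> q')" using dec[of v] v by auto
    have c': "s' \<in> carrier R" "k' \<in> carrier R" "p' \<in> carrier R" "q' \<in> carrier R" "s \<ominus> p \<in> carrier R"
      using s' sp K.Icarr Icarr S.Icarr by auto
    have "((s \<ominus> p) \<otimes> s') \<otimes> v = (s \<ominus> p) \<otimes> (k' \<oplus> (p' \<otimes> u \<oplus> q'))"
      using c' vc s'(5) by (simp add: m_assoc)
    also have "\<dots> = ((s \<ominus> p) \<otimes> k' \<oplus> p' \<otimes> ((s \<ominus> p) \<otimes> u)) \<oplus> (s \<ominus> p) \<otimes> q'"
      using c' u by algebra
    also have "\<dots> = ((s \<ominus> p) \<otimes> k' \<oplus> p' \<otimes> k) \<oplus> (p' \<otimes> q \<oplus> (s \<ominus> p) \<otimes> q')"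
      unfolding spu using c' c u by algebra
    finally have eq: "((s \<ominus> p) \<otimes> s') \<otimes> v = ((s \<ominus> p) \<otimes> k' \<oplus> p' \<otimes> k) \<oplus> (p' \<otimes> q \<oplus> (s \<ominus> p) \<otimes> q')" .
    have m1: "(s \<ominus> p) \<otimes> k' \<oplus> p' \<otimes> k \<in> K"
      using K.a_closed K.I_l_closed s'(2) s(2) c' by auto
    have m2: "p' \<otimes> q \<oplus> (s \<ominus> p) \<otimes> q' \<in> lin_span I (regular_module R) us"
      using S.a_closed S.I_l_closed s'(4) s(4) c' by auto
    show "v \<in> saturation R I {k \<oplus> q | k q. k \<in> K \<and> q \<in> lin_span I (regular_module R) us}"
      by (rule saturationI[OF vc prod_notin[OF sp s'(1)]]) (use eq m1 m2 in blast)
  qed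
  then have "lin_span I (regular_module R) us \<subseteq> K"
    using assms(1) a_subset by (intro module.lin_span_least[OF regular_module_module])
      (auto simp: submodule_regular_iff_ideal)
  then have "(s \<ominus> p) \<otimes> u \<in> K" unfolding spu using s K.a_closed by auto
  then have "u \<in> saturation R I K" using saturationI[OF u sp] by simp
  then show ?case using usK assms(2) by auto
qed simp

section \<open>The descending chain condition and the principal ideal theorem\<close>

text \<open>
  The descending chain condition in the localization of \<^term>\<open>R\<close> at \<^term>\<open>P\<close>, modulo an ideal
  \<^term>\<open>J\<close> for which \<^term>\<open>P\<close> is the only prime between \<^term>\<open>J\<close> and \<^term>\<open>P\<close>; ideals of the localization are
  represented by saturated ideals of \<^term>\<open>R\<close>.
\<close>

lemma (in noetherian_cring) saturated_chain_stabilizes: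
  assumes "primeideal P R" "ideal J R"
    and "\<And>Q. primeideal Q R \<Longrightarrow> J \<subseteq> Q \<Longrightarrow> Q \<subseteq> P \<Longrightarrow> Q = P"
    and "\<And>n. ideal (K n) R" "\<And>n. saturation R P (K n) \<subseteq> K n" "\<And>n. J \<subseteq> K n" "\<And>n::nat. K (Suc n) \<subseteq> K n"
  shows "\<exists>n. K (Suc n) = K n"
proof -
  interpret P: primeideal P R by fact
  \<comment> \<open>The induction varies the chain together with the ideal, and it carries eventual
    constancy so that two derived chains can be compared at a common index.\<close>
  have "(\<forall>Q. primeideal Q R \<longrightarrow> J \<subseteq> Q \<longrightarrow> Q \<subseteq> P \<longrightarrow> Q = P) \<Longrightarrow>
    (\<And>n. ideal (K n) R) \<Longrightarrow> (\<And>n. saturation R P (K n) \<subseteq> K n) \<Longrightarrow> (\<And>n. J \<subseteq> K n) \<Longrightarrow>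
    (\<And>n. K (Suc n) \<subseteq> K n) \<Longrightarrow> \<exists>N. \<forall>n\<ge>N. K n = K N"
    for K using assms(2)
  proof (induction J arbitrary: K rule: ideal_induct)
    case (step J)
    note Kid = step.prems(2) and Ksat = step.prems(3) and JK = step.prems(4) and dec = step.prems(5)
    interpret J: ideal J R by fact
    have dec': "K n \<subseteq> K m" if "m \<le> n" for m n :: nat
      using lift_Suc_antimono_le[of K, OF dec that] .
    have full: "K n = carrier R" if n: "\<not> K n \<subseteq> P" for n
    proof -
      interpret K: ideal "K n" R by (rule Kid)
      obtain s where s: "s \<in> K n" "s \<notin> P" using n by blast
      then have "\<one> \<in> saturation R P (K n)" using K.Icarr[OF s(1)]
        by (intro saturationI[of _ _ s]) auto
      then show ?thesis using Ksat K.one_imp_carrier by blast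
    qed
    show ?case
    proof (cases "\<forall>n. \<not> K n \<subseteq> P")
      case True then show ?thesis using full by auto
    next
      case False
      then obtain N0 where N0: "K N0 \<subseteq> P" by blast
      then have JP: "J \<subseteq> P" using JK by blast
      show ?thesis
      proof (cases "primeideal J R")
        case True
        then have "J = P" using step.prems(1) JP by blast
        then have "K n = P" if "n \<ge> N0" for n using JK N0 dec'[OF that] by blast
        then show ?thesis by auto
      next
        case False
        moreover have "carrier R \<noteq> J" using JP P.one_notin by auto
        ultimately obtain a b where ab: "a \<in> carrier R" "b \<in> carrier R" "a \<otimes> b \<in> J" "a \<notin> J" "b \<notin> J"
          using J.primeidealCD[OF is_cring] by blast
        \<comment> \<open>K n + Ra and (K n : a) together determine K n up to saturation. Both
          chains live over ideals strictly larger than \<open>J\<close>, the first because of a and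
          the second because of b.\<close>
        define A where "A n = saturation R P (ideal_adjoin R (K n) a)" for n
        define B where "B n = {u \<in> carrier R. u \<otimes> a \<in> K n}" for n
        have J1: "ideal (ideal_adjoin R J a) R" "J \<subset> ideal_adjoin R J a"
          using ideal_adjoin[OF step.hyps ab(1)] ab(4) by auto
        have J2: "ideal {u \<in> carrier R. u \<otimes> a \<in> J} R" "J \<subset> {u \<in> carrier R. u \<otimes> a \<in> J}"
        proof -
          show "ideal {u \<in> carrier R. u \<otimes> a \<in> J} R" by (rule colon_ideal[OF step.hyps ab(1)])
          have "b \<in> {u \<in> carrier R. u \<otimes> a \<in> J}" using ab by (simp add: m_comm)
          moreover have "J \<subseteq> {u \<in> carrier R. u \<otimes> a \<in> J}" using J.I_r_closed ab(1) J.Icarr by auto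
          ultimately show "J \<subset> {u \<in> carrier R. u \<otimes> a \<in> J}" using ab(5) by blast
        qed
        have Aid: "ideal (ideal_adjoin R (K n) a) R" for n using ideal_adjoin[OF Kid ab(1)] by blast
        have "\<exists>N. \<forall>n\<ge>N. A n = A N"
        proof (rule step.IH[OF J1])
          show "\<forall>Q. primeideal Q R \<longrightarrow> ideal_adjoin R J a \<subseteq> Q \<longrightarrow> Q \<subseteq> P \<longrightarrow> Q = P"
            using step.prems(1) J1(2) by blast
          show "ideal (A n) R" for n unfolding A_def by (rule P.saturation_ideal'[OF Aid])
          show "saturation R P (A n) \<subseteq> A n" for n unfolding A_def using P.saturation_idem'[OF Aid] by simp
          show "ideal_adjoin R J a \<subseteq> A n" for n
            using P.saturation_ge'[OF Aid, of n] JK[of n] unfolding A_def ideal_adjoin_def by blast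
          show "A (Suc n) \<subseteq> A n" for n
            unfolding A_def by (rule saturation_mono) (use dec[of n] in \<open>auto simp: ideal_adjoin_def\<close>)
        qed
        then obtain N1 where N1: "\<And>n. n \<ge> N1 \<Longrightarrow> A n = A N1" by blast
        have "\<exists>N. \<forall>n\<ge>N. B n = B N"
        proof (rule step.IH[OF J2])
          show "\<forall>Q. primeideal Q R \<longrightarrow> {u \<in> carrier R. u \<otimes> a \<in> J} \<subseteq> Q \<longrightarrow> Q \<subseteq> P \<longrightarrow> Q = P"
            using step.prems(1) subset_trans[OF psubset_imp_subset[OF J2(2)]] by simp
          show "ideal (B n) R" for n unfolding B_def by (rule colon_ideal[OF Kid ab(1)])
          show "saturation R P (B n) \<subseteq> B n" for n
          proof
            fix u assume "u \<in> saturation R P (B n)"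
            then obtain s where s: "s \<in> carrier R - P" "s \<otimes> u \<otimes> a \<in> K n" "u \<in> carrier R"
              unfolding saturation_def B_def by blast
            then have "u \<otimes> a \<in> saturation R P (K n)"
              using ab(1) by (intro saturationI[of _ _ s]) (auto simp: m_assoc)
            then show "u \<in> B n" using Ksat[of n] s unfolding B_def by blast
          qed
          show "{u \<in> carrier R. u \<otimes> a \<in> J} \<subseteq> B n" for n using JK[of n] unfolding B_def by blast
          show "B (Suc n) \<subseteq> B n" for n using dec[of n] unfolding B_def by blast
        qed
        then obtain N2 where N2: "\<And>n. n \<ge> N2 \<Longrightarrow> B n = B N2" by blast
        define N where "N = max N1 N2"
        \<comment> \<open>Both derived chains are constant from \<open>N\<close> on. Write s u = v +
          c a with v in K n; then c lies in (K N : a) = (K n : a), so s u lies in K n and saturation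
          removes s.\<close>
        have "K N \<subseteq> K n" if n: "n \<ge> N" for n
        proof
          interpret K: ideal "K n" R by (rule Kid)
          interpret KN: ideal "K N" R by (rule Kid)
          fix u assume u: "u \<in> K N"
          have "A N = A n" using N1[of N] N1[of n] n unfolding N_def by simp
          moreover have "u \<in> A N"
            using P.saturation_ge'[OF Aid, of N] ideal_adjoin(2)[OF Kid ab(1), of N] u unfolding A_def by blast
          ultimately obtain s v c where s: "s \<in> carrier R - P" "s \<otimes> u = v \<oplus> c \<otimes> a" "v \<in> K n" "c \<in> carrier R"
            unfolding A_def saturation_def ideal_adjoin_def by blast
          have vN: "v \<in> K N" using s(3) dec'[OF n] by blast
          have cc: "v \<in> carrier R" "u \<in> carrier R" using KN.Icarr vN u by auto
          have "c \<otimes> a = s \<otimes> u \<ominus> v" unfolding s(2) using cc s(4) ab(1) by algebra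
          also have "\<dots> \<in> K N" unfolding a_minus_def
            using KN.a_closed KN.I_l_closed KN.a_inv_closed u vN s(1) by auto
          finally have "c \<in> B N" unfolding B_def using s(4) by blast
          moreover have "B N = B n" using N2[of N] N2[of n] n unfolding N_def by simp
          ultimately have "c \<otimes> a \<in> K n" unfolding B_def by blast
          then have "s \<otimes> u \<in> K n" unfolding s(2) using s(3) by simp
          then have "u \<in> saturation R P (K n)" using s(1) cc by (intro saturationI[of _ _ s]) auto
          then show "u \<in> K n" using Ksat by blast
        qed
        then have "\<forall>n\<ge>N. K n = K N" using dec' by blast
        then show ?thesis by blast
      qed
    qed
  qed
  from this[of K] assms(3-) obtain N where "\<And>n. n \<ge> N \<Longrightarrow> K n = K N" by metis
  then show ?thesis by (metis le_SucI order_refl)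
qed

lemma (in module) lin_span_smult_coeff:
  assumes "ideal P R" "x \<in> P" "set us \<subseteq> carrier M" "v \<in> lin_span (carrier R) M us"
  shows "x \<odot>\<^bsub>M\<^esub> v \<in> lin_span P M us"
  using assms(3,4)
proof (induction us arbitrary: v)
  case Nil then show ?case using assms(2) ideal.Icarr[OF assms(1)] by simp
next
  case (Cons u us)
  interpret P: ideal P R by fact
  obtain p k where v: "v = p \<odot>\<^bsub>M\<^esub> u \<oplus>\<^bsub>M\<^esub> k" "p \<in> carrier R" "k \<in> lin_span (carrier R) M us"
    using Cons.prems(2) by auto
  have c: "k \<in> carrier M" "u \<in> carrier M" "x \<in> carrier R"
    using v lin_span_closed[of "carrier R" us] Cons.prems(1) P.Icarr assms(2) by auto
  have "x \<odot>\<^bsub>M\<^esub> v = (x \<otimes> p) \<odot>\<^bsub>M\<^esub> u \<oplus>\<^bsub>M\<^esub> x \<odot>\<^bsub>M\<^esub> k"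
    unfolding v(1) using c v(2) by (simp add: smult_r_distr smult_assoc1)
  moreover have "x \<odot>\<^bsub>M\<^esub> k \<in> lin_span P M us" using Cons v by simp
  ultimately show ?case using lin_span_ConsI[of "x \<otimes> p" P] v(2) P.I_r_closed assms(2) by metis
qed

text \<open>
  Krull's principal ideal theorem, localized at \<^term>\<open>P\<close> and modulo \<^term>\<open>p0\<close>. With
  \<open>J n = (y^n : x^\<infinity>)\<close>, the descending chain condition modulo \<^term>\<open>x\<close> gives \<open>J n \<subseteq> J (n + 1) + x J n\<close>,
  so \<open>J n = J (n + 1)\<close> by Nakayama. Hence some \<open>x^b y^n\<close> is a multiple of \<open>y^(n + 1)\<close>, which is
  impossible when \<open>y\<close> lies in \<^term>\<open>p1\<close> but not in \<^term>\<open>p0\<close>.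
\<close>

lemma (in noetherian_cring) principal_ideal_theorem:
  assumes "primeideal p0 R" "primeideal p1 R" "primeideal P R" "p0 \<subset> p1" "p1 \<subset> P" "x \<in> P"
  shows "\<exists>Q. primeideal Q R \<and> p0 \<subseteq> Q \<and> x \<in> Q \<and> Q \<subset> P"
proof (rule ccontr)
  assume no: "\<not> ?thesis"
  interpret p0: primeideal p0 R by fact
  interpret p1: primeideal p1 R by fact
  interpret P: primeideal P R by fact
  have xc: "x \<in> carrier R" using assms(6) P.Icarr by blast
  \<comment> \<open>Otherwise p1 itself would be the prime whose existence is denied.\<close>
  have xp1: "x \<notin> p1" using no assms by blast
  obtain y where y: "y \<in> p1" "y \<notin> p0" using assms(4) by blast
  have yc: "y \<in> carrier R" using y p1.Icarr by blast
  \<comment> \<open>Inverting the powers of \<open>x\<close> together with the complement of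
    \<open>P\<close> lets a single saturation produce both the colon by powers of \<open>x\<close>
    and the localization at \<open>P\<close>.\<close>
  define S where "S = {s \<otimes> x [^] b | s b. s \<in> carrier R - P \<and> b \<in> (UNIV :: nat set)}"
  have Sc: "S \<subseteq> carrier R" unfolding S_def using xc by auto
  have S1: "s \<in> S" if "s \<in> carrier R - P" for s
  proof -
    have "s = s \<otimes> x [^] (0::nat)" using that by simp
    then show ?thesis unfolding S_def using that by blast
  qed
  have one: "\<one> \<in> S" using S1 P.one_notin by blast
  have xS: "x \<in> S"
  proof -
    have "x = \<one> \<otimes> x [^] (1::nat)" using xc by simp
    then show ?thesis unfolding S_def using P.one_notin by blast
  qed
  have mul: "s \<otimes> t \<in> S" if st: "s \<in> S" "t \<in> S" for s t
  proof -
    obtain a b c d where "s = a \<otimes> x [^] (b::nat)" "a \<in> carrier R - P" "t = c \<otimes> x [^] (d::nat)" "c \<in> carrier R - P"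
      using st unfolding S_def by blast
    moreover from this have "s \<otimes> t = (a \<otimes> c) \<otimes> x [^] (b + d)"
      using xc by (simp add: nat_pow_mult[symmetric] m_ac)
    ultimately show ?thesis unfolding S_def using P.prod_notin by blast
  qed
  define A where "A n = ideal_adjoin R p0 (y [^] (n::nat))" for n
  have Aid: "ideal (A n) R" and Ap0: "p0 \<subseteq> A n" and Ay: "y [^] n \<in> A n" for n
    unfolding A_def using ideal_adjoin[OF p0.is_ideal, of "y [^] n"] yc by auto
  have Adec: "A (Suc n) \<subseteq> A n" for n
  proof
    fix u assume "u \<in> A (Suc n)"
    then obtain v c where u: "u = v \<oplus> c \<otimes> y [^] Suc n" "v \<in> p0" "c \<in> carrier R"
      unfolding A_def ideal_adjoin_def by blast
    then have "u = v \<oplus> (c \<otimes> y) \<otimes> y [^] n" using yc by (simp add: m_ac)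
    then show "u \<in> A n" unfolding A_def ideal_adjoin_def using u yc by blast
  qed
  define C where "C = carrier R - S"
  have CS: "carrier R - C = S" unfolding C_def using Sc by blast
  have C1: "\<one> \<notin> C" "\<And>a b. a \<in> carrier R - C \<Longrightarrow> b \<in> carrier R - C \<Longrightarrow> a \<otimes> b \<in> carrier R - C"
    using one mul unfolding CS by (auto simp: C_def)
  define J where "J n = saturation R C (A n)" for n
  have Jid: "ideal (J n) R" for n unfolding J_def by (rule saturation_ideal[OF C1 Aid])
  have AJ: "A n \<subseteq> J n" for n unfolding J_def by (rule saturation_ge[OF C1 Aid])
  have Jsat: "u \<in> J n" if "u \<in> carrier R" "s \<in> S" "s \<otimes> u \<in> J n" for u s n
  proof -
    have "u \<in> saturation R C (J n)" using that by (intro saturationI[of _ _ s]) (auto simp: CS)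
    then show ?thesis unfolding J_def using saturation_idem[OF C1 Aid] by simp
  qed
  have Jdec: "J (Suc n) \<subseteq> J n" for n unfolding J_def by (rule saturation_mono[OF Adec])
  have JXid: "ideal (ideal_adjoin R (J n) x) R" for n using ideal_adjoin[OF Jid xc] by blast
  define K where "K n = saturation R P (ideal_adjoin R (J n) x)" for n
  have JK: "ideal_adjoin R (J n) x \<subseteq> K n" for n unfolding K_def by (rule P.saturation_ge'[OF JXid])
  \<comment> \<open>The denial says that \<open>P\<close> is the only prime between p0 + Rx and
    \<open>P\<close>, which is the hypothesis of the chain condition modulo that ideal.\<close>
  have "\<exists>n. K (Suc n) = K n"
  proof (rule saturated_chain_stabilizes[OF assms(3)])
    show "ideal (ideal_adjoin R p0 x) R" using ideal_adjoin[OF p0.is_ideal xc] by blast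
    fix Q assume Q: "primeideal Q R" "ideal_adjoin R p0 x \<subseteq> Q" "Q \<subseteq> P"
    then have "p0 \<subseteq> Q" "x \<in> Q" using ideal_adjoin[OF p0.is_ideal xc] by auto
    then show "Q = P" using no Q by blast
  next
    fix n
    show "ideal (K n) R" unfolding K_def by (rule P.saturation_ideal'[OF JXid])
    show "saturation R P (K n) \<subseteq> K n" unfolding K_def using P.saturation_idem'[OF JXid] by simp
    have "ideal_adjoin R p0 x \<subseteq> ideal_adjoin R (J n) x"
      using Ap0[of n] AJ[of n] unfolding ideal_adjoin_def by blast
    then show "ideal_adjoin R p0 x \<subseteq> K n" using JK[of n] by blast
    have "ideal_adjoin R (J (Suc n)) x \<subseteq> ideal_adjoin R (J n) x"
      using Jdec[of n] unfolding ideal_adjoin_def by blast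
    then show "K (Suc n) \<subseteq> K n" unfolding K_def by (rule saturation_mono)
  qed
  then obtain n where n: "K (Suc n) = K n" by blast
  interpret J: ideal "J n" R by (rule Jid)
  obtain us where us: "set us \<subseteq> carrier R" "J n = Idl (set us)" using ideal_gens[OF Jid] by blast
  interpret RM: module R "regular_module R" by (rule regular_module_module)
  have "set us \<subseteq> J (Suc n)"
  proof (rule P.nakayama[OF Jid _ us(1)])
    show "saturation R P (J (Suc n)) \<subseteq> J (Suc n)"
    proof
      fix u assume "u \<in> saturation R P (J (Suc n))"
      then show "u \<in> J (Suc n)" unfolding saturation_def using Jsat S1 by blast
    qed
    fix u assume "u \<in> set us"
    then have "u \<in> J n" using us genideal_self by blast
    then have "u \<in> K (Suc n)" using n JK[of n] ideal_adjoin(2)[OF Jid xc, of n] by blast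
    then obtain s v c where s: "s \<in> carrier R - P" "u \<in> carrier R" "s \<otimes> u = v \<oplus> c \<otimes> x" "v \<in> J (Suc n)" "c \<in> carrier R"
      unfolding K_def saturation_def ideal_adjoin_def by blast
    have vn: "v \<in> J n" using s(4) Jdec by blast
    then have vc: "v \<in> carrier R" using J.Icarr by blast
    have "x \<otimes> c = s \<otimes> u \<ominus> v" unfolding s(3) using xc vc s(5) by algebra
    also have "\<dots> \<in> J n" unfolding a_minus_def
      using J.a_closed[OF J.I_l_closed J.a_inv_closed] \<open>u \<in> J n\<close> vn s(1) by auto
    \<comment> \<open>\<open>J n\<close> is closed under division by \<open>x\<close> because
      \<open>x\<close> lies in \<open>S\<close>. So the multiple of \<open>x\<close> separating
      \<open>J n\<close> from \<open>J (Suc n)\<close> has its cofactor in \<open>J n\<close>, the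
      shape required by Nakayama's lemma as \<open>x\<close> is in \<open>P\<close>.\<close>
    finally have "c \<in> J n" using Jsat xS s(5) by blast
    then have "c \<in> lin_span (carrier R) (regular_module R) us" using Idl_eq_lin_span us by simp
    then have "x \<otimes> c \<in> lin_span P (regular_module R) us"
      using RM.lin_span_smult_coeff[OF P.is_ideal assms(6), of us c] us(1) by simp
    then have "s \<otimes> u \<in> {k \<oplus> q | k q. k \<in> J (Suc n) \<and> q \<in> lin_span P (regular_module R) us}"
      using s(3,4,5) xc by (auto simp: m_comm)
    then show "u \<in> saturation R P {k \<oplus> q | k q. k \<in> J (Suc n) \<and> q \<in> lin_span P (regular_module R) us}"
      by (rule saturationI[OF s(2,1)])
  qed
  then have "J n \<subseteq> J (Suc n)" using us genideal_minimal[OF Jid] by simp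
  then have "y [^] n \<in> J (Suc n)" using Ay[of n] AJ[of n] by blast
  then obtain s where "s \<in> S" "s \<otimes> y [^] n \<in> A (Suc n)"
    unfolding J_def saturation_def CS by blast
  then obtain a b v c where a: "a \<in> carrier R - P" "(a \<otimes> x [^] (b::nat)) \<otimes> y [^] n = v \<oplus> c \<otimes> y [^] Suc n"
    "v \<in> p0" "c \<in> carrier R"
    unfolding S_def A_def ideal_adjoin_def by blast
  have c: "a \<in> carrier R" "x [^] b \<in> carrier R" "y [^] n \<in> carrier R" "v \<in> carrier R"
    using a xc yc p0.Icarr by auto
  \<comment> \<open>As \<open>y\<close> is outside the prime p0, its power can be cancelled modulo
    p0. This puts a x^b into p1, although neither a nor x lies there.\<close>
  have "(a \<otimes> x [^] b \<ominus> c \<otimes> y) \<otimes> y [^] n = (a \<otimes> x [^] b) \<otimes> y [^] n \<ominus> c \<otimes> (y [^] n \<otimes> y)"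
    using c a(4) yc by algebra
  also have "\<dots> = (v \<oplus> c \<otimes> (y [^] n \<otimes> y)) \<ominus> c \<otimes> (y [^] n \<otimes> y)" unfolding a(2) by simp
  also have "\<dots> = v" using c a(4) yc by algebra
  finally have "(a \<otimes> x [^] b \<ominus> c \<otimes> y) \<otimes> y [^] n \<in> p0" using a(3) by simp
  then have "a \<otimes> x [^] b \<ominus> c \<otimes> y \<in> p0"
    using p0.I_prime[of "a \<otimes> x [^] b \<ominus> c \<otimes> y" "y [^] n"] p0.pow_mem[of y n] y c a(4) yc by auto
  then have "a \<otimes> x [^] b \<ominus> c \<otimes> y \<in> p1" using assms(4) by blast
  then have "(a \<otimes> x [^] b \<ominus> c \<otimes> y) \<oplus> c \<otimes> y \<in> p1" using p1.a_closed p1.I_l_closed y(1) a(4) by blast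
  moreover have "(a \<otimes> x [^] b \<ominus> c \<otimes> y) \<oplus> c \<otimes> y = a \<otimes> x [^] b" using c a(4) yc by algebra
  ultimately have "a \<in> p1 \<or> x [^] b \<in> p1" using p1.I_prime[of a "x [^] b"] c by simp
  then show False using a(1) assms(5) p1.pow_mem[of x b] xc xp1 by blast
qed

section \<open>Chains of prime ideals and heights\<close>

definition prime_chain :: "('a, 'r) ring_scheme \<Rightarrow> (nat \<Rightarrow> 'a set) \<Rightarrow> nat \<Rightarrow> bool" where
  "prime_chain R p n \<longleftrightarrow> (\<forall>i\<le>n. primeideal (p i) R) \<and> (\<forall>i<n. p i \<subset> p (Suc i))"

lemma prime_chain_Suc:
  "prime_chain R p (Suc n) \<longleftrightarrow> prime_chain R p n \<and> primeideal (p (Suc n)) R \<and> p n \<subset> p (Suc n)"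
  unfolding prime_chain_def by (auto simp: le_Suc_eq less_Suc_eq)

lemma prime_chain_carrier:
  assumes "prime_chain R p n" "i \<le> n"
  shows "p i \<subseteq> carrier R"
proof -
  interpret primeideal "p i" R using assms unfolding prime_chain_def by simp
  show ?thesis by (rule a_subset)
qed

lemma prime_chain_cong:
  "(\<And>i. i \<le> n \<Longrightarrow> p i = q i) \<Longrightarrow> prime_chain R p n \<longleftrightarrow> prime_chain R q n"
  unfolding prime_chain_def by (auto; metis Suc_leI order_less_imp_le)

text \<open>From the top downwards, a prime missing \<open>x\<close> is replaced by one that
  contains \<open>x\<close> and lies strictly between its neighbours, as supplied by the principal
  ideal theorem. Neither the endpoints nor the length change.\<close>

lemma (in noetherian_cring) prime_chain_through:
  assumes "prime_chain R p (Suc n)" "x \<in> p (Suc n)"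
  shows "\<exists>q. prime_chain R q (Suc n) \<and> q 0 = p 0 \<and> q (Suc n) = p (Suc n) \<and> x \<in> q (Suc 0)"
  using assms
proof (induction n arbitrary: p)
  case 0 then show ?case by blast
next
  case (Suc n)
  note ch = Suc.prems(1)
  have "\<exists>p'. prime_chain R p' (Suc n) \<and> p' 0 = p 0 \<and> x \<in> p' (Suc n) \<and> p' (Suc n) \<subset> p (Suc (Suc n))"
  proof (cases "x \<in> p (Suc n)")
    case True then show ?thesis using ch unfolding prime_chain_Suc[of _ _ "Suc n"] by blast
  next
    case False
    obtain Q where Q: "primeideal Q R" "p n \<subseteq> Q" "x \<in> Q" "Q \<subset> p (Suc (Suc n))"
      using principal_ideal_theorem[of "p n" "p (Suc n)" "p (Suc (Suc n))" x] ch Suc.prems(2)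
      unfolding prime_chain_def by auto
    have "p n \<subset> Q" using Q False ch unfolding prime_chain_Suc by blast
    moreover have "prime_chain R (p(Suc n := Q)) n \<longleftrightarrow> prime_chain R p n"
      by (rule prime_chain_cong) simp
    ultimately have "prime_chain R (p(Suc n := Q)) (Suc n)"
      unfolding prime_chain_Suc using ch Q by (simp add: prime_chain_Suc)
    then show ?thesis using Q by (intro exI[of _ "p(Suc n := Q)"]) simp
  qed
  then obtain p' where p': "prime_chain R p' (Suc n)" "p' 0 = p 0" "x \<in> p' (Suc n)" "p' (Suc n) \<subset> p (Suc (Suc n))"
    by blast
  obtain q where q: "prime_chain R q (Suc n)" "q 0 = p 0" "q (Suc n) = p' (Suc n)" "x \<in> q (Suc 0)"
    using Suc.IH[OF p'(1,3)] p'(2) by auto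
  let ?q = "q(Suc (Suc n) := p (Suc (Suc n)))"
  have "prime_chain R ?q (Suc n) \<longleftrightarrow> prime_chain R q (Suc n)" by (rule prime_chain_cong) simp
  then have "prime_chain R ?q (Suc (Suc n))"
    unfolding prime_chain_Suc[of _ _ "Suc n"] using q p'(4) ch by (simp add: prime_chain_Suc)
  moreover have "?q 0 = p 0" "?q (Suc (Suc n)) = p (Suc (Suc n))" "x \<in> ?q (Suc 0)" using q by simp_all
  ultimately show ?case by blast
qed

text \<open>Stated relative to the bottom prime \<open>p 0\<close> so that induction on the
  generators goes through: after rerouting through a prime \<open>q (Suc 0)\<close> that contains
  \<open>x\<close>, dropping \<open>p 0\<close> costs one step of the chain and one
  generator.\<close>

lemma (in noetherian_cring) prime_chain_length_le:
  assumes "prime_chain R p n" "p n \<subseteq> Idl (p 0 \<union> set xs)" "set xs \<subseteq> p n"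
  shows "n \<le> length xs"
  using assms
proof (induction xs arbitrary: p n)
  case Nil
  have "ideal (p 0) R" using Nil.prems(1) primeideal.axioms(1) unfolding prime_chain_def by blast
  then have "p n \<subseteq> p 0" using Nil.prems(2) genideal_minimal[of "p 0" "p 0"] by auto
  show ?case
  proof (cases n)
    case (Suc m)
    have "p 0 \<subseteq> p m" using Nil.prems(1) unfolding Suc prime_chain_Suc
    proof (induction m)
      case (Suc m) then show ?case unfolding prime_chain_Suc by blast
    qed simp
    then show ?thesis using Nil.prems(1) \<open>p n \<subseteq> p 0\<close> unfolding Suc prime_chain_Suc by blast
  qed simp
next
  case (Cons x xs)
  show ?case
  proof (cases n)
    case (Suc m)
    obtain q where q: "prime_chain R q (Suc m)" "q 0 = p 0" "q (Suc m) = p (Suc m)" "x \<in> q (Suc 0)"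
      using prime_chain_through[of p m x] Cons.prems unfolding Suc by auto
    have "m \<le> length xs"
    proof (rule Cons.IH[of "\<lambda>i. q (Suc i)"])
      show "prime_chain R (\<lambda>i. q (Suc i)) m" using q(1) unfolding prime_chain_def by auto
      show "set xs \<subseteq> q (Suc m)" using Cons.prems Suc q by auto
      have carr: "q (Suc 0) \<union> set xs \<subseteq> carrier R"
      proof -
        have "q (Suc 0) \<subseteq> carrier R" "p (Suc m) \<subseteq> carrier R"
          using prime_chain_carrier[OF q(1), of "Suc 0"] prime_chain_carrier[of R p n "Suc m"]
            Cons.prems(1) Suc by auto
        then show ?thesis using Cons.prems(3) Suc by auto
      qed
      have "p 0 \<subseteq> q (Suc 0)" using q(1,2) unfolding prime_chain_def by auto
      then have "Idl (p 0 \<union> set (x # xs)) \<subseteq> Idl (q (Suc 0) \<union> set xs)"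
        using genideal_self[OF carr] q(4) by (intro genideal_minimal genideal_ideal[OF carr]) auto
      then show "q (Suc m) \<subseteq> Idl (q (Suc 0) \<union> set xs)" using Cons.prems(2) q(3) Suc by auto
    qed
    then show ?thesis using Suc by simp
  qed simp
qed

section \<open>Regular sequences\<close>

text \<open>
  A sequence \<open>x1, \<dots>, xr\<close> is the list \<open>[xr, \<dots>, x1]\<close>, with the last element at the head;
  \<open>seq_mult M [xr, \<dots>, x1]\<close> is the submodule \<open>(x1, \<dots>, xr) M\<close>.
\<close>

primrec seq_mult :: "('a, 'b, 'm) module_scheme \<Rightarrow> 'a list \<Rightarrow> 'b set" where
  "seq_mult M [] = {\<zero>\<^bsub>M\<^esub>}"
| "seq_mult M (x # xs) = {x \<odot>\<^bsub>M\<^esub> u \<oplus>\<^bsub>M\<^esub> k | u k. u \<in> carrier M \<and> k \<in> seq_mult M xs}"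

text \<open>These are weakly regular sequences: the quotient by the sequence may vanish. Properness
  enters separately, through primes that contain the sequence.\<close>

primrec reg_seq :: "('a, 'b, 'm) module_scheme \<Rightarrow> 'a list \<Rightarrow> bool" where
  "reg_seq M [] \<longleftrightarrow> True"
| "reg_seq M (x # xs) \<longleftrightarrow>
     reg_seq M xs \<and> (\<forall>u\<in>carrier M. x \<odot>\<^bsub>M\<^esub> u \<in> seq_mult M xs \<longrightarrow> u \<in> seq_mult M xs)"

lemma seq_mult_ConsI:
  "u \<in> carrier M \<Longrightarrow> k \<in> seq_mult M xs \<Longrightarrow> x \<odot>\<^bsub>M\<^esub> u \<oplus>\<^bsub>M\<^esub> k \<in> seq_mult M (x # xs)"
  by auto

lemma (in module) seq_mult_submodule:
  assumes "set xs \<subseteq> carrier R"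
  shows "submodule (seq_mult M xs) R M"
  using assms
proof (induction xs)
  case Nil
  show ?case by (rule submoduleI) auto
next
  case (Cons x xs)
  then have sm: "submodule (seq_mult M xs) R M" and x: "x \<in> carrier R" by auto
  note E = submoduleE[OF sm]
  have z: "\<zero>\<^bsub>M\<^esub> \<in> seq_mult M xs" using subgroup.one_closed[OF submodule.axioms(1)[OF sm]] by simp
  have smult: "a \<odot>\<^bsub>M\<^esub> v \<in> seq_mult M (x # xs)" if a: "a \<in> carrier R" and v: "v \<in> seq_mult M (x # xs)" for a v
  proof -
    obtain u k where u: "v = x \<odot>\<^bsub>M\<^esub> u \<oplus>\<^bsub>M\<^esub> k" "u \<in> carrier M" "k \<in> seq_mult M xs" using v by auto
    have "k \<in> carrier M" using u E by blast
    then have "a \<odot>\<^bsub>M\<^esub> v = x \<odot>\<^bsub>M\<^esub> (a \<odot>\<^bsub>M\<^esub> u) \<oplus>\<^bsub>M\<^esub> a \<odot>\<^bsub>M\<^esub> k"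
      unfolding u(1) using u(2) a x by (simp add: smult_r_distr smult_assoc1[symmetric] R.m_comm)
    then show ?thesis using seq_mult_ConsI[of "a \<odot>\<^bsub>M\<^esub> u" M "a \<odot>\<^bsub>M\<^esub> k" xs x] u a E(4) by auto
  qed
  show ?case
  proof (rule submoduleI)
    show sub: "seq_mult M (x # xs) \<subseteq> carrier M" using E(1) x by auto
    show "\<zero>\<^bsub>M\<^esub> \<in> seq_mult M (x # xs)"
      using seq_mult_ConsI[OF M.zero_closed z, of x] x by simp
    fix v assume v: "v \<in> seq_mult M (x # xs)"
    then have "\<ominus>\<^bsub>M\<^esub> v = (\<ominus> \<one>) \<odot>\<^bsub>M\<^esub> v" using sub by (simp add: smult_l_minus subset_iff)
    then show "\<ominus>\<^bsub>M\<^esub> v \<in> seq_mult M (x # xs)" using smult[OF _ v, of "\<ominus> \<one>"] by simp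
    fix w assume w: "w \<in> seq_mult M (x # xs)"
    obtain u k u' k' where u: "v = x \<odot>\<^bsub>M\<^esub> u \<oplus>\<^bsub>M\<^esub> k" "u \<in> carrier M" "k \<in> seq_mult M xs"
      "w = x \<odot>\<^bsub>M\<^esub> u' \<oplus>\<^bsub>M\<^esub> k'" "u' \<in> carrier M" "k' \<in> seq_mult M xs" using v w by auto
    have "k \<in> carrier M" "k' \<in> carrier M" using u E by blast+
    then have "v \<oplus>\<^bsub>M\<^esub> w = x \<odot>\<^bsub>M\<^esub> (u \<oplus>\<^bsub>M\<^esub> u') \<oplus>\<^bsub>M\<^esub> (k \<oplus>\<^bsub>M\<^esub> k')"
      unfolding u(1,4) using u(2,5) x by (simp add: smult_r_distr M.a_ac)
    then show "v \<oplus>\<^bsub>M\<^esub> w \<in> seq_mult M (x # xs)"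
      using seq_mult_ConsI[of "u \<oplus>\<^bsub>M\<^esub> u'" M "k \<oplus>\<^bsub>M\<^esub> k'" xs x] u E(5) by auto
  qed (use smult in auto)
qed

lemma (in module) seq_mult_simps:
  assumes "set xs \<subseteq> carrier R"
  shows "seq_mult M xs \<subseteq> carrier M" "\<zero>\<^bsub>M\<^esub> \<in> seq_mult M xs"
    "v \<in> seq_mult M xs \<Longrightarrow> w \<in> seq_mult M xs \<Longrightarrow> v \<oplus>\<^bsub>M\<^esub> w \<in> seq_mult M xs"
    "v \<in> seq_mult M xs \<Longrightarrow> \<ominus>\<^bsub>M\<^esub> v \<in> seq_mult M xs"
    "v \<in> seq_mult M xs \<Longrightarrow> w \<in> seq_mult M xs \<Longrightarrow> v \<ominus>\<^bsub>M\<^esub> w \<in> seq_mult M xs"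
    "v \<in> seq_mult M xs \<Longrightarrow> a \<in> carrier R \<Longrightarrow> a \<odot>\<^bsub>M\<^esub> v \<in> seq_mult M xs"
  using submoduleE[OF seq_mult_submodule[OF assms]]
    subgroup.one_closed[OF submodule.axioms(1)[OF seq_mult_submodule[OF assms]]]
  by (auto simp: a_minus_def)

lemma (in module) seq_mult_Cons_le:
  assumes "set xs \<subseteq> carrier R" "x \<in> carrier R"
  shows "seq_mult M xs \<subseteq> seq_mult M (x # xs)"
proof
  fix k assume k: "k \<in> seq_mult M xs"
  then have "k = x \<odot>\<^bsub>M\<^esub> \<zero>\<^bsub>M\<^esub> \<oplus>\<^bsub>M\<^esub> k" using seq_mult_simps(1)[OF assms(1)] assms(2) by auto
  then show "k \<in> seq_mult M (x # xs)" using seq_mult_ConsI[OF M.zero_closed k] by metis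
qed

lemma (in cring) seq_mult_ideal:
  assumes "set xs \<subseteq> carrier R"
  shows "ideal (seq_mult (regular_module R) xs) R"
  using module.seq_mult_submodule[OF regular_module_module assms] submodule_regular_iff_ideal by blast

lemma (in cring) seq_mult_eq_Idl:
  assumes "set xs \<subseteq> carrier R"
  shows "seq_mult (regular_module R) xs = Idl (set xs)"
proof -
  have "seq_mult (regular_module R) xs = lin_span (carrier R) (regular_module R) xs"
    using assms
  proof (induction xs)
    case (Cons x xs)
    then have "x \<otimes> u = u \<otimes> x" if "u \<in> carrier R" for u using that by (simp add: m_comm)
    then show ?case using Cons by auto metis+
  qed simp
  then show ?thesis using Idl_eq_lin_span[OF assms] by simp
qed

text \<open>Each regular element adds a step at the top: as \<open>x\<close> is regular modulo the
  ideal of the preceding elements, some prime strictly inside \<open>p\<close> contains that ideal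
  and omits \<open>x\<close>, and the induction supplies a chain ending there.\<close>

lemma (in noetherian_cring) reg_seq_prime_chain:
  assumes "set xs \<subseteq> carrier R" "reg_seq (regular_module R) xs" "primeideal p R"
    "seq_mult (regular_module R) xs \<subseteq> p"
  shows "\<exists>q. prime_chain R q (length xs) \<and> q (length xs) = p"
  using assms
proof (induction xs arbitrary: p)
  case Nil
  then show ?case by (intro exI[of _ "\<lambda>_. p"]) (simp add: prime_chain_def)
next
  case (Cons x xs)
  interpret p: primeideal p R by fact
  define J where "J = seq_mult (regular_module R) xs"
  have x: "x \<in> carrier R" and xs: "set xs \<subseteq> carrier R" using Cons.prems by auto
  have J: "ideal J R" unfolding J_def by (rule seq_mult_ideal[OF xs])
  interpret J: ideal J R by fact
  have reg: "\<And>u. u \<in> carrier R \<Longrightarrow> x \<otimes> u \<in> J \<Longrightarrow> u \<in> J" using Cons.prems(2) unfolding J_def by auto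
  have J_le: "J \<subseteq> seq_mult (regular_module R) (x # xs)"
    unfolding J_def by (rule module.seq_mult_Cons_le[OF regular_module_module xs x])
  have xp: "x \<in> p"
    using Cons.prems(4) seq_mult_ConsI[of \<one> "regular_module R" \<zero> xs x] J.zero_closed x unfolding J_def by auto
  \<comment> \<open>A prime disjoint from \<open>S\<close> lies in \<open>p\<close> and omits
    \<open>x\<close>. Regularity cancels the powers of \<open>x\<close> modulo \<open>J\<close>, and
    \<open>J\<close> is inside \<open>p\<close>, so \<open>S\<close> misses
    \<open>J\<close>.\<close>
  define S where "S = {a \<otimes> x [^] k | a k. a \<in> carrier R - p \<and> k \<in> (UNIV :: nat set)}"
  have "\<exists>q. primeideal q R \<and> J \<subseteq> q \<and> q \<inter> S = {}"
  proof (rule ex_prime_disjoint[OF J])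
    show "S \<subseteq> carrier R" unfolding S_def using x by auto
    have "\<one> = \<one> \<otimes> x [^] (0::nat)" by simp
    then show "\<one> \<in> S" unfolding S_def using p.one_notin by blast
    fix s t assume "s \<in> S" "t \<in> S"
    then obtain a b c d where "s = a \<otimes> x [^] (b::nat)" "a \<in> carrier R - p" "t = c \<otimes> x [^] (d::nat)" "c \<in> carrier R - p"
      unfolding S_def by blast
    moreover from this have "s \<otimes> t = (a \<otimes> c) \<otimes> x [^] (b + d)"
      using x by (simp add: nat_pow_mult[symmetric] m_ac)
    moreover have "a \<otimes> c \<in> carrier R - p" using calculation(2,4) by (rule p.prod_notin)
    ultimately show "s \<otimes> t \<in> S" unfolding S_def by blast
  next
    have "a \<in> J" if "a \<in> carrier R" "a \<otimes> x [^] (k::nat) \<in> J" for a k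
      using that(2)
    proof (induction k)
      case (Suc k)
      then have "x \<otimes> (a \<otimes> x [^] k) \<in> J" using that(1) x by (simp add: m_ac)
      then have "a \<otimes> x [^] k \<in> J" by (rule reg[rotated]) (use that(1) x in simp)
      then show ?case by (rule Suc.IH)
    qed (use that(1) in simp)
    then have "a \<in> p" if "a \<in> carrier R" "a \<otimes> x [^] (k::nat) \<in> J" for a k
      using that J_le Cons.prems(4) by blast
    then show "J \<inter> S = {}" unfolding S_def by blast
  qed
  then obtain q where q: "primeideal q R" "J \<subseteq> q" "q \<inter> S = {}" by blast
  interpret q: primeideal q R by fact
  have "q \<subseteq> p"
  proof
    fix a assume a: "a \<in> q"
    then have "a = a \<otimes> x [^] (0::nat)" using q.Icarr by simp
    then show "a \<in> p" using q(3) a q.Icarr unfolding S_def by blast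
  qed
  moreover have "x \<notin> q"
  proof -
    have "x = \<one> \<otimes> x [^] (1::nat)" using x by simp
    then have "x \<in> S" unfolding S_def using p.one_notin by blast
    then show ?thesis using q(3) by blast
  qed
  ultimately have qp: "q \<subset> p" using xp by blast
  have "reg_seq (regular_module R) xs" using Cons.prems(2) by simp
  then obtain r where r: "prime_chain R r (length xs)" "r (length xs) = q"
    using Cons.IH[OF xs _ q(1)] q(2) unfolding J_def by blast
  let ?r = "r(Suc (length xs) := p)"
  have "prime_chain R ?r (length xs) \<longleftrightarrow> prime_chain R r (length xs)" by (rule prime_chain_cong) simp
  then have "prime_chain R ?r (Suc (length xs))"
    unfolding prime_chain_Suc using r qp Cons.prems(3) by simp
  then have "prime_chain R ?r (length (x # xs))" "?r (length (x # xs)) = p" by simp_all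
  then show ?case by blast
qed

lemma (in noetherian_local_ring) prime_chain_le_card:
  assumes "prime_chain R p n" "S \<subseteq> carrier R" "finite S" "Idl S = max_ideal R"
  shows "n \<le> card S"
proof -
  obtain xs where xs: "set xs = S" "length xs = card S"
    using finite_distinct_list[OF assms(3)] distinct_card by metis
  interpret m: primeideal "max_ideal R" R by (rule max_ideal_prime)
  have pr: "primeideal (p n) R" using assms(1) unfolding prime_chain_def by simp
  interpret pn: primeideal "p n" R by fact
  have "p n \<subseteq> max_ideal R" by (rule proper_ideal_le_max[OF pn.is_ideal pn.one_notin])
  have Sm: "S \<subseteq> max_ideal R" using genideal_self[OF assms(2)] assms(4) by simp
  have le: "Idl S \<subseteq> Idl (p 0 \<union> S)"
    using prime_chain_carrier[OF assms(1), of 0] assms(2) by (intro subset_Idl_subset) auto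
  show ?thesis
  proof (cases n)
    case (Suc k)
    \<comment> \<open>The top prime may be smaller than the maximal ideal; raising it keeps the
      chain strict and makes its top the ideal generated by \<open>S\<close>.\<close>
    define q where "q = p(n := max_ideal R)"
    have "prime_chain R q k \<longleftrightarrow> prime_chain R p k" unfolding q_def Suc by (rule prime_chain_cong) simp
    then have "prime_chain R q n"
      using assms(1) max_ideal_prime \<open>p n \<subseteq> max_ideal R\<close> unfolding Suc prime_chain_Suc
      by (auto simp: q_def Suc)
    moreover have "q 0 = p 0" "q n = max_ideal R" by (simp_all add: q_def Suc)
    ultimately show ?thesis
      using prime_chain_length_le[of q n xs] le assms(4) Sm xs by simp
  qed simp
qed

text \<open>Krull's bound gives dim \<le> edim. The sequence generates the maximal ideal, so edim
  \<le> length, and it is regular, so length \<le> dim; hence all three agree.\<close>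

lemma (in noetherian_local_ring) regular_if_max_ideal_reg_seq:
  assumes "set xs \<subseteq> carrier R" "reg_seq (regular_module R) xs"
    and "max_ideal R = seq_mult (regular_module R) xs"
  shows "regular_local_ring R"
proof -
  let ?E = "\<lambda>n. \<exists>S \<subseteq> carrier R. finite S \<and> card S = n \<and> Idl S = max_ideal R"
  have 1: "?E (card (set xs))" using assms(1,3) seq_mult_eq_Idl by auto
  then have "embedding_dim R \<le> card (set xs)" unfolding embedding_dim_def by (rule Least_le)
  then have le: "embedding_dim R \<le> length xs" using card_length[of xs] by simp
  obtain S where S: "S \<subseteq> carrier R" "finite S" "card S = embedding_dim R" "Idl S = max_ideal R"
    using LeastI[of ?E, OF 1] unfolding embedding_dim_def by blast
  obtain q where q: "prime_chain R q (length xs)"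
    using reg_seq_prime_chain[OF assms(1,2) max_ideal_prime] assms(3) by auto
  have "krull_dim R = enat (embedding_dim R)"
  proof (rule antisym)
    show "krull_dim R \<le> enat (embedding_dim R)"
      unfolding krull_dim_def using prime_chain_le_card[OF _ S(1,2,4)] S(3)
      by (intro SUP_least) (auto simp: prime_chain_def)
    have "enat (length xs) \<le> krull_dim R"
      unfolding krull_dim_def using q by (intro SUP_upper) (auto simp: prime_chain_def)
    then show "enat (embedding_dim R) \<le> krull_dim R" using le by (meson enat_ord_simps(1) order_trans)
  qed
  then show ?thesis unfolding regular_local_ring_def using noetherian_local_ring_axioms by simp
qed

section \<open>Prime avoidance and associated primes\<close>

text \<open>Take the product of one element outside \<open>p\<close> from each ideal; primality
  keeps the product outside.\<close>

lemma (in cring) ex_in_Inter_notin_prime: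
  assumes "finite Q" "primeideal p R" "\<And>J. J \<in> Q \<Longrightarrow> ideal J R" "\<And>J. J \<in> Q \<Longrightarrow> \<not> J \<subseteq> p"
  shows "\<exists>z\<in>carrier R. z \<notin> p \<and> (\<forall>J\<in>Q. z \<in> J)"
  using assms(1,3,4)
proof (induction Q)
  case empty
  then show ?case using primeideal.one_notin[OF assms(2)] by blast
next
  case (insert J Q)
  interpret p: primeideal p R by fact
  interpret J: ideal J R using insert by simp
  obtain z where z: "z \<in> carrier R" "z \<notin> p" "\<forall>J\<in>Q. z \<in> J" using insert by auto
  obtain w where w: "w \<in> J" "w \<notin> p" using insert by blast
  have wc: "w \<in> carrier R" using w J.Icarr by blast
  have "z \<otimes> w \<notin> p" using p.I_prime z w wc by blast
  moreover have "z \<otimes> w \<in> J'" if "J' \<in> insert J Q" for J'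
    using that ideal.I_l_closed[of J R w z] ideal.I_r_closed[of J' R z w] insert.prems(1) w(1) wc z by auto
  ultimately show ?case using z wc by (intro bexI[of _ "z \<otimes> w"]) auto
qed

text \<open>The ideal \<open>q\<close> may be non-prime, since it will be the square of the maximal
  ideal plus I; in exchange no prime of the family may contain it.\<close>

lemma (in cring) prime_avoidance:
  assumes "finite Ps" "\<And>p. p \<in> Ps \<Longrightarrow> primeideal p R" "ideal J R" "ideal q R" "\<not> J \<subseteq> q"
    "\<And>p. p \<in> Ps \<Longrightarrow> \<not> J \<subseteq> p" "\<And>p. p \<in> Ps \<Longrightarrow> \<not> q \<subseteq> p"
  shows "\<exists>x\<in>J. x \<notin> q \<and> (\<forall>p\<in>Ps. x \<notin> p)"
  using assms
proof (induction "card Ps" arbitrary: Ps rule: less_induct)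
  case less
  \<comment> \<open>A prime inside another one is avoided for free. In the remaining case the primes
    are pairwise incomparable, as the correction term below requires.\<close>
  show ?case
  proof (cases "\<exists>p\<in>Ps. \<exists>p'\<in>Ps. p' \<subset> p")
    case True
    then obtain p p' where p: "p \<in> Ps" "p' \<in> Ps" "p' \<subset> p" by blast
    have "\<exists>x\<in>J. x \<notin> q \<and> (\<forall>p\<in>Ps - {p'}. x \<notin> p)"
      using less.prems by (intro less.hyps[OF card_Diff1_less[OF less.prems(1) p(2)]]) simp_all
    then show ?thesis using p by blast
  next
    case anti: False
    show ?thesis
    proof (cases "Ps = {}")
      case False
      then obtain p where p: "p \<in> Ps" by blast
      have "\<exists>x\<in>J. x \<notin> q \<and> (\<forall>p\<in>Ps - {p}. x \<notin> p)"
        using less.prems by (intro less.hyps[OF card_Diff1_less[OF less.prems(1) p]]) simp_all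
      then obtain x where x: "x \<in> J" "x \<notin> q" "\<forall>p\<in>Ps - {p}. x \<notin> p" by blast
      show ?thesis
      proof (cases "x \<in> p")
        case True
        \<comment> \<open>The correction \<open>z\<close> lies in \<open>J\<close>, \<open>q\<close>
          and the other primes but outside \<open>p\<close>, so adding it to \<open>x\<close>
          changes membership in \<open>p\<close> only.\<close>
        have "\<exists>z\<in>carrier R. z \<notin> p \<and> (\<forall>I\<in>insert J (insert q (Ps - {p})). z \<in> I)"
        proof (rule ex_in_Inter_notin_prime)
          fix I assume I: "I \<in> insert J (insert q (Ps - {p}))"
          then show "ideal I R" using less.prems primeideal.axioms(1) by blast
          show "\<not> I \<subseteq> p"
          proof (cases "I \<in> Ps - {p}")
            case True then show ?thesis using anti p by blast
          next
            case False then show ?thesis using I less.prems p by blast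
          qed
        qed (use less.prems p in auto)
        then obtain z where z: "z \<in> carrier R" "z \<notin> p" "\<forall>I\<in>insert J (insert q (Ps - {p})). z \<in> I"
          by blast
        have cancel: "x \<in> I" if "ideal I R" "z \<in> I" "x \<oplus> z \<in> I" for I
        proof -
          interpret I: ideal I R by fact
          interpret J: ideal J R by (rule less.prems)
          have "x = (x \<oplus> z) \<ominus> z" using z(1) J.Icarr[OF x(1)] by algebra
          then show ?thesis using that I.a_closed I.a_inv_closed unfolding a_minus_def by metis
        qed
        have cancel': "z \<in> I" if "ideal I R" "x \<in> I" "x \<oplus> z \<in> I" for I
        proof -
          interpret I: ideal I R by fact
          have "z = (x \<oplus> z) \<ominus> x" using z(1) I.Icarr[OF that(2)] by algebra
          then show ?thesis using that I.a_closed I.a_inv_closed unfolding a_minus_def by metis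
        qed
        have "x \<oplus> z \<in> J" using x z less.prems(3) by (simp add: additive_subgroup.a_closed ideal.axioms(1))
        moreover have "x \<oplus> z \<notin> q" using cancel[OF less.prems(4)] z x by auto
        moreover have "x \<oplus> z \<notin> p'" if "p' \<in> Ps" for p'
          using cancel[of p'] cancel'[of p'] x z True less.prems(2)[OF that] that primeideal.axioms(1)
          by (cases "p' = p") auto
        ultimately show ?thesis by blast
      qed (use x p in blast)
    qed (use less.prems in blast)
  qed
qed

section \<open>Associated primes of a quotient module\<close>

lemma lin_span_mono_set:
  assumes "module R M" "set us \<subseteq> set vs" "set vs \<subseteq> carrier M"
  shows "lin_span (carrier R) M us \<subseteq> lin_span (carrier R) M vs"
proof -
  interpret module R M by fact
  show ?thesis
    using lin_span_gens[OF R.oneideal _ assms(3)] assms(2)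
    by (intro lin_span_least lin_span_submodule R.oneideal assms(3)) auto
qed

text \<open>Each of the finitely many generators of the submodule spanned by \<open>Y\<close>
  involves only finitely many elements of \<open>Y\<close>. This extracts a finite family from a
  possibly infinite set of annihilator witnesses.\<close>

lemma (in module) ex_span_of_subset:
  assumes "Y \<subseteq> carrier M"
    and fg: "\<And>N. submodule N R M \<Longrightarrow> \<exists>ns. set ns \<subseteq> carrier M \<and> N = lin_span (carrier R) M ns"
  shows "\<exists>ys. set ys \<subseteq> Y \<and> Y \<subseteq> lin_span (carrier R) M ys"
proof -
  let ?L = "lin_span (carrier R) M"
  define N where "N = {v. \<exists>ys. set ys \<subseteq> Y \<and> v \<in> ?L ys}"
  have L: "submodule (?L ys) R M" if "set ys \<subseteq> Y" for ys
    using that assms(1) by (intro lin_span_submodule R.oneideal) auto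
  have "submodule N R M"
  proof (rule submoduleI)
    show "N \<subseteq> carrier M" unfolding N_def using submoduleE(1)[OF L] by blast
    show "\<zero>\<^bsub>M\<^esub> \<in> N" unfolding N_def by (auto intro!: exI[of _ "[]"])
    show "\<ominus>\<^bsub>M\<^esub> a \<in> N" if a: "a \<in> N" for a
    proof -
      obtain ys where "set ys \<subseteq> Y" "a \<in> ?L ys" using a unfolding N_def by blast
      then show ?thesis using submoduleE(3)[OF L] unfolding N_def by blast
    qed
    show "a \<odot>\<^bsub>M\<^esub> x \<in> N" if a: "a \<in> carrier R" "x \<in> N" for a x
    proof -
      obtain ys where "set ys \<subseteq> Y" "x \<in> ?L ys" using a unfolding N_def by blast
      then show ?thesis using submoduleE(4)[OF L] a(1) unfolding N_def by blast
    qed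
    fix a b assume "a \<in> N" "b \<in> N"
    then obtain ys zs where yz: "a \<in> ?L ys" "set ys \<subseteq> Y" "b \<in> ?L zs" "set zs \<subseteq> Y" unfolding N_def by blast
    then have "set (ys @ zs) \<subseteq> Y" by simp
    moreover have "a \<in> ?L (ys @ zs)" "b \<in> ?L (ys @ zs)"
      using yz lin_span_mono_set[OF module_axioms, of ys "ys @ zs"]
        lin_span_mono_set[OF module_axioms, of zs "ys @ zs"] assms(1) by auto
    ultimately show "a \<oplus>\<^bsub>M\<^esub> b \<in> N" using submoduleE(5)[OF L[of "ys @ zs"]] unfolding N_def by blast
  qed
  then obtain ns where ns: "set ns \<subseteq> carrier M" "N = ?L ns" using fg by blast
  have "set ns \<subseteq> N" using lin_span_gens[OF R.oneideal _ ns(1)] ns(2) by simp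
  then have "\<exists>ys. set ys \<subseteq> Y \<and> set ns \<subseteq> ?L ys"
  proof (induction ns)
    case (Cons n ns)
    then obtain ys where ys: "set ys \<subseteq> Y" "set ns \<subseteq> ?L ys" by auto
    obtain zs where zs: "set zs \<subseteq> Y" "n \<in> ?L zs" using Cons.prems unfolding N_def by auto
    have "?L ys \<subseteq> ?L (ys @ zs)" "?L zs \<subseteq> ?L (ys @ zs)"
      using ys(1) zs(1) assms(1) by (intro lin_span_mono_set[OF module_axioms]; auto)+
    then show ?case using ys zs by (intro exI[of _ "ys @ zs"]) auto
  qed (auto intro: exI[of _ "[]"])
  then obtain ys where ys: "set ys \<subseteq> Y" "set ns \<subseteq> ?L ys" by blast
  have "Y \<subseteq> N"
  proof
    fix y assume y: "y \<in> Y"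
    then have "y \<in> ?L [y]" using assms(1) lin_span_gens[OF R.oneideal, of "[y]"] by auto
    then show "y \<in> N" unfolding N_def using y by (intro CollectI exI[of _ "[y]"]) simp
  qed
  also have "\<dots> \<subseteq> ?L ys" unfolding ns(2) by (rule lin_span_least[OF L[OF ys(1)] order_refl ys(2)])
  finally show ?thesis using ys by blast
qed

lemma (in module) colon_submodule_ideal:
  assumes "submodule K R M" "y \<in> carrier M"
  shows "ideal {a \<in> carrier R. a \<odot>\<^bsub>M\<^esub> y \<in> K} R"
proof (rule idealI[OF R.ring_axioms])
  note E = submoduleE[OF assms(1)]
  have z: "\<zero>\<^bsub>M\<^esub> \<in> K" using subgroup.one_closed[OF submodule.axioms(1)[OF assms(1)]] by simp
  show "subgroup {a \<in> carrier R. a \<odot>\<^bsub>M\<^esub> y \<in> K} (add_monoid R)"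
  proof (rule R.add.subgroupI)
    show "{a \<in> carrier R. a \<odot>\<^bsub>M\<^esub> y \<in> K} \<noteq> {}" using z assms(2) by (auto intro!: exI[of _ \<zero>])
  qed (use E assms(2) in \<open>auto simp: smult_l_minus smult_l_distr\<close>)
  fix a x assume a: "a \<in> {a \<in> carrier R. a \<odot>\<^bsub>M\<^esub> y \<in> K}" "x \<in> carrier R"
  then show "x \<otimes> a \<in> {a \<in> carrier R. a \<odot>\<^bsub>M\<^esub> y \<in> K}" using E(4) assms(2) by (auto simp: smult_assoc1)
  then show "a \<otimes> x \<in> {a \<in> carrier R. a \<odot>\<^bsub>M\<^esub> y \<in> K}" using a by (simp add: R.m_comm)
qed

text \<open>
  The maximal members of the family of annihilators of nonzero elements of \<open>M / K\<close> are prime;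
  there are finitely many of them since finitely many of the corresponding elements generate all.
\<close>

lemma (in module) finite_primes_cover_zero_divisors:
  assumes "noetherian_ring R" and K: "submodule K R M"
    and fg: "\<And>N. submodule N R M \<Longrightarrow> \<exists>ns. set ns \<subseteq> carrier M \<and> N = lin_span (carrier R) M ns"
  shows "\<exists>Ps. finite Ps \<and>
    (\<forall>p\<in>Ps. primeideal p R \<and> (\<exists>y\<in>carrier M - K. p = {a \<in> carrier R. a \<odot>\<^bsub>M\<^esub> y \<in> K})) \<and>
    (\<forall>x\<in>carrier R. (\<exists>u\<in>carrier M - K. x \<odot>\<^bsub>M\<^esub> u \<in> K) \<longrightarrow> (\<exists>p\<in>Ps. x \<in> p))"
proof -
  interpret NR: noetherian_ring R by fact
  note E = submoduleE[OF K]
  define c where "c y = {a \<in> carrier R. a \<odot>\<^bsub>M\<^esub> y \<in> K}" for y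
  have cid: "ideal (c y) R" if "y \<in> carrier M" for y unfolding c_def by (rule colon_submodule_ideal[OF K that])
  define C where "C = c ` (carrier M - K)"
  define Ps where "Ps = {p \<in> C. \<forall>p'\<in>C. p \<subseteq> p' \<longrightarrow> p' = p}"
  have prime: "primeideal p R" if p: "p \<in> Ps" for p
  proof -
    obtain y where y: "y \<in> carrier M" "y \<notin> K" "p = c y" using p unfolding Ps_def C_def by blast
    show ?thesis unfolding y(3)
    proof (rule primeidealI[OF cid[OF y(1)] R.is_cring])
      have "\<one> \<notin> c y" using y unfolding c_def by simp
      then show "carrier R \<noteq> c y" by auto
      fix a b assume ab: "a \<in> carrier R" "b \<in> carrier R" "a \<otimes> b \<in> c y"
      show "a \<in> c y \<or> b \<in> c y"
      proof (cases "a \<odot>\<^bsub>M\<^esub> y \<in> K")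
        case False
        then have "c (a \<odot>\<^bsub>M\<^esub> y) \<in> C" unfolding C_def using ab(1) y(1) by blast
        \<comment> \<open>Scaling \<open>y\<close> can only enlarge its annihilator modulo
          \<open>K\<close>, and maximality forbids a strict enlargement.\<close>
        moreover have "c y \<subseteq> c (a \<odot>\<^bsub>M\<^esub> y)"
        proof
          fix r assume r: "r \<in> c y"
          then have "r \<odot>\<^bsub>M\<^esub> (a \<odot>\<^bsub>M\<^esub> y) = a \<odot>\<^bsub>M\<^esub> (r \<odot>\<^bsub>M\<^esub> y)"
            using ab(1) y(1) unfolding c_def by (simp add: smult_assoc1[symmetric] R.m_comm)
          then show "r \<in> c (a \<odot>\<^bsub>M\<^esub> y)" using r E(4) ab(1) unfolding c_def by auto
        qed
        ultimately have "c (a \<odot>\<^bsub>M\<^esub> y) = c y" using p y(3) unfolding Ps_def by blast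
        moreover have "b \<in> c (a \<odot>\<^bsub>M\<^esub> y)"
          using ab y(1) unfolding c_def by (simp add: smult_assoc1[symmetric] R.m_comm)
        ultimately show ?thesis by blast
      qed (use ab in \<open>simp add: c_def\<close>)
    qed
  qed
  have cover: "\<exists>p\<in>Ps. x \<in> p" if x: "x \<in> carrier R" "u \<in> carrier M - K" "x \<odot>\<^bsub>M\<^esub> u \<in> K" for x u
  proof -
    have u: "ideal (c u) R" "c u \<in> C \<and> c u \<subseteq> c u" using cid x unfolding C_def by auto
    obtain p where p: "ideal p R" "p \<in> C \<and> c u \<subseteq> p"
      "\<And>I. ideal I R \<Longrightarrow> I \<in> C \<and> c u \<subseteq> I \<Longrightarrow> p \<subseteq> I \<Longrightarrow> I = p"
      by (rule NR.obtain_maximal_ideal[of "c u" "\<lambda>I. I \<in> C \<and> c u \<subseteq> I", OF u]) metis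
    have "p' = p" if p': "p' \<in> C" "p \<subseteq> p'" for p'
    proof (rule p(3)[OF _ _ p'(2)])
      show "ideal p' R" using p'(1) cid unfolding C_def by blast
      show "p' \<in> C \<and> c u \<subseteq> p'" using p(2) p' by (blast intro: subset_trans)
    qed
    then have "p \<in> Ps" unfolding Ps_def using p(2) by blast
    moreover have "x \<in> p" using p(2) x unfolding c_def by blast
    ultimately show ?thesis by blast
  qed
  define y where "y p = (SOME y. y \<in> carrier M - K \<and> p = c y)" for p
  have y: "y p \<in> carrier M - K \<and> p = c (y p)" if "p \<in> Ps" for p
  proof -
    have "\<exists>v. v \<in> carrier M - K \<and> p = c v" using that unfolding Ps_def C_def by blast
    then show ?thesis unfolding y_def by (rule someI_ex)
  qed
  \<comment> \<open>One witness has been chosen for each maximal annihilator; finitely many of them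
    span all the others.\<close>
  obtain ys where ys: "set ys \<subseteq> y ` Ps" "y ` Ps \<subseteq> lin_span (carrier R) M ys"
    using ex_span_of_subset[of "y ` Ps"] y fg by blast
  have ysc: "set ys \<subseteq> carrier M" using ys(1) y by blast
  have "p \<in> c ` set ys" if p: "p \<in> Ps" for p
  proof (rule ccontr)
    assume np: "p \<notin> c ` set ys"
    have max: "p' = p" if "p' \<in> C" "p' \<subseteq> p" "p' \<in> Ps" for p'
      using that p unfolding Ps_def by blast
    \<comment> \<open>Distinct maximal annihilators are incomparable, so some \<open>z\<close>
      outside \<open>p\<close> annihilates every member of \<open>ys\<close> modulo
      \<open>K\<close>. It then annihilates the span and with it the witness of \<open>p\<close>,
      which puts \<open>z\<close> into \<open>p\<close>.\<close>
    have "\<exists>z\<in>carrier R. z \<notin> p \<and> (\<forall>J\<in>c ` set ys. z \<in> J)"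
    proof (rule R.ex_in_Inter_notin_prime[OF _ prime[OF p]])
      fix J assume "J \<in> c ` set ys"
      then obtain v where v: "v \<in> set ys" "J = c v" by blast
      then obtain p' where p': "p' \<in> Ps" "v = y p'" using ys(1) by blast
      then have J: "J = p'" using y v by metis
      show "ideal J R" using cid v ysc by blast
      show "\<not> J \<subseteq> p"
      proof
        assume Jp: "J \<subseteq> p"
        have "p' \<in> C" using p'(1) unfolding Ps_def by simp
        then have "J = p" using max[of J] Jp p'(1) J by simp
        then show False using np v by blast
      qed
    qed simp
    then obtain z where z: "z \<in> carrier R" "z \<notin> p" and zJ: "\<forall>J\<in>c ` set ys. z \<in> J" by blast
    have zK: "z \<odot>\<^bsub>M\<^esub> v \<in> K" if "v \<in> set ys" for v
      using bspec[OF zJ, of "c v"] that unfolding c_def by simp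
    have "submodule {v \<in> carrier M. z \<odot>\<^bsub>M\<^esub> v \<in> K} R M"
    proof (rule submoduleI)
      have z0: "\<zero>\<^bsub>M\<^esub> \<in> K" using subgroup.one_closed[OF submodule.axioms(1)[OF K]] by simp
      show "\<zero>\<^bsub>M\<^esub> \<in> {v \<in> carrier M. z \<odot>\<^bsub>M\<^esub> v \<in> K}" using z0 z(1) by simp
      fix a x assume ax: "a \<in> carrier R" "x \<in> {v \<in> carrier M. z \<odot>\<^bsub>M\<^esub> v \<in> K}"
      then have "z \<odot>\<^bsub>M\<^esub> (a \<odot>\<^bsub>M\<^esub> x) = a \<odot>\<^bsub>M\<^esub> (z \<odot>\<^bsub>M\<^esub> x)"
        using z(1) by (simp add: smult_assoc1[symmetric] R.m_comm)
      then show "a \<odot>\<^bsub>M\<^esub> x \<in> {v \<in> carrier M. z \<odot>\<^bsub>M\<^esub> v \<in> K}" using ax E(4) by simp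
    qed (use z(1) E in \<open>auto simp: smult_r_distr smult_r_minus\<close>)
    then have "lin_span (carrier R) M ys \<subseteq> {v \<in> carrier M. z \<odot>\<^bsub>M\<^esub> v \<in> K}"
      using zK ysc by (intro lin_span_least) auto
    then have "z \<odot>\<^bsub>M\<^esub> y p \<in> K" using ys(2) p by blast
    then have "z \<in> c (y p)" unfolding c_def using z(1) by simp
    then show False using y[OF p] z(2) by blast
  qed
  then have "finite Ps" by (meson finite_imageI finite_set finite_subset subsetI)
  moreover have "\<exists>v\<in>carrier M - K. p = {a \<in> carrier R. a \<odot>\<^bsub>M\<^esub> v \<in> K}" if "p \<in> Ps" for p
    using y[OF that] unfolding c_def by blast
  ultimately show ?thesis using prime cover by (intro exI[of _ Ps] conjI) auto
qed

section \<open>Finitely generated modules over Noetherian rings\<close>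

text \<open>\<open>J\<close> collects the coefficients of \<open>m\<close> in elements of
  \<open>N\<close> and is finitely generated. Lifts to \<open>N\<close> of its generators, together
  with generators of the part of \<open>N\<close> in the span of \<open>ms\<close>, generate
  \<open>N\<close>.\<close>

lemma (in module) submodule_of_lin_span:
  assumes NR: "noetherian_ring R" and "set ms \<subseteq> carrier M" "submodule N R M" "N \<subseteq> lin_span (carrier R) M ms"
  shows "\<exists>ns. set ns \<subseteq> N \<and> N = lin_span (carrier R) M ns"
  using assms(2-)
proof (induction ms arbitrary: N)
  case Nil
  then have "N = {\<zero>\<^bsub>M\<^esub>}" using submoduleE(2)[OF Nil(2)] by auto
  then show ?case by (intro exI[of _ "[]"]) simp
next
  case (Cons m ms)
  let ?L = "lin_span (carrier R) M"
  interpret NR: noetherian_ring R by fact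
  have m: "m \<in> carrier M" and ms: "set ms \<subseteq> carrier M" using Cons.prems by auto
  note E = submoduleE[OF Cons.prems(2)]
  have sm: "submodule (?L ms) R M" by (rule lin_span_submodule[OF R.oneideal ms])
  note F = submoduleE[OF sm]
  have zN: "\<zero>\<^bsub>M\<^esub> \<in> N" using subgroup.one_closed[OF submodule.axioms(1)[OF Cons.prems(2)]] by simp
  have zL: "\<zero>\<^bsub>M\<^esub> \<in> ?L ms" using subgroup.one_closed[OF submodule.axioms(1)[OF sm]] by simp
  define J where "J = {a \<in> carrier R. \<exists>k\<in>?L ms. a \<odot>\<^bsub>M\<^esub> m \<oplus>\<^bsub>M\<^esub> k \<in> N}"
  have smul: "x \<otimes> a \<in> J" if ax: "a \<in> J" "x \<in> carrier R" for a x
  proof -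
    obtain k where k: "a \<in> carrier R" "k \<in> ?L ms" "a \<odot>\<^bsub>M\<^esub> m \<oplus>\<^bsub>M\<^esub> k \<in> N" using ax(1) unfolding J_def by blast
    have kc: "k \<in> carrier M" using k F by blast
    have "x \<odot>\<^bsub>M\<^esub> (a \<odot>\<^bsub>M\<^esub> m \<oplus>\<^bsub>M\<^esub> k) = (x \<otimes> a) \<odot>\<^bsub>M\<^esub> m \<oplus>\<^bsub>M\<^esub> x \<odot>\<^bsub>M\<^esub> k"
      using k kc m ax by (simp add: smult_r_distr smult_assoc1)
    then show ?thesis unfolding J_def using E(4)[OF ax(2) k(3)] F(4)[OF ax(2) k(2)] k ax by auto
  qed
  have "ideal J R"
  proof (rule idealI[OF R.ring_axioms])
    show "subgroup J (add_monoid R)"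
    proof (rule R.add.subgroupI)
      show "J \<subseteq> carrier R" unfolding J_def by blast
      have "\<zero> \<in> J" unfolding J_def using zL zN m by (auto intro!: bexI[of _ "\<zero>\<^bsub>M\<^esub>"])
      then show "J \<noteq> {}" by blast
      fix a assume a: "a \<in> J"
      then have "\<ominus> a = (\<ominus> \<one>) \<otimes> a" unfolding J_def by (simp add: R.l_minus)
      then show "\<ominus> a \<in> J" using smul[OF a, of "\<ominus> \<one>"] by simp
      fix b assume b: "b \<in> J"
      obtain k l where k: "a \<in> carrier R" "k \<in> ?L ms" "a \<odot>\<^bsub>M\<^esub> m \<oplus>\<^bsub>M\<^esub> k \<in> N"
        and l: "b \<in> carrier R" "l \<in> ?L ms" "b \<odot>\<^bsub>M\<^esub> m \<oplus>\<^bsub>M\<^esub> l \<in> N" using a b unfolding J_def by blast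
      have c: "k \<in> carrier M" "l \<in> carrier M" using k l F by blast+
      have "(a \<oplus> b) \<odot>\<^bsub>M\<^esub> m \<oplus>\<^bsub>M\<^esub> (k \<oplus>\<^bsub>M\<^esub> l) = (a \<odot>\<^bsub>M\<^esub> m \<oplus>\<^bsub>M\<^esub> k) \<oplus>\<^bsub>M\<^esub> (b \<odot>\<^bsub>M\<^esub> m \<oplus>\<^bsub>M\<^esub> l)"
        using k(1) l(1) c m by (simp add: smult_l_distr M.a_ac)
      then have "(a \<oplus> b) \<odot>\<^bsub>M\<^esub> m \<oplus>\<^bsub>M\<^esub> (k \<oplus>\<^bsub>M\<^esub> l) \<in> N" using E(5)[OF k(3) l(3)] by simp
      then show "a \<oplus> b \<in> J" unfolding J_def using F(5)[OF k(2) l(2)] k(1) l(1) by blast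
    qed
    fix a x assume "a \<in> J" "x \<in> carrier R"
    then show "x \<otimes> a \<in> J" by (rule smul)
    then show "a \<otimes> x \<in> J" using \<open>a \<in> J\<close> \<open>x \<in> carrier R\<close> unfolding J_def by (simp add: R.m_comm)
  qed
  then obtain as where as: "set as \<subseteq> carrier R" "J = Idl (set as)"
    using NR.finetely_gen finite_list by metis
  then have J: "J = lin_span (carrier R) (regular_module R) as" using R.Idl_eq_lin_span by simp
  have asJ: "set as \<subseteq> J" using as R.genideal_self by blast
  have ex: "\<exists>v. v \<in> N \<and> (\<exists>k\<in>?L ms. v = a \<odot>\<^bsub>M\<^esub> m \<oplus>\<^bsub>M\<^esub> k)" if "a \<in> J" for a
    using that unfolding J_def by blast
  define g where "g a = (SOME v. v \<in> N \<and> (\<exists>k\<in>?L ms. v = a \<odot>\<^bsub>M\<^esub> m \<oplus>\<^bsub>M\<^esub> k))" for a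
  have g: "g a \<in> N" "\<exists>k\<in>?L ms. g a = a \<odot>\<^bsub>M\<^esub> m \<oplus>\<^bsub>M\<^esub> k" if "a \<in> J" for a
    using someI_ex[OF ex[OF that]] unfolding g_def by blast+
  have comb: "\<exists>w\<in>?L (map g bs). \<exists>k\<in>?L ms. w = a \<odot>\<^bsub>M\<^esub> m \<oplus>\<^bsub>M\<^esub> k"
    if "set bs \<subseteq> J" "a \<in> lin_span (carrier R) (regular_module R) bs" for a bs
    using that
  proof (induction bs arbitrary: a)
    case Nil then show ?case using zL m by (auto intro!: bexI[of _ "\<zero>\<^bsub>M\<^esub>"])
  next
    case (Cons b bs)
    obtain p q where a: "a = p \<otimes> b \<oplus> q" "p \<in> carrier R" "q \<in> lin_span (carrier R) (regular_module R) bs"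
      using Cons.prems(2) by auto
    obtain w k where w: "w \<in> ?L (map g bs)" "k \<in> ?L ms" "w = q \<odot>\<^bsub>M\<^esub> m \<oplus>\<^bsub>M\<^esub> k"
      using Cons.IH[OF _ a(3)] Cons.prems(1) by auto
    obtain l where l: "l \<in> ?L ms" "g b = b \<odot>\<^bsub>M\<^esub> m \<oplus>\<^bsub>M\<^esub> l" using g(2)[of b] Cons.prems(1) by auto
    have bc: "b \<in> carrier R" "set bs \<subseteq> carrier R" using Cons.prems(1) unfolding J_def by auto
    have qc: "q \<in> carrier R" using a(3) bc(2) module.lin_span_closed[OF R.regular_module_module, of "carrier R" bs] by auto
    have c: "k \<in> carrier M" "l \<in> carrier M" using w l F by blast+
    have "p \<odot>\<^bsub>M\<^esub> g b \<oplus>\<^bsub>M\<^esub> w = a \<odot>\<^bsub>M\<^esub> m \<oplus>\<^bsub>M\<^esub> (p \<odot>\<^bsub>M\<^esub> l \<oplus>\<^bsub>M\<^esub> k)"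
      unfolding l(2) w(3) a(1) using c bc qc a(2) m
      by (simp add: smult_l_distr smult_r_distr smult_assoc1 M.a_ac)
    moreover have "p \<odot>\<^bsub>M\<^esub> l \<oplus>\<^bsub>M\<^esub> k \<in> ?L ms" using F a(2) l(1) w(2) by blast
    moreover have "p \<odot>\<^bsub>M\<^esub> g b \<oplus>\<^bsub>M\<^esub> w \<in> ?L (map g (b # bs))"
      using lin_span_ConsI[OF a(2) w(1)] by simp
    ultimately show ?case by blast
  qed
  have "submodule (N \<inter> ?L ms) R M"
    by (rule submoduleI) (use E F zN zL in auto)
  then obtain ns where ns: "set ns \<subseteq> N \<inter> ?L ms" "N \<inter> ?L ms = ?L ns" using Cons.IH[OF ms _ Int_lower2] by blast
  let ?ns = "map g as @ ns"
  have nsN: "set ?ns \<subseteq> N" using g(1) asJ ns(1) by auto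
  have nsc: "set ?ns \<subseteq> carrier M" using nsN E(1) by blast
  have "N \<subseteq> ?L ?ns"
  proof
    fix v assume v: "v \<in> N"
    then obtain a k where a: "v = a \<odot>\<^bsub>M\<^esub> m \<oplus>\<^bsub>M\<^esub> k" "a \<in> carrier R" "k \<in> ?L ms" using Cons.prems(3) by auto
    then have "a \<in> J" unfolding J_def using v by blast
    then obtain w l where w: "w \<in> ?L (map g as)" "l \<in> ?L ms" "w = a \<odot>\<^bsub>M\<^esub> m \<oplus>\<^bsub>M\<^esub> l"
      using comb[OF asJ] J by blast
    have wns: "w \<in> ?L ?ns" using w(1) lin_span_mono_set[OF module_axioms, of "map g as" ?ns] nsc by auto
    have "?L (map g as) \<subseteq> N" by (rule lin_span_least[OF Cons.prems(2)]) (use g(1) asJ in auto)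
    then have wN: "w \<in> N" using w(1) by blast
    have c: "k \<in> carrier M" "l \<in> carrier M" using a w F by blast+
    have "v \<ominus>\<^bsub>M\<^esub> w = k \<ominus>\<^bsub>M\<^esub> l"
      unfolding a(1) w(3) using c a(2) m by (simp add: a_minus_def M.minus_add M.a_ac M.r_neg1 M.r_neg2 M.r_neg M.l_neg)
    moreover have "v \<ominus>\<^bsub>M\<^esub> w \<in> N" unfolding a_minus_def using E v wN by blast
    moreover have "k \<ominus>\<^bsub>M\<^esub> l \<in> ?L ms" unfolding a_minus_def using F a w by blast
    ultimately have "v \<ominus>\<^bsub>M\<^esub> w \<in> ?L ns" using ns(2) by auto
    then have "v \<ominus>\<^bsub>M\<^esub> w \<in> ?L ?ns" using lin_span_mono_set[OF module_axioms, of ns ?ns] nsc by auto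
    then have "(v \<ominus>\<^bsub>M\<^esub> w) \<oplus>\<^bsub>M\<^esub> w \<in> ?L ?ns" using wns lin_span_add[OF R.oneideal nsc] by blast
    moreover have "(v \<ominus>\<^bsub>M\<^esub> w) \<oplus>\<^bsub>M\<^esub> w = v"
      using v wN E(1) by (simp add: a_minus_def M.a_assoc M.l_neg subset_iff)
    ultimately show "v \<in> ?L ?ns" by simp
  qed
  moreover have "?L ?ns \<subseteq> N" by (rule lin_span_least[OF Cons.prems(2) order_refl nsN])
  ultimately show ?case using nsN by blast
qed

lemma (in module) finitely_generated_span:
  assumes "finitely_generated_module R M"
  shows "\<exists>ms. set ms \<subseteq> carrier M \<and> carrier M = lin_span (carrier R) M ms"
proof -
  obtain S where S: "S \<subseteq> carrier M" "finite S" "\<Inter>{N. submodule N R M \<and> S \<subseteq> N} = carrier M"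
    using assms unfolding finitely_generated_module_def by blast
  obtain ms where ms: "set ms = S" using finite_list[OF S(2)] by blast
  have "submodule (lin_span (carrier R) M ms) R M" "S \<subseteq> lin_span (carrier R) M ms"
    using lin_span_submodule[OF R.oneideal, of ms] lin_span_gens[OF R.oneideal, of ms] S(1) ms by auto
  then have "carrier M \<subseteq> lin_span (carrier R) M ms" using S(3) by blast
  then show ?thesis using lin_span_closed[of "carrier R" ms] S(1) ms by blast
qed

lemma (in module) submodules_finitely_generated:
  assumes "noetherian_ring R" "finitely_generated_module R M" "submodule N R M"
  shows "\<exists>ns. set ns \<subseteq> carrier M \<and> N = lin_span (carrier R) M ns"
proof -
  obtain ms where "set ms \<subseteq> carrier M" "carrier M = lin_span (carrier R) M ms"
    using finitely_generated_span[OF assms(2)] by blast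
  then obtain ns where "set ns \<subseteq> N" "N = lin_span (carrier R) M ns"
    using submodule_of_lin_span[OF assms(1) _ assms(3), of ms] submoduleE(1)[OF assms(3)] by blast
  then show ?thesis using submoduleE(1)[OF assms(3)] by blast
qed

section \<open>Homomorphisms and direct sums\<close>

lemma mod_homD:
  assumes "f \<in> mod_hom R M N"
  shows "x \<in> carrier M \<Longrightarrow> f x \<in> carrier N"
    "x \<in> carrier M \<Longrightarrow> y \<in> carrier M \<Longrightarrow> f (x \<oplus>\<^bsub>M\<^esub> y) = f x \<oplus>\<^bsub>N\<^esub> f y"
    "a \<in> carrier R \<Longrightarrow> x \<in> carrier M \<Longrightarrow> f (a \<odot>\<^bsub>M\<^esub> x) = a \<odot>\<^bsub>N\<^esub> f x"
  using assms unfolding mod_hom_def by auto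

lemma mod_homI:
  assumes "\<And>x. x \<in> carrier M \<Longrightarrow> f x \<in> carrier N"
    "\<And>x y. x \<in> carrier M \<Longrightarrow> y \<in> carrier M \<Longrightarrow> f (x \<oplus>\<^bsub>M\<^esub> y) = f x \<oplus>\<^bsub>N\<^esub> f y"
    "\<And>a x. a \<in> carrier R \<Longrightarrow> x \<in> carrier M \<Longrightarrow> f (a \<odot>\<^bsub>M\<^esub> x) = a \<odot>\<^bsub>N\<^esub> f x"
  shows "f \<in> mod_hom R M N"
  using assms unfolding mod_hom_def by auto

lemma mod_hom_zero:
  assumes "module R M" "module R N" "f \<in> mod_hom R M N"
  shows "f \<zero>\<^bsub>M\<^esub> = \<zero>\<^bsub>N\<^esub>"
proof -
  interpret M: module R M by fact
  interpret N: module R N by fact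
  have "f (\<zero>\<^bsub>R\<^esub> \<odot>\<^bsub>M\<^esub> \<zero>\<^bsub>M\<^esub>) = \<zero>\<^bsub>R\<^esub> \<odot>\<^bsub>N\<^esub> f \<zero>\<^bsub>M\<^esub>" using mod_homD(3)[OF assms(3)] by blast
  then show ?thesis using mod_homD(1)[OF assms(3)] by simp
qed

lemma mod_hom_minus:
  assumes "module R M" "module R N" "f \<in> mod_hom R M N" "x \<in> carrier M" "y \<in> carrier M"
  shows "f (\<ominus>\<^bsub>M\<^esub> x) = \<ominus>\<^bsub>N\<^esub> f x" "f (x \<ominus>\<^bsub>M\<^esub> y) = f x \<ominus>\<^bsub>N\<^esub> f y"
proof -
  interpret M: module R M by fact
  interpret N: module R N by fact
  note D = mod_homD[OF assms(3)]
  have neg: "f (\<ominus>\<^bsub>M\<^esub> z) = \<ominus>\<^bsub>N\<^esub> f z" if z: "z \<in> carrier M" for z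
  proof -
    have "f (\<ominus>\<^bsub>M\<^esub> z) \<oplus>\<^bsub>N\<^esub> f z = \<zero>\<^bsub>N\<^esub>"
      using D(2)[of "\<ominus>\<^bsub>M\<^esub> z" z] z mod_hom_zero[OF assms(1-3)] by (simp add: M.M.l_neg)
    then show ?thesis using D(1) z N.M.minus_equality by force
  qed
  show "f (\<ominus>\<^bsub>M\<^esub> x) = \<ominus>\<^bsub>N\<^esub> f x" by (rule neg[OF assms(4)])
  show "f (x \<ominus>\<^bsub>M\<^esub> y) = f x \<ominus>\<^bsub>N\<^esub> f y"
    unfolding a_minus_def using D assms(4,5) neg by simp
qed

lemma mod_hom_compose:
  assumes "f \<in> mod_hom R M N" "g \<in> mod_hom R N L"
  shows "(\<lambda>x. g (f x)) \<in> mod_hom R M L"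
  by (rule mod_homI) (simp_all add: mod_homD[OF assms(1)] mod_homD[OF assms(2)])

lemma mod_hom_image_submodule:
  assumes "module R M" "module R N" "f \<in> mod_hom R M N"
  shows "submodule (f ` carrier M) R N"
proof -
  interpret M: module R M by fact
  interpret N: module R N by fact
  note D = mod_homD[OF assms(3)]
  show ?thesis
  proof (rule N.submoduleI)
    show "f ` carrier M \<subseteq> carrier N" using D(1) by blast
    show "\<zero>\<^bsub>N\<^esub> \<in> f ` carrier M" using mod_hom_zero[OF assms] imageI[OF M.M.zero_closed, of f] by simp
    fix a assume "a \<in> f ` carrier M"
    then obtain x where x: "x \<in> carrier M" "a = f x" by blast
    then show "\<ominus>\<^bsub>N\<^esub> a \<in> f ` carrier M"
      using mod_hom_minus(1)[OF assms x(1) x(1)] imageI[OF M.M.a_inv_closed[OF x(1)], of f] by simp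
    fix b assume "b \<in> f ` carrier M"
    then obtain y where y: "y \<in> carrier M" "b = f y" by blast
    then show "a \<oplus>\<^bsub>N\<^esub> b \<in> f ` carrier M" using D(2)[OF x(1) y(1)] x imageI[OF M.M.a_closed[OF x(1) y(1)], of f] by simp
  next
    fix a x assume a: "a \<in> carrier R" and "x \<in> f ` carrier M"
    then obtain y where y: "y \<in> carrier M" "x = f y" by blast
    then show "a \<odot>\<^bsub>N\<^esub> x \<in> f ` carrier M"
      using D(3)[OF a y(1)] imageI[OF M.smult_closed[OF a y(1)], of f] by simp
  qed
qed

lemma mod_hom_kernel_submodule:
  assumes "module R M" "module R N" "f \<in> mod_hom R M N"
  shows "submodule {x \<in> carrier M. f x = \<zero>\<^bsub>N\<^esub>} R M"
proof -
  interpret M: module R M by fact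
  interpret N: module R N by fact
  note D = mod_homD[OF assms(3)]
  show ?thesis
    by (rule M.submoduleI) (auto simp: D mod_hom_zero[OF assms] mod_hom_minus(1)[OF assms])
qed

lemma mod_hom_seq_mult:
  assumes "module R M" "module R N" "f \<in> mod_hom R M N" "set xs \<subseteq> carrier R" "v \<in> seq_mult M xs"
  shows "f v \<in> seq_mult N xs"
  using assms(4,5)
proof (induction xs arbitrary: v)
  case Nil then show ?case using mod_hom_zero[OF assms(1-3)] by simp
next
  case (Cons x xs)
  interpret M: module R M by fact
  note D = mod_homD[OF assms(3)]
  obtain u k where v: "v = x \<odot>\<^bsub>M\<^esub> u \<oplus>\<^bsub>M\<^esub> k" "u \<in> carrier M" "k \<in> seq_mult M xs" using Cons.prems by auto
  have "k \<in> carrier M" using M.seq_mult_simps(1)[of xs] v Cons.prems by auto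
  then have "f v = x \<odot>\<^bsub>N\<^esub> f u \<oplus>\<^bsub>N\<^esub> f k" unfolding v(1) using v D Cons.prems by simp
  then show ?case using seq_mult_ConsI[of "f u" N "f k" xs x] D v Cons by auto
qed

lemma mod_iso_inverse:
  assumes "module R M" "f \<in> mod_iso R M N"
  shows "inv_into (carrier M) f \<in> mod_iso R N M"
proof -
  interpret M: module R M by fact
  have f: "f \<in> mod_hom R M N" "bij_betw f (carrier M) (carrier N)" using assms(2) unfolding mod_iso_def by auto
  note D = mod_homD[OF f(1)]
  let ?g = "inv_into (carrier M) f"
  have g: "bij_betw ?g (carrier N) (carrier M)" by (rule bij_betw_inv_into[OF f(2)])
  have gc: "?g y \<in> carrier M" and fg: "f (?g y) = y" if "y \<in> carrier N" for y
    using that g f(2) by (auto simp: bij_betw_def f_inv_into_f)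
  have gf: "?g (f x) = x" if "x \<in> carrier M" for x using that f(2) by (simp add: bij_betw_def)
  have "?g \<in> mod_hom R N M"
  proof (rule mod_homI)
    fix x y assume xy: "x \<in> carrier N" "y \<in> carrier N"
    have "?g (x \<oplus>\<^bsub>N\<^esub> y) = ?g (f (?g x \<oplus>\<^bsub>M\<^esub> ?g y))" using D(2) xy gc fg by simp
    then show "?g (x \<oplus>\<^bsub>N\<^esub> y) = ?g x \<oplus>\<^bsub>M\<^esub> ?g y" using gf gc xy by simp
  next
    fix a x assume ax: "a \<in> carrier R" "x \<in> carrier N"
    have "?g (a \<odot>\<^bsub>N\<^esub> x) = ?g (f (a \<odot>\<^bsub>M\<^esub> ?g x))" using D(3) ax gc fg by simp
    then show "?g (a \<odot>\<^bsub>N\<^esub> x) = a \<odot>\<^bsub>M\<^esub> ?g x" using gf gc ax by simp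
  qed (rule gc)
  then show ?thesis using g unfolding mod_iso_def by simp
qed

lemma mod_iso_seq_mult_iff:
  assumes "module R M" "module R N" "f \<in> mod_iso R M N" "set xs \<subseteq> carrier R" "v \<in> carrier M"
  shows "f v \<in> seq_mult N xs \<longleftrightarrow> v \<in> seq_mult M xs"
proof
  have f: "f \<in> mod_hom R M N" "bij_betw f (carrier M) (carrier N)" using assms(3) unfolding mod_iso_def by auto
  have g: "inv_into (carrier M) f \<in> mod_hom R N M"
    using mod_iso_inverse[OF assms(1,3)] unfolding mod_iso_def by simp
  show "f v \<in> seq_mult N xs" if "v \<in> seq_mult M xs" by (rule mod_hom_seq_mult[OF assms(1,2) f(1) assms(4) that])
  show "v \<in> seq_mult M xs" if "f v \<in> seq_mult N xs"
    using mod_hom_seq_mult[OF assms(2,1) g assms(4) that] f(2) assms(5) by (simp add: bij_betw_def)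
qed

lemma mod_iso_reg_seq:
  assumes "module R M" "module R N" "f \<in> mod_iso R M N" "set xs \<subseteq> carrier R" "reg_seq N xs"
  shows "reg_seq M xs"
  using assms(4,5)
proof (induction xs)
  case (Cons x xs)
  interpret M: module R M by fact
  have f: "f \<in> mod_hom R M N" using assms(3) unfolding mod_iso_def by auto
  have "u \<in> seq_mult M xs" if u: "u \<in> carrier M" "x \<odot>\<^bsub>M\<^esub> u \<in> seq_mult M xs" for u
  proof -
    have "x \<odot>\<^bsub>N\<^esub> f u \<in> seq_mult N xs"
      using mod_hom_seq_mult[OF assms(1,2) f _ u(2)] mod_homD(3)[OF f] u Cons.prems by simp
    then have "f u \<in> seq_mult N xs" using Cons.prems mod_homD(1)[OF f u(1)] by simp
    then show ?thesis using mod_iso_seq_mult_iff[OF assms(1-3) _ u(1)] Cons.prems by simp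
  qed
  then show ?case using Cons by simp
qed simp

section \<open>Finite direct sums\<close>

lemma finite_direct_sum_simps [simp]:
  "carrier (finite_direct_sum I M) = (\<Pi>\<^sub>E i\<in>I. carrier (M i))"
  "zero (finite_direct_sum I M) = (\<lambda>i\<in>I. \<zero>\<^bsub>M i\<^esub>)"
  "add (finite_direct_sum I M) = (\<lambda>x y. \<lambda>i\<in>I. x i \<oplus>\<^bsub>M i\<^esub> y i)"
  "smult (finite_direct_sum I M) = (\<lambda>a x. \<lambda>i\<in>I. a \<odot>\<^bsub>M i\<^esub> x i)"
  by (simp_all add: finite_direct_sum_def)

lemma finite_direct_sum_module:
  assumes "cring R" "\<And>i. i \<in> I \<Longrightarrow> module R (M i)"
  shows "module R (finite_direct_sum I M)"
proof -
  have A: "abelian_group (M i)" if "i \<in> I" for i using module.axioms(2)[OF assms(2)[OF that]] .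
  note ag = abelian_groupE[OF A]
  have closed: "x i \<in> carrier (M i)" if "x \<in> (\<Pi>\<^sub>E i\<in>I. carrier (M i))" "i \<in> I" for x i
    using that by auto
  have add: "(\<lambda>i\<in>I. x i \<oplus>\<^bsub>M i\<^esub> y i) \<in> (\<Pi>\<^sub>E i\<in>I. carrier (M i))"
    if "x \<in> (\<Pi>\<^sub>E i\<in>I. carrier (M i))" "y \<in> (\<Pi>\<^sub>E i\<in>I. carrier (M i))" for x y
    using that ag(1) by (auto simp: PiE_iff)
  show ?thesis
  proof (rule moduleI[OF assms(1)], goal_cases)
    case 1
    show ?case
    proof (rule abelian_groupI, goal_cases)
      case 1 then show ?case using add by simp
    next
      case 2 then show ?case using ag(2) by auto
    next
      case (3 x y z)
      then have "x i \<oplus>\<^bsub>M i\<^esub> y i \<oplus>\<^bsub>M i\<^esub> z i = x i \<oplus>\<^bsub>M i\<^esub> (y i \<oplus>\<^bsub>M i\<^esub> z i)" if "i \<in> I" for i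
        using that ag(3)[OF that, of "x i" "y i" "z i"] by (simp add: PiE_iff)
      then show ?case by (auto intro!: restrict_ext)
    next
      case (4 x y)
      then have "x i \<oplus>\<^bsub>M i\<^esub> y i = y i \<oplus>\<^bsub>M i\<^esub> x i" if "i \<in> I" for i
        using that ag(4)[OF that, of "x i" "y i"] by (simp add: PiE_iff)
      then show ?case by (auto intro!: restrict_ext)
    next
      case (5 x)
      have "(\<lambda>i\<in>I. (\<lambda>i\<in>I. \<zero>\<^bsub>M i\<^esub>) i \<oplus>\<^bsub>M i\<^esub> x i) = x"
        by (rule PiE_ext[where k=I and s="\<lambda>i. carrier (M i)"])
          (use 5 add ag in \<open>auto simp: PiE_iff\<close>)
      then show ?case by simp
    next
      case (6 x)
      let ?y = "\<lambda>i\<in>I. \<ominus>\<^bsub>M i\<^esub> x i"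
      have "?y \<in> (\<Pi>\<^sub>E i\<in>I. carrier (M i))"
        using 6 abelian_group.a_inv_closed[OF A] by (auto simp: PiE_iff)
      moreover have "(\<lambda>i\<in>I. ?y i \<oplus>\<^bsub>M i\<^esub> x i) = (\<lambda>i\<in>I. \<zero>\<^bsub>M i\<^esub>)"
        using 6 abelian_group.l_neg[OF A] by (intro restrict_ext) (auto simp: PiE_iff)
      ultimately show ?case by (intro bexI[of _ ?y]) (simp_all only: finite_direct_sum_simps)
    qed
  next
    case (2 a x) then show ?case using module.smult_closed[OF assms(2)] by (auto simp: PiE_iff)
  next
    case (3 a b x)
    then show ?case using module.smult_l_distr[OF assms(2)] by (auto simp: PiE_iff intro!: restrict_ext)
  next
    case (4 a x y)
    then show ?case using module.smult_r_distr[OF assms(2)] by (auto simp: PiE_iff intro!: restrict_ext)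
  next
    case (5 a b x)
    then show ?case using module.smult_assoc1[OF assms(2)] by (auto simp: PiE_iff intro!: restrict_ext)
  next
    case (6 x)
    have "(\<lambda>i\<in>I. \<one>\<^bsub>R\<^esub> \<odot>\<^bsub>M i\<^esub> x i) = x"
      by (rule PiE_ext[where k=I and s="\<lambda>i. carrier (M i)"])
        (use 6 module.smult_one[OF assms(2)] in \<open>auto simp: PiE_iff\<close>)
    then show ?case by simp
  qed
qed

lemma finite_direct_sum_seq_mult:
  assumes "cring R" "\<And>i. i \<in> I \<Longrightarrow> module R (M i)" "set xs \<subseteq> carrier R" "v \<in> carrier (finite_direct_sum I M)"
  shows "v \<in> seq_mult (finite_direct_sum I M) xs \<longleftrightarrow> (\<forall>i\<in>I. v i \<in> seq_mult (M i) xs)"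
  using assms(3,4)
proof (induction xs arbitrary: v)
  case Nil
  then show ?case by (auto simp: PiE_iff extensional_def fun_eq_iff restrict_def)
next
  case (Cons x xs)
  let ?D = "finite_direct_sum I M"
  interpret D: module R ?D by (rule finite_direct_sum_module[OF assms(1,2)])
  show ?case
  proof
    assume "v \<in> seq_mult ?D (x # xs)"
    then obtain u k where v: "v = x \<odot>\<^bsub>?D\<^esub> u \<oplus>\<^bsub>?D\<^esub> k" "u \<in> carrier ?D" "k \<in> seq_mult ?D xs" by auto
    have "k \<in> carrier ?D" using D.seq_mult_simps(1)[of xs] v Cons.prems(1) by auto
    then have "\<forall>i\<in>I. k i \<in> seq_mult (M i) xs" using Cons v(3) by simp
    moreover have "v i = x \<odot>\<^bsub>M i\<^esub> u i \<oplus>\<^bsub>M i\<^esub> k i" if "i \<in> I" for i unfolding v(1) using that by simp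
    moreover have "u i \<in> carrier (M i)" if "i \<in> I" for i using v(2) that by auto
    ultimately show "\<forall>i\<in>I. v i \<in> seq_mult (M i) (x # xs)" using seq_mult_ConsI by metis
  next
    assume v: "\<forall>i\<in>I. v i \<in> seq_mult (M i) (x # xs)"
    then have "\<forall>i\<in>I. \<exists>u k. u \<in> carrier (M i) \<and> k \<in> seq_mult (M i) xs \<and> v i = x \<odot>\<^bsub>M i\<^esub> u \<oplus>\<^bsub>M i\<^esub> k" by auto
    then obtain u k where uk: "\<And>i. i \<in> I \<Longrightarrow> u i \<in> carrier (M i) \<and> k i \<in> seq_mult (M i) xs \<and> v i = x \<odot>\<^bsub>M i\<^esub> u i \<oplus>\<^bsub>M i\<^esub> k i"
      by metis
    let ?u = "\<lambda>i\<in>I. u i" and ?k = "\<lambda>i\<in>I. k i"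
    have u: "?u \<in> carrier ?D" using uk by simp
    have "k i \<in> carrier (M i)" if "i \<in> I" for i
      using uk[OF that] module.seq_mult_simps(1)[OF assms(2)[OF that], of xs] Cons.prems(1) by auto
    then have k: "?k \<in> carrier ?D" by simp
    then have "?k \<in> seq_mult ?D xs" using Cons uk by simp
    moreover have "v = x \<odot>\<^bsub>?D\<^esub> ?u \<oplus>\<^bsub>?D\<^esub> ?k"
      using uk Cons.prems(2) by (auto simp: PiE_iff extensional_def fun_eq_iff restrict_def)
    ultimately show "v \<in> seq_mult ?D (x # xs)" using seq_mult_ConsI[OF u, of ?k xs x] by simp
  qed
qed

lemma finite_direct_sum_reg_seq:
  assumes "cring R" "\<And>i. i \<in> I \<Longrightarrow> module R (M i)" "set xs \<subseteq> carrier R" "\<And>i. i \<in> I \<Longrightarrow> reg_seq (M i) xs"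
  shows "reg_seq (finite_direct_sum I M) xs"
  using assms(3,4)
proof (induction xs)
  case (Cons x xs)
  let ?D = "finite_direct_sum I M"
  interpret D: module R ?D by (rule finite_direct_sum_module[OF assms(1,2)])
  have xs: "set xs \<subseteq> carrier R" "x \<in> carrier R" using Cons.prems(1) by auto
  have "u \<in> seq_mult ?D xs" if u: "u \<in> carrier ?D" "x \<odot>\<^bsub>?D\<^esub> u \<in> seq_mult ?D xs" for u
  proof -
    have "x \<odot>\<^bsub>?D\<^esub> u \<in> carrier ?D" using u(1) xs D.smult_closed by blast
    from finite_direct_sum_seq_mult[OF assms(1,2) xs(1) this]
    have "\<forall>i\<in>I. x \<odot>\<^bsub>M i\<^esub> u i \<in> seq_mult (M i) xs" using u(2) by simp
    then have "\<forall>i\<in>I. u i \<in> seq_mult (M i) xs" using Cons.prems(2) u(1) by (auto simp: PiE_iff)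
    then show ?thesis using finite_direct_sum_seq_mult[OF assms(1,2) xs(1) u(1)] by blast
  qed
  then show ?case using Cons by simp
qed simp

section \<open>Free modules and Hom modules\<close>

lemma free_module_simps [simp]:
  "carrier (free_module R n) = ({..<n} \<rightarrow>\<^sub>E carrier R)"
  "zero (free_module R n) = (\<lambda>i\<in>{..<n}. \<zero>\<^bsub>R\<^esub>)"
  "add (free_module R n) = (\<lambda>x y. \<lambda>i\<in>{..<n}. x i \<oplus>\<^bsub>R\<^esub> y i)"
  "smult (free_module R n) = (\<lambda>a x. \<lambda>i\<in>{..<n}. a \<otimes>\<^bsub>R\<^esub> x i)"
  by (simp_all add: free_module_def)

lemma (in cring) free_module_module: "module R (free_module R n)"
  unfolding free_module_def by (rule finite_direct_sum_module[OF is_cring regular_module_module])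

lemma (in cring) free_module_seq_mult:
  assumes "set xs \<subseteq> carrier R" "v \<in> carrier (free_module R n)"
  shows "v \<in> seq_mult (free_module R n) xs \<longleftrightarrow> (\<forall>i<n. v i \<in> seq_mult (regular_module R) xs)"
  using finite_direct_sum_seq_mult[OF is_cring, of "{..<n}" "\<lambda>_. regular_module R" xs v] assms
    regular_module_module unfolding free_module_def by auto

lemma (in cring) free_module_reg_seq:
  assumes "set xs \<subseteq> carrier R" "reg_seq (regular_module R) xs"
  shows "reg_seq (free_module R n) xs"
  unfolding free_module_def
  by (rule finite_direct_sum_reg_seq[OF is_cring regular_module_module assms])

section \<open>Basis vectors and linear combinations\<close>

definition basis_vec :: "('a, 'r) ring_scheme \<Rightarrow> nat \<Rightarrow> nat \<Rightarrow> nat \<Rightarrow> 'a" where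
  "basis_vec R n i = (\<lambda>j\<in>{..<n}. if j = i then \<one>\<^bsub>R\<^esub> else \<zero>\<^bsub>R\<^esub>)"

lemma (in cring) basis_vec_closed: "basis_vec R n i \<in> carrier (free_module R n)"
  by (simp add: basis_vec_def)

primrec lin_comb :: "('a, 'b, 'm) module_scheme \<Rightarrow> (nat \<Rightarrow> 'b) \<Rightarrow> (nat \<Rightarrow> 'a) \<Rightarrow> nat \<Rightarrow> 'b" where
  "lin_comb M m v 0 = \<zero>\<^bsub>M\<^esub>"
| "lin_comb M m v (Suc k) = lin_comb M m v k \<oplus>\<^bsub>M\<^esub> v k \<odot>\<^bsub>M\<^esub> m k"

lemma lin_comb_cong:
  assumes "\<And>i. i < k \<Longrightarrow> v i = w i" "\<And>i. i < k \<Longrightarrow> m i = m' i"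
  shows "lin_comb M m v k = lin_comb M m' w k"
  using assms by (induction k) auto

lemma (in module) lin_comb_closed:
  assumes "\<And>i. i < k \<Longrightarrow> v i \<in> carrier R" "\<And>i. i < k \<Longrightarrow> m i \<in> carrier M"
  shows "lin_comb M m v k \<in> carrier M"
  using assms by (induction k) auto

lemma (in module) lin_comb_add:
  assumes "\<And>i. i < k \<Longrightarrow> v i \<in> carrier R" "\<And>i. i < k \<Longrightarrow> w i \<in> carrier R" "\<And>i. i < k \<Longrightarrow> m i \<in> carrier M"
  shows "lin_comb M m (\<lambda>i. v i \<oplus> w i) k = lin_comb M m v k \<oplus>\<^bsub>M\<^esub> lin_comb M m w k"
  using assms
proof (induction k)
  case (Suc k)
  then show ?case by (simp add: smult_l_distr lin_comb_closed M.a_ac)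
qed simp

lemma (in module) lin_comb_smult:
  assumes "\<And>i. i < k \<Longrightarrow> v i \<in> carrier R" "a \<in> carrier R" "\<And>i. i < k \<Longrightarrow> m i \<in> carrier M"
  shows "lin_comb M m (\<lambda>i. a \<otimes> v i) k = a \<odot>\<^bsub>M\<^esub> lin_comb M m v k"
  using assms
proof (induction k)
  case (Suc k)
  then show ?case by (simp add: smult_r_distr smult_assoc1 lin_comb_closed)
qed simp

lemma (in module) lin_comb_hom:
  assumes "\<And>i. i < n \<Longrightarrow> m i \<in> carrier M"
  shows "(\<lambda>v. lin_comb M m v n) \<in> mod_hom R (free_module R n) M"
proof (rule mod_homI)
  show "lin_comb M m v n \<in> carrier M" if "v \<in> carrier (free_module R n)" for v
    using that assms by (intro lin_comb_closed) auto
  fix v w assume v: "v \<in> carrier (free_module R n)" "w \<in> carrier (free_module R n)"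
  have "lin_comb M m (v \<oplus>\<^bsub>free_module R n\<^esub> w) n = lin_comb M m (\<lambda>i. v i \<oplus> w i) n"
    by (rule lin_comb_cong) simp_all
  also have "\<dots> = lin_comb M m v n \<oplus>\<^bsub>M\<^esub> lin_comb M m w n"
    by (rule lin_comb_add) (use v assms in auto)
  finally show "lin_comb M m (v \<oplus>\<^bsub>free_module R n\<^esub> w) n = lin_comb M m v n \<oplus>\<^bsub>M\<^esub> lin_comb M m w n" .
next
  fix a v assume v: "a \<in> carrier R" "v \<in> carrier (free_module R n)"
  have "lin_comb M m (a \<odot>\<^bsub>free_module R n\<^esub> v) n = lin_comb M m (\<lambda>i. a \<otimes> v i) n"
    by (rule lin_comb_cong) simp_all
  also have "\<dots> = a \<odot>\<^bsub>M\<^esub> lin_comb M m v n"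
    by (rule lin_comb_smult) (use v assms in auto)
  finally show "lin_comb M m (a \<odot>\<^bsub>free_module R n\<^esub> v) n = a \<odot>\<^bsub>M\<^esub> lin_comb M m v n" .
qed

lemma (in module) lin_comb_basis_vec:
  assumes "\<And>i. i < n \<Longrightarrow> m i \<in> carrier M" "i < n"
  shows "lin_comb M m (basis_vec R n i) n = m i"
proof -
  have "lin_comb M m (basis_vec R n i) k = (if i < k then m i else \<zero>\<^bsub>M\<^esub>)" if "k \<le> n" for k
    using that
  proof (induction k)
    case (Suc k)
    then show ?case using assms by (auto simp: basis_vec_def less_Suc_eq)
  qed simp
  then show ?thesis using assms(2) by simp
qed

lemma (in module) mod_hom_free_eq_lin_comb:
  assumes "f \<in> mod_hom R (free_module R n) M" "v \<in> carrier (free_module R n)"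
  shows "f v = lin_comb M (\<lambda>i. f (basis_vec R n i)) v n"
proof -
  \<comment> \<open>\<open>t k\<close> keeps the first \<open>k\<close> coordinates of
    \<open>v\<close>, so it grows from zero to \<open>v\<close> by one multiple of a basis vector at
    a time.\<close>
  define t where "t k = (\<lambda>j\<in>{..<n}. if j < k then v j else \<zero>)" for k
  note D = mod_homD[OF assms(1)]
  interpret F: module R "free_module R n" by (rule R.free_module_module)
  have vc: "v i \<in> carrier R" if "i < n" for i using assms(2) that by auto
  have tc: "t k \<in> carrier (free_module R n)" for k unfolding t_def using vc by simp
  have "f (t k) = lin_comb M (\<lambda>i. f (basis_vec R n i)) v k" if "k \<le> n" for k
    using that
  proof (induction k)
    case 0
    have "t 0 = \<zero>\<^bsub>free_module R n\<^esub>" unfolding t_def by simp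
    then have "f (t 0) = \<zero>\<^bsub>M\<^esub>" using mod_hom_zero[OF F.module_axioms module_axioms assms(1)] by (simp only:)
    then show ?case by simp
  next
    case (Suc k)
    have b: "basis_vec R n k \<in> carrier (free_module R n)" by (rule R.basis_vec_closed)
    have "t (Suc k) = t k \<oplus>\<^bsub>free_module R n\<^esub> (v k \<odot>\<^bsub>free_module R n\<^esub> basis_vec R n k)"
      unfolding t_def basis_vec_def using Suc.prems vc by (auto intro!: restrict_ext simp: less_Suc_eq)
    then have "f (t (Suc k)) = f (t k) \<oplus>\<^bsub>M\<^esub> v k \<odot>\<^bsub>M\<^esub> f (basis_vec R n k)"
      using D(2)[OF tc[of k] F.smult_closed[OF _ b, of "v k"]] D(3)[OF _ b, of "v k"] vc[of k] Suc.prems by simp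
    then show ?case using Suc by simp
  qed
  moreover have "t n = v" unfolding t_def using assms(2) by (auto simp: PiE_iff extensional_def fun_eq_iff)
  ultimately show ?thesis by force
qed

lemma (in module) lin_span_lin_comb:
  assumes "set ms \<subseteq> carrier M"
  shows "(\<lambda>v. lin_comb M (\<lambda>i. ms ! i) v (length ms)) ` carrier (free_module R (length ms)) =
    lin_span (carrier R) M ms" (is "?f ` carrier ?F = ?L")
proof
  have mc: "ms ! i \<in> carrier M" if "i < length ms" for i using assms that by auto
  have f: "?f \<in> mod_hom R ?F M" by (rule lin_comb_hom[OF mc])
  have L: "submodule ?L R M" by (rule lin_span_submodule[OF R.oneideal assms])
  note E = submoduleE[OF L]
  have gens: "ms ! i \<in> ?L" if "i < length ms" for i
    using lin_span_gens[OF R.oneideal _ assms] that by auto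
  have "\<zero>\<^bsub>M\<^esub> \<in> ?L" using subgroup.one_closed[OF submodule.axioms(1)[OF L]] by simp
  then have "lin_comb M (\<lambda>i. ms ! i) v k \<in> ?L" if "k \<le> length ms" "\<And>i. i < k \<Longrightarrow> v i \<in> carrier R" for k v
    using that by (induction k) (auto intro!: E(4,5) gens)
  then show "?f ` carrier ?F \<subseteq> ?L" by auto
  have "ms ! i \<in> ?f ` carrier ?F" if i: "i < length ms" for i
    using lin_comb_basis_vec[OF mc i] imageI[OF R.basis_vec_closed, of ?f "length ms" i] by simp
  then have "set ms \<subseteq> ?f ` carrier ?F" by (auto simp: set_conv_nth)
  then show "?L \<subseteq> ?f ` carrier ?F"
    by (intro lin_span_least mod_hom_image_submodule[OF R.free_module_module module_axioms f]) auto
qed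

section \<open>Hom modules\<close>

lemma Hom_module_simps [simp]:
  "carrier (Hom_module R M N) = mod_hom R M N \<inter> extensional (carrier M)"
  "zero (Hom_module R M N) = (\<lambda>x\<in>carrier M. \<zero>\<^bsub>N\<^esub>)"
  "add (Hom_module R M N) = (\<lambda>f g. \<lambda>x\<in>carrier M. f x \<oplus>\<^bsub>N\<^esub> g x)"
  "smult (Hom_module R M N) = (\<lambda>a f. \<lambda>x\<in>carrier M. a \<odot>\<^bsub>N\<^esub> f x)"
  by (simp_all add: Hom_module_def)

lemma mod_hom_restrict:
  assumes "module R M" "f \<in> mod_hom R M N"
  shows "restrict f (carrier M) \<in> mod_hom R M N"
proof -
  interpret M: module R M by fact
  show ?thesis by (rule mod_homI) (simp_all add: mod_homD[OF assms(2)])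
qed

lemma Hom_module_eqI:
  assumes "f \<in> carrier (Hom_module R M N)" "g \<in> carrier (Hom_module R M N)"
    "\<And>x. x \<in> carrier M \<Longrightarrow> f x = g x"
  shows "f = g"
  using assms by (intro extensionalityI[of _ "carrier M"]) auto

lemma Hom_module_module:
  assumes "module R M" "module R N"
  shows "module R (Hom_module R M N)"
proof -
  interpret M: module R M by fact
  interpret N: module R N by fact
  let ?H = "Hom_module R M N"
  note D = mod_homD[of _ R M N]
  have add: "f \<oplus>\<^bsub>?H\<^esub> g \<in> carrier ?H" if "f \<in> carrier ?H" "g \<in> carrier ?H" for f g
  proof -
    have fg: "f \<in> mod_hom R M N" "g \<in> mod_hom R M N" using that by auto
    have "(\<lambda>x\<in>carrier M. f x \<oplus>\<^bsub>N\<^esub> g x) \<in> mod_hom R M N"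
      by (rule mod_homI) (auto simp: D[OF fg(1)] D[OF fg(2)] N.M.a_ac N.smult_r_distr)
    then show ?thesis by simp
  qed
  have smult: "a \<odot>\<^bsub>?H\<^esub> f \<in> carrier ?H" if "a \<in> carrier R" "f \<in> carrier ?H" for a f
  proof -
    have f: "f \<in> mod_hom R M N" using that by auto
    have "(\<lambda>x\<in>carrier M. a \<odot>\<^bsub>N\<^esub> f x) \<in> mod_hom R M N"
      using that(1)
      by (intro mod_homI) (auto simp: D[OF f] N.smult_r_distr N.smult_assoc1[symmetric] M.R.m_comm)
    then show ?thesis by simp
  qed
  have zero: "\<zero>\<^bsub>?H\<^esub> \<in> carrier ?H"
  proof -
    have "(\<lambda>x\<in>carrier M. \<zero>\<^bsub>N\<^esub>) \<in> mod_hom R M N" by (rule mod_homI) auto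
    then show ?thesis by simp
  qed
  have val: "f x \<in> carrier N" if "f \<in> carrier ?H" "x \<in> carrier M" for f x using D(1) that by auto
  show ?thesis
  proof (rule moduleI[OF M.R.is_cring])
    show "abelian_group ?H"
    proof (rule abelian_groupI)
      show "\<exists>g\<in>carrier ?H. g \<oplus>\<^bsub>?H\<^esub> f = \<zero>\<^bsub>?H\<^esub>" if f: "f \<in> carrier ?H" for f
      proof (rule bexI[OF _ smult[OF _ f]])
        show "((\<ominus>\<^bsub>R\<^esub> \<one>\<^bsub>R\<^esub>) \<odot>\<^bsub>?H\<^esub> f) \<oplus>\<^bsub>?H\<^esub> f = \<zero>\<^bsub>?H\<^esub>"
          by (rule Hom_module_eqI[OF add[OF smult[OF _ f] f] zero])
            (use val[OF f] in \<open>auto simp: N.smult_l_minus N.M.l_neg\<close>)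
      qed simp
      show "f \<oplus>\<^bsub>?H\<^esub> g \<oplus>\<^bsub>?H\<^esub> h = f \<oplus>\<^bsub>?H\<^esub> (g \<oplus>\<^bsub>?H\<^esub> h)"
        if "f \<in> carrier ?H" "g \<in> carrier ?H" "h \<in> carrier ?H" for f g h
        by (rule Hom_module_eqI[OF add[OF add] add[OF _ add]])
          (use that val in \<open>auto simp: N.M.a_assoc simp del: Hom_module_simps(1)\<close>)
      show "f \<oplus>\<^bsub>?H\<^esub> g = g \<oplus>\<^bsub>?H\<^esub> f" if "f \<in> carrier ?H" "g \<in> carrier ?H" for f g
        by (rule Hom_module_eqI[OF add add])
          (use that val in \<open>auto simp: N.M.a_comm simp del: Hom_module_simps(1)\<close>)
      show "\<zero>\<^bsub>?H\<^esub> \<oplus>\<^bsub>?H\<^esub> f = f" if "f \<in> carrier ?H" for f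
        by (rule Hom_module_eqI[OF add[OF zero]])
          (use that val in \<open>auto simp del: Hom_module_simps(1)\<close>)
    qed (use add zero in blast)+
    show "(a \<oplus>\<^bsub>R\<^esub> b) \<odot>\<^bsub>?H\<^esub> f = a \<odot>\<^bsub>?H\<^esub> f \<oplus>\<^bsub>?H\<^esub> b \<odot>\<^bsub>?H\<^esub> f"
      if "a \<in> carrier R" "b \<in> carrier R" "f \<in> carrier ?H" for a b f
      by (rule Hom_module_eqI[OF smult add[OF smult smult]])
        (use that val in \<open>auto simp: N.smult_l_distr simp del: Hom_module_simps(1)\<close>)
    show "a \<odot>\<^bsub>?H\<^esub> (f \<oplus>\<^bsub>?H\<^esub> g) = a \<odot>\<^bsub>?H\<^esub> f \<oplus>\<^bsub>?H\<^esub> a \<odot>\<^bsub>?H\<^esub> g"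
      if "a \<in> carrier R" "f \<in> carrier ?H" "g \<in> carrier ?H" for a f g
      by (rule Hom_module_eqI[OF smult[OF _ add] add[OF smult smult]])
        (use that val in \<open>auto simp: N.smult_r_distr simp del: Hom_module_simps(1)\<close>)
    show "(a \<otimes>\<^bsub>R\<^esub> b) \<odot>\<^bsub>?H\<^esub> f = a \<odot>\<^bsub>?H\<^esub> (b \<odot>\<^bsub>?H\<^esub> f)"
      if "a \<in> carrier R" "b \<in> carrier R" "f \<in> carrier ?H" for a b f
      by (rule Hom_module_eqI[OF smult smult[OF _ smult]])
        (use that val in \<open>auto simp: N.smult_assoc1 simp del: Hom_module_simps(1)\<close>)
    show "\<one>\<^bsub>R\<^esub> \<odot>\<^bsub>?H\<^esub> f = f" if "f \<in> carrier ?H" for f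
      by (rule Hom_module_eqI[OF smult])
        (use that val in \<open>auto simp del: Hom_module_simps(1)\<close>)
  qed (use smult in blast)
qed

text \<open>Identifying Hom from a free module with copies of \<open>N\<close> reduces regularity,
  and membership in I times Hom, to the images of the basis vectors.\<close>

lemma Hom_free_iso:
  assumes "module R N"
  shows "(\<lambda>f. \<lambda>i\<in>{..<n}. f (basis_vec R n i)) \<in>
    mod_iso R (Hom_module R (free_module R n) N) (finite_direct_sum {..<n} (\<lambda>_. N))"
    (is "?T \<in> mod_iso R ?H ?D")
proof -
  interpret N: module R N by fact
  have F: "module R (free_module R n)" by (rule N.R.free_module_module)
  note b = N.R.basis_vec_closed[of n]
  have "?T \<in> mod_hom R ?H ?D"
  proof (rule mod_homI)
    show "?T f \<in> carrier ?D" if "f \<in> carrier ?H" for f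
      using that b mod_homD(1)[of f R "free_module R n" N] by simp
    show "?T (f \<oplus>\<^bsub>?H\<^esub> g) = ?T f \<oplus>\<^bsub>?D\<^esub> ?T g" for f g
      using b by (auto intro!: restrict_ext simp del: free_module_simps)
    show "?T (a \<odot>\<^bsub>?H\<^esub> f) = a \<odot>\<^bsub>?D\<^esub> ?T f" for a f
      using b by (auto intro!: restrict_ext simp del: free_module_simps)
  qed
  moreover have "bij_betw ?T (carrier ?H) (carrier ?D)"
  proof (rule bij_betw_imageI)
    show "inj_on ?T (carrier ?H)"
    proof (rule inj_onI)
      fix f g assume fg: "f \<in> carrier ?H" "g \<in> carrier ?H" "?T f = ?T g"
      have eq: "f (basis_vec R n i) = g (basis_vec R n i)" if "i < n" for i
        using fun_cong[OF fg(3), of i] that by simp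
      have "f v = g v" if v: "v \<in> carrier (free_module R n)" for v
        using N.mod_hom_free_eq_lin_comb[of f n v] N.mod_hom_free_eq_lin_comb[of g n v] fg v
          lin_comb_cong[of n v v "\<lambda>i. f (basis_vec R n i)" "\<lambda>i. g (basis_vec R n i)" N] eq by simp
      then show "f = g" using Hom_module_eqI fg by blast
    qed
    show "?T ` carrier ?H = carrier ?D"
    proof
      show "?T ` carrier ?H \<subseteq> carrier ?D" using mod_homD(1)[OF calculation] by blast
      show "carrier ?D \<subseteq> ?T ` carrier ?H"
      proof
        fix m assume m: "m \<in> carrier ?D"
        then have mc: "m i \<in> carrier N" if "i < n" for i using that by auto
        let ?f = "\<lambda>v\<in>carrier (free_module R n). lin_comb N m v n"
        have "?f \<in> carrier ?H" using mod_hom_restrict[OF F N.lin_comb_hom[OF mc]] by simp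
        moreover have "?T ?f = m"
          using m b N.lin_comb_basis_vec[OF mc]
          by (auto simp: PiE_iff extensional_def fun_eq_iff simp del: free_module_simps)
        ultimately show "m \<in> ?T ` carrier ?H" by (intro image_eqI[of _ _ ?f]) (simp_all only:)
      qed
    qed
  qed
  ultimately show ?thesis unfolding mod_iso_def by simp
qed

lemma Hom_free_reg_seq:
  assumes "module R N" "set xs \<subseteq> carrier R" "reg_seq N xs"
  shows "reg_seq (Hom_module R (free_module R n) N) xs"
proof -
  interpret N: module R N by fact
  note F = N.R.free_module_module[of n]
  show ?thesis
    by (rule mod_iso_reg_seq[OF Hom_module_module[OF F assms(1)]
          finite_direct_sum_module[OF N.R.is_cring assms(1)] Hom_free_iso[OF assms(1)] assms(2)
          finite_direct_sum_reg_seq[OF N.R.is_cring assms(1,2,3)]])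
qed

text \<open>Freeness of the source makes values in I \<open>N\<close> sufficient: the images of the
  basis vectors are decomposed separately and reassembled into homomorphisms.\<close>

lemma Hom_free_seq_mult:
  assumes "module R N" "set xs \<subseteq> carrier R" "f \<in> carrier (Hom_module R (free_module R n) N)"
    and "\<And>v. v \<in> carrier (free_module R n) \<Longrightarrow> f v \<in> seq_mult N xs"
  shows "f \<in> seq_mult (Hom_module R (free_module R n) N) xs"
proof -
  interpret N: module R N by fact
  note F = N.R.free_module_module[of n]
  have D: "module R (finite_direct_sum {..<n} (\<lambda>_. N))"
    by (rule finite_direct_sum_module[OF N.R.is_cring assms(1)])
  have "(\<lambda>i\<in>{..<n}. f (basis_vec R n i)) \<in> carrier (finite_direct_sum {..<n} (\<lambda>_. N))"
    using mod_homD(1)[of f R "free_module R n" N] assms(3) N.R.basis_vec_closed[of n] by simp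
  then have "(\<lambda>i\<in>{..<n}. f (basis_vec R n i)) \<in> seq_mult (finite_direct_sum {..<n} (\<lambda>_. N)) xs"
    using finite_direct_sum_seq_mult[OF N.R.is_cring assms(1,2), where I = "{..<n}" and v = "\<lambda>i\<in>{..<n}. f (basis_vec R n i)"]
      assms(4)[OF N.R.basis_vec_closed] by simp
  then show ?thesis
    using mod_iso_seq_mult_iff[OF Hom_module_module[OF F assms(1)] D Hom_free_iso[OF assms(1)] assms(2,3)] by simp
qed

lemma Hom_module_seq_mult_apply:
  assumes "module R M" "module R N" "set xs \<subseteq> carrier R" "f \<in> seq_mult (Hom_module R M N) xs" "v \<in> carrier M"
  shows "f v \<in> seq_mult N xs"
proof -
  have "(\<lambda>f. f v) \<in> mod_hom R (Hom_module R M N) N"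
    by (rule mod_homI) (use assms(5) mod_homD(1) in auto)
  from mod_hom_seq_mult[OF Hom_module_module[OF assms(1,2)] assms(2) this assms(3,4)] show ?thesis .
qed

section \<open>Cocycles modulo a regular sequence\<close>

text \<open>An elementwise form of the long exact sequence for multiplication by \<open>x\<close>.
  Exactness is assumed in positive degrees, so in degree 0 a cocycle modulo I lifts to a genuine
  cocycle; this is what turns a map L \<rightarrow> L/IL into an endomorphism of L.\<close>

lemma cocycle_lift:
  assumes H: "\<And>i. module R (H i)" and hom: "\<And>i. \<delta> i \<in> mod_hom R (H i) (H (Suc i))"
    and \<delta>\<delta>: "\<And>i u. u \<in> carrier (H i) \<Longrightarrow> \<delta> (Suc i) (\<delta> i u) = \<zero>\<^bsub>H (Suc (Suc i))\<^esub>"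
    and exact: "\<And>i z. z \<in> carrier (H (Suc i)) \<Longrightarrow> \<delta> (Suc i) z = \<zero>\<^bsub>H (Suc (Suc i))\<^esub> \<Longrightarrow>
      \<exists>u\<in>carrier (H i). z = \<delta> i u"
    and "set xs \<subseteq> carrier R" "\<And>i. reg_seq (H i) xs"
    and "f \<in> carrier (H i)" "\<delta> i f \<in> seq_mult (H (Suc i)) xs"
  shows "\<exists>k\<in>seq_mult (H i) xs. \<exists>z\<in>carrier (H i). \<delta> i z = \<zero>\<^bsub>H (Suc i)\<^esub> \<and> f = k \<oplus>\<^bsub>H i\<^esub> z"
  using assms(5-)
proof (induction xs arbitrary: i f)
  case Nil
  interpret Hi: module R "H i" by (rule H)
  show ?case using Nil.prems by (intro bexI[of _ "\<zero>\<^bsub>H i\<^esub>"] bexI[of _ f]) auto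
next
  case (Cons x xs)
  interpret H0: module R "H i" by (rule H)
  interpret H1: module R "H (Suc i)" by (rule H)
  interpret H2: module R "H (Suc (Suc i))" by (rule H)
  have x: "x \<in> carrier R" and xs: "set xs \<subseteq> carrier R" using Cons.prems(1) by auto
  have regs: "reg_seq (H i) xs" and reg: "\<And>u. u \<in> carrier (H i) \<Longrightarrow> x \<odot>\<^bsub>H i\<^esub> u \<in> seq_mult (H i) xs \<Longrightarrow> u \<in> seq_mult (H i) xs" for i
    using Cons.prems(2)[of i] by auto
  \<comment> \<open>Applied twice: in degree \<open>Suc i\<close> to the cofactor \<open>u\<close>
    of \<open>x\<close> in \<open>\<delta> i f\<close>, and in degree \<open>i\<close> to a
    corrected \<open>f\<close>.\<close>
  note IH = Cons.IH[OF xs regs]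
  note D = mod_homD[OF hom]
  obtain u k where u: "\<delta> i f = x \<odot>\<^bsub>H (Suc i)\<^esub> u \<oplus>\<^bsub>H (Suc i)\<^esub> k" "u \<in> carrier (H (Suc i))" "k \<in> seq_mult (H (Suc i)) xs"
    using Cons.prems(4) by auto
  have k: "k \<in> carrier (H (Suc i))" using H1.seq_mult_simps(1)[OF xs] u(3) by blast
  have \<delta>k: "\<delta> (Suc i) k \<in> seq_mult (H (Suc (Suc i))) xs" by (rule mod_hom_seq_mult[OF H H hom xs u(3)])
  have "\<zero>\<^bsub>H (Suc (Suc i))\<^esub> = x \<odot>\<^bsub>H (Suc (Suc i))\<^esub> \<delta> (Suc i) u \<oplus>\<^bsub>H (Suc (Suc i))\<^esub> \<delta> (Suc i) k"
    using \<delta>\<delta>[OF Cons.prems(3)] u k x D by simp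
  then have "x \<odot>\<^bsub>H (Suc (Suc i))\<^esub> \<delta> (Suc i) u = \<ominus>\<^bsub>H (Suc (Suc i))\<^esub> \<delta> (Suc i) k"
    using H2.M.minus_equality[of "x \<odot>\<^bsub>H (Suc (Suc i))\<^esub> \<delta> (Suc i) u" "\<delta> (Suc i) k"] D(1) u(2) k x by simp
  then have "\<delta> (Suc i) u \<in> seq_mult (H (Suc (Suc i))) xs"
    using reg[of "\<delta> (Suc i) u" "Suc (Suc i)"] D(1)[OF u(2)] H2.seq_mult_simps(4)[OF xs \<delta>k] by simp
  then obtain k' z' where k': "k' \<in> seq_mult (H (Suc i)) xs" "z' \<in> carrier (H (Suc i))"
    "\<delta> (Suc i) z' = \<zero>\<^bsub>H (Suc (Suc i))\<^esub>" "u = k' \<oplus>\<^bsub>H (Suc i)\<^esub> z'" using IH[OF u(2)] by blast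
  obtain v where v: "v \<in> carrier (H i)" "z' = \<delta> i v" using exact k' by blast
  have k'c: "k' \<in> carrier (H (Suc i))" using H1.seq_mult_simps(1)[OF xs] k'(1) by blast
  \<comment> \<open>Exactness writes the cocycle part of \<open>u\<close> as
    \<open>\<delta> i v\<close>. Subtracting x v from \<open>f\<close> leaves a differential that is
    zero modulo the shorter sequence.\<close>
  define f' where "f' = f \<ominus>\<^bsub>H i\<^esub> x \<odot>\<^bsub>H i\<^esub> v"
  have f': "f' \<in> carrier (H i)" unfolding f'_def using Cons.prems(3) v x by simp
  have \<delta>v: "\<delta> i v \<in> carrier (H (Suc i))" using D(1) v by blast
  have "\<delta> i f' = \<delta> i f \<ominus>\<^bsub>H (Suc i)\<^esub> x \<odot>\<^bsub>H (Suc i)\<^esub> \<delta> i v"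
    unfolding f'_def using mod_hom_minus(2)[OF H H hom] D(3) Cons.prems(3) v x by simp
  also have "\<dots> = x \<odot>\<^bsub>H (Suc i)\<^esub> k' \<oplus>\<^bsub>H (Suc i)\<^esub> k"
    unfolding u(1) k'(4) v(2) a_minus_def using k k'c \<delta>v x
    by (simp add: H1.smult_r_distr H1.M.a_ac H1.M.r_neg H1.M.r_neg1 H1.M.r_neg2)
  also have "\<dots> \<in> seq_mult (H (Suc i)) xs"
    using H1.seq_mult_simps(3,6)[OF xs] k'(1) u(3) x by blast
  finally obtain k'' z where k'': "k'' \<in> seq_mult (H i) xs" "z \<in> carrier (H i)"
    "\<delta> i z = \<zero>\<^bsub>H (Suc i)\<^esub>" "f' = k'' \<oplus>\<^bsub>H i\<^esub> z" using IH[OF f'] by blast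
  have k''c: "k'' \<in> carrier (H i)" using H0.seq_mult_simps(1)[OF xs] k''(1) by blast
  have "f = x \<odot>\<^bsub>H i\<^esub> v \<oplus>\<^bsub>H i\<^esub> f'"
    unfolding f'_def a_minus_def using Cons.prems(3) v x by (simp add: H0.M.a_ac H0.M.r_neg H0.M.r_neg1 H0.M.r_neg2)
  also have "\<dots> = (x \<odot>\<^bsub>H i\<^esub> v \<oplus>\<^bsub>H i\<^esub> k'') \<oplus>\<^bsub>H i\<^esub> z"
    unfolding k''(4) using v x k''(2) k''c by (simp add: H0.M.a_assoc)
  finally show ?case using seq_mult_ConsI[OF v(1) k''(1), of x] k''(2,3) by blast
qed

section \<open>Minimal resolutions of the residue field\<close>

text \<open>Elements of the maximal ideal that are linearly independent modulo its square.\<close>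

primrec param_seq :: "('a, 'r) ring_scheme \<Rightarrow> 'a list \<Rightarrow> bool" where
  "param_seq R [] \<longleftrightarrow> True"
| "param_seq R (x # xs) \<longleftrightarrow> param_seq R xs \<and> x \<in> max_ideal R \<and>
     x \<notin> set_add R (ideal_prod R (max_ideal R) (max_ideal R)) (seq_mult (regular_module R) xs)"

lemma a_kernel_eq: "a_kernel M N f = {x \<in> carrier M. f x = \<zero>\<^bsub>N\<^esub>}"
  by (simp add: a_kernel_def kernel_def)

context noetherian_local_ring
begin

abbreviation \<mm> :: "'a set" where "\<mm> \<equiv> max_ideal R"
abbreviation \<mm>2 :: "'a set" where "\<mm>2 \<equiv> ideal_prod R \<mm> \<mm>"

lemma max_ideal_ideal: "ideal \<mm> R"
  using max_ideal_prime primeideal.axioms(1) by blast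

lemma max_ideal_sq_ideal: "ideal \<mm>2 R"
  by (rule ideal_prod_is_ideal[OF max_ideal_ideal max_ideal_ideal])

lemma param_seq_subset: "param_seq R xs \<Longrightarrow> set xs \<subseteq> carrier R"
  using ideal.Icarr[OF max_ideal_ideal] by (induction xs) auto

text \<open>Everything that is used of the residue field: its zero is the coset
  \<open>\<mm>\<close>, and the maximal ideal acts by zero.\<close>

lemma residue_field_simps:
  shows "\<zero>\<^bsub>residue_field R\<^esub> = \<mm>" "\<mm> \<oplus>\<^bsub>residue_field R\<^esub> \<mm> = \<mm>"
    and "a \<in> \<mm> \<Longrightarrow> X \<in> carrier (residue_field R) \<Longrightarrow> a \<odot>\<^bsub>residue_field R\<^esub> X = \<mm>"
proof -
  interpret m: ideal \<mm> R by (rule max_ideal_ideal)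
  show "\<zero>\<^bsub>residue_field R\<^esub> = \<mm>" by (simp add: residue_field_def quotient_module_def)
  have "set_add R \<mm> \<mm> = \<mm>"
  proof
    show "\<mm> \<subseteq> set_add R \<mm> \<mm>"
    proof
      fix x assume x: "x \<in> \<mm>"
      then have "x = x \<oplus> \<zero>" using m.Icarr by simp
      then show "x \<in> set_add R \<mm> \<mm>" using x m.zero_closed unfolding set_add_def' by blast
    qed
  qed (auto simp: set_add_def')
  then show "\<mm> \<oplus>\<^bsub>residue_field R\<^esub> \<mm> = \<mm>"
    by (simp add: residue_field_def quotient_module_def set_add_def')
  assume a: "a \<in> \<mm>" and X: "X \<in> carrier (residue_field R)"
  have coset: "\<mm> +>\<^bsub>regular_module R\<^esub> r = \<mm> +>\<^bsub>R\<^esub> r" for r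
    by (simp add: a_r_coset_def')
  obtain r where r: "r \<in> carrier R" "X = \<mm> +>\<^bsub>R\<^esub> r"
    using X coset by (auto simp: residue_field_def quotient_module_def A_RCOSETS_def')
  have sub: "X \<subseteq> carrier R" using r m.a_subset unfolding a_r_coset_def' by auto
  have "X \<noteq> {}" using r m.zero_closed unfolding a_r_coset_def' by blast
  moreover have "\<mm> +>\<^bsub>R\<^esub> (a \<otimes> x) = \<mm>" if "x \<in> X" for x
    by (rule a_rcos_zero[OF max_ideal_ideal]) (use m.I_r_closed a sub that in auto)
  ultimately show "a \<odot>\<^bsub>residue_field R\<^esub> X = \<mm>"
    by (auto simp: residue_field_def quotient_module_def coset)
qed

lemma obtain_max_ideal_gens:
  obtains gs where "set gs \<subseteq> \<mm>" "seq_mult (regular_module R) gs = \<mm>"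
proof -
  obtain gs where gs: "set gs \<subseteq> carrier R" "\<mm> = Idl (set gs)" by (rule ideal_gens[OF max_ideal_ideal])
  then have "set gs \<subseteq> \<mm>" using genideal_self by simp
  then show ?thesis using that gs seq_mult_eq_Idl by simp
qed

context
  fixes b :: "nat \<Rightarrow> nat" and d :: "nat \<Rightarrow> (nat \<Rightarrow> 'a) \<Rightarrow> (nat \<Rightarrow> 'a)" and \<epsilon> :: "(nat \<Rightarrow> 'a) \<Rightarrow> 'a set"
  assumes res: "minimal_free_resolution R (residue_field R) b d \<epsilon>"
begin

abbreviation F :: "nat \<Rightarrow> ('a, nat \<Rightarrow> 'a) module" where "F n \<equiv> free_module R (b n)"

lemma minimal_resD:
  shows "\<epsilon> \<in> mod_hom R (F 0) (residue_field R)" "d n \<in> mod_hom R (F (Suc n)) (F n)"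
    "w \<in> carrier (F 0) \<Longrightarrow> \<epsilon> w = \<mm> \<Longrightarrow> \<exists>u\<in>carrier (F (Suc 0)). w = d 0 u"
    "d (Suc n) ` carrier (F (Suc (Suc n))) = a_kernel (F (Suc n)) (F n) (d n)"
    "x \<in> carrier (F (Suc n)) \<Longrightarrow> i < b n \<Longrightarrow> d n x i \<in> \<mm>"
proof -
  have fr: "free_resolution R (residue_field R) b d \<epsilon>"
    and mn: "\<forall>n. \<forall>x\<in>carrier (F (Suc n)). \<forall>i<b n. d n x i \<in> \<mm>"
    using res unfolding minimal_free_resolution_def by auto
  show "x \<in> carrier (F (Suc n)) \<Longrightarrow> i < b n \<Longrightarrow> d n x i \<in> \<mm>" using mn by blast
  show "\<epsilon> \<in> mod_hom R (F 0) (residue_field R)" "d n \<in> mod_hom R (F (Suc n)) (F n)"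
    "d (Suc n) ` carrier (F (Suc (Suc n))) = a_kernel (F (Suc n)) (F n) (d n)"
    using fr unfolding free_resolution_def Let_def by blast+
  have ker: "d 0 ` carrier (F (Suc 0)) = a_kernel (F 0) (residue_field R) \<epsilon>"
    using fr unfolding free_resolution_def Let_def One_nat_def by blast
  assume "w \<in> carrier (F 0)" "\<epsilon> w = \<mm>"
  then have "w \<in> d 0 ` carrier (F (Suc 0))" unfolding ker a_kernel_eq residue_field_simps(1) by simp
  then show "\<exists>u\<in>carrier (F (Suc 0)). w = d 0 u" by blast
qed

lemma d_d:
  assumes "u \<in> carrier (F (Suc (Suc n)))" shows "d n (d (Suc n) u) = \<zero>\<^bsub>F n\<^esub>"
  using minimal_resD(4)[of n] assms unfolding a_kernel_eq by blast

text \<open>\<open>\<epsilon>\<close> kills vectors with coordinates in the maximal ideal because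
  that ideal annihilates the residue field. This settles degree 0 of the lifting lemma, where there
  is no cycle condition to exploit.\<close>

lemma max_ideal_vec_in_image:
  assumes "w \<in> carrier (F 0)" "\<And>i. i < b 0 \<Longrightarrow> w i \<in> \<mm>"
  shows "\<exists>u\<in>carrier (F (Suc 0)). w = d 0 u"
proof (rule minimal_resD(3)[OF assms(1)])
  obtain gs where gs: "set gs \<subseteq> \<mm>" "seq_mult (regular_module R) gs = \<mm>" by (rule obtain_max_ideal_gens)
  have gsc: "set gs \<subseteq> carrier R" using gs(1) ideal.Icarr[OF max_ideal_ideal] by blast
  interpret F0: module R "F 0" by (rule free_module_module)
  note E = mod_homD[OF minimal_resD(1)]
  have "w \<in> seq_mult (F 0) gs" using free_module_seq_mult[OF gsc assms(1)] assms(2) gs(2) by simp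
  then show "\<epsilon> w = \<mm>" using gs(1) gsc
  proof (induction gs arbitrary: w)
    case Nil
    \<comment> \<open>Zero is written as zero times zero so that the rule for scalars from the
      maximal ideal yields the value of \<open>\<epsilon>\<close>.\<close>
    have "\<epsilon> (\<zero> \<odot>\<^bsub>F 0\<^esub> \<zero>\<^bsub>F 0\<^esub>) = \<mm>"
      using E(3)[OF zero_closed F0.M.zero_closed]
        residue_field_simps(3)[OF additive_subgroup.zero_closed E(1)[OF F0.M.zero_closed]]
        ideal.axioms(1)[OF max_ideal_ideal] by simp
    then show ?case using Nil F0.smult_l_null[OF F0.M.zero_closed] by (simp del: free_module_simps)
  next
    case (Cons g gs)
    obtain u k where u: "w = g \<odot>\<^bsub>F 0\<^esub> u \<oplus>\<^bsub>F 0\<^esub> k" "u \<in> carrier (F 0)" "k \<in> seq_mult (F 0) gs"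
      using Cons.prems(1) by (auto simp del: free_module_simps)
    have g: "g \<in> carrier R" "g \<in> \<mm>" using Cons.prems by auto
    have k: "k \<in> carrier (F 0)" using F0.seq_mult_simps(1)[of gs] u(3) Cons.prems(3) by auto
    have "\<epsilon> w = \<epsilon> (g \<odot>\<^bsub>F 0\<^esub> u) \<oplus>\<^bsub>residue_field R\<^esub> \<epsilon> k"
      unfolding u(1) by (rule E(2)[OF F0.smult_closed[OF g(1) u(2)] k])
    also have "\<epsilon> (g \<odot>\<^bsub>F 0\<^esub> u) = \<mm>" using E(3)[OF g(1) u(2)] residue_field_simps(3)[OF g(2) E(1)[OF u(2)]] by simp
    also have "\<epsilon> k = \<mm>" using Cons.IH u(3) Cons.prems by simp
    finally show ?case by (simp only: residue_field_simps(2))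
  qed
qed

text \<open>Minimality supplies one factor in the maximal ideal and the coordinates of
  \<open>w\<close> the other; a list of generators of the ideal makes the latter explicit.\<close>

lemma d_max_ideal_vec:
  assumes "w \<in> carrier (F (Suc n))" "\<And>i. i < b (Suc n) \<Longrightarrow> w i \<in> \<mm>" "i < b n"
  shows "d n w i \<in> \<mm>2"
proof -
  obtain gs where gs: "set gs \<subseteq> \<mm>" "seq_mult (regular_module R) gs = \<mm>" by (rule obtain_max_ideal_gens)
  have gsc: "set gs \<subseteq> carrier R" using gs(1) ideal.Icarr[OF max_ideal_ideal] by blast
  interpret F0: module R "F n" by (rule free_module_module)
  interpret F1: module R "F (Suc n)" by (rule free_module_module)
  note D = mod_homD[OF minimal_resD(2)[of n]]
  interpret m2: ideal "\<mm>2" R by (rule max_ideal_sq_ideal)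
  have "w \<in> seq_mult (F (Suc n)) gs" using free_module_seq_mult[OF gsc assms(1)] assms(2) gs(2) by simp
  then show ?thesis using gs(1) gsc
  proof (induction gs arbitrary: w)
    case Nil
    have "d n w = \<zero>\<^bsub>F n\<^esub>" using Nil mod_hom_zero[OF F1.module_axioms F0.module_axioms minimal_resD(2)] by simp
    then show ?case using assms(3) by simp
  next
    case (Cons g gs)
    obtain u k where u: "w = g \<odot>\<^bsub>F (Suc n)\<^esub> u \<oplus>\<^bsub>F (Suc n)\<^esub> k" "u \<in> carrier (F (Suc n))" "k \<in> seq_mult (F (Suc n)) gs"
      using Cons.prems(1) by (auto simp del: free_module_simps)
    have g: "g \<in> carrier R" "g \<in> \<mm>" using Cons.prems by auto
    have k: "k \<in> carrier (F (Suc n))" using F1.seq_mult_simps(1)[of gs] u(3) Cons.prems(3) by auto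
    have "d n w = (g \<odot>\<^bsub>F n\<^esub> d n u) \<oplus>\<^bsub>F n\<^esub> d n k"
      unfolding u(1) using D(2)[OF F1.smult_closed[OF g(1) u(2)] k] D(3)[OF g(1) u(2)] by simp
    then have "d n w i = g \<otimes> d n u i \<oplus> d n k i" using assms(3) by simp
    moreover have "g \<otimes> d n u i \<in> \<mm>2" by (rule ideal_prod.prod[OF g(2) minimal_resD(5)[OF u(2) assms(3)]])
    moreover have "d n k i \<in> \<mm>2" using Cons.IH[OF u(3)] Cons.prems by simp
    ultimately show ?case by simp
  qed
qed

text \<open>
  The key step: \<open>d w = x u + \<dots>\<close> with all coordinates of \<open>w\<close> in the maximal ideal forces those of \<open>u\<close> to
  lie there as well, since a unit coordinate would put \<open>x\<close> into the square of the maximal ideal.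
\<close>

lemma minimal_cycle_lift:
  assumes "param_seq R xs" "reg_seq (regular_module R) xs"
    and "w \<in> carrier (F n)" "\<And>i. i < b n \<Longrightarrow> w i \<in> \<mm>"
    and "case n of 0 \<Rightarrow> True | Suc p \<Rightarrow> d p w \<in> seq_mult (F p) xs"
  shows "\<exists>k\<in>seq_mult (F n) xs. \<exists>u\<in>carrier (F (Suc n)). w = k \<oplus>\<^bsub>F n\<^esub> d n u"
  using assms
proof (induction xs arbitrary: n w)
  case Nil
  interpret Fn: module R "F n" by (rule free_module_module)
  have "\<exists>u\<in>carrier (F (Suc n)). w = d n u"
  proof (cases n)
    case 0 then show ?thesis using max_ideal_vec_in_image Nil by blast
  next
    case (Suc p)
    then have "w \<in> a_kernel (F (Suc p)) (F p) (d p)" using Nil unfolding a_kernel_eq by simp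
    then show ?thesis using minimal_resD(4)[of p] Nil Suc by blast
  qed
  then obtain u where u: "u \<in> carrier (F (Suc n))" "w = d n u" by blast
  have "w = \<zero>\<^bsub>F n\<^esub> \<oplus>\<^bsub>F n\<^esub> d n u" using u Fn.M.l_zero[OF Nil(3)] by (simp del: free_module_simps)
  then show ?case using u(1) by (auto simp del: free_module_simps)
next
  case (Cons x xs)
  have par: "param_seq R xs" and x: "x \<in> \<mm>"
    and xn: "x \<notin> set_add R \<mm>2 (seq_mult (regular_module R) xs)" using Cons.prems(1) by auto
  have xs: "set xs \<subseteq> carrier R" and xc: "x \<in> carrier R" using param_seq_subset[OF Cons.prems(1)] by auto
  have reg: "reg_seq (regular_module R) xs" using Cons.prems(2) by simp
  have regF: "u \<in> seq_mult (F q) xs" if "u \<in> carrier (F q)" "x \<odot>\<^bsub>F q\<^esub> u \<in> seq_mult (F q) xs" for u q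
    using free_module_reg_seq[OF param_seq_subset[OF Cons.prems(1)] Cons.prems(2), of "b q"] that
    by (simp del: free_module_simps)
  note IH = Cons.IH[OF par reg]
  interpret m: ideal \<mm> R by (rule max_ideal_ideal)
  interpret m2: ideal "\<mm>2" R by (rule max_ideal_sq_ideal)
  interpret I: ideal "seq_mult (regular_module R) xs" R by (rule seq_mult_ideal[OF xs])
  show ?case
  proof (cases n)
    case 0
    interpret Fn: module R "F n" by (rule free_module_module)
    have z: "\<zero>\<^bsub>F n\<^esub> \<in> seq_mult (F n) (x # xs)"
      using Fn.seq_mult_simps(2) param_seq_subset[OF Cons.prems(1)] by blast
    obtain u where u: "u \<in> carrier (F (Suc n))" "w = d n u" using max_ideal_vec_in_image Cons.prems(3,4) 0 by blast
    then have "w = \<zero>\<^bsub>F n\<^esub> \<oplus>\<^bsub>F n\<^esub> d n u" using Fn.M.l_zero[OF Cons.prems(3)] by (simp del: free_module_simps)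
    then show ?thesis using u z by blast
  next
    case (Suc p)
    interpret F0: module R "F p" by (rule free_module_module)
    interpret F1: module R "F n" by (rule free_module_module)
    interpret F2: module R "F (Suc n)" by (rule free_module_module)
    have dp: "d p \<in> mod_hom R (F n) (F p)" using minimal_resD(2) Suc by simp
    note D = mod_homD[OF dp]
    have "d p w \<in> seq_mult (F p) (x # xs)" using Cons.prems(5) Suc by simp
    then obtain u k where u: "d p w = x \<odot>\<^bsub>F p\<^esub> u \<oplus>\<^bsub>F p\<^esub> k" "u \<in> carrier (F p)" "k \<in> seq_mult (F p) xs"
      by (auto simp del: free_module_simps)
    have k: "k \<in> carrier (F p)" using F0.seq_mult_simps(1)[OF xs] u(3) by blast
    have um: "u i \<in> \<mm>" if i: "i < b p" for i
    proof (rule ccontr)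
      assume n: "u i \<notin> \<mm>"
      have uc: "u i \<in> carrier R" and kc: "k i \<in> carrier R" using u(2) k i by auto
      obtain c where c: "c \<in> carrier R" "c \<otimes> u i = \<one>" using unit_of_not_max[OF uc n] by blast
      have e: "d p w i = x \<otimes> u i \<oplus> k i" unfolding u(1) using i by simp
      have dm: "d p w i \<in> \<mm>2" using d_max_ideal_vec[of w p i] Cons.prems(3,4) Suc i by simp
      have km: "k i \<in> seq_mult (regular_module R) xs" using free_module_seq_mult[OF xs k] u(3) i by simp
      have "c \<otimes> d p w i = x \<otimes> (c \<otimes> u i) \<oplus> c \<otimes> k i" unfolding e using c(1) xc uc kc by algebra
      then have "x = c \<otimes> d p w i \<oplus> (\<ominus> c) \<otimes> k i"
        unfolding c(2) using c(1) xc kc by (simp add: l_minus a_assoc r_neg)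
      moreover have "c \<otimes> d p w i \<in> \<mm>2" "(\<ominus> c) \<otimes> k i \<in> seq_mult (regular_module R) xs"
        using m2.I_l_closed[OF dm c(1)] I.I_l_closed[OF km] c(1) by auto
      ultimately show False using xn unfolding set_add_def' by blast
    qed
    \<comment> \<open>Applying the next differential to d w = x u + k gives zero, and regularity of
      \<open>x\<close> turns this into the cycle condition for \<open>u\<close> modulo the shorter
      sequence.\<close>
    have "case p of 0 \<Rightarrow> True | Suc q \<Rightarrow> d q u \<in> seq_mult (F q) xs"
    proof (cases p)
      case (Suc q)
      interpret F': module R "F q" by (rule free_module_module)
      have dq: "d q \<in> mod_hom R (F p) (F q)" using minimal_resD(2) Suc by simp
      note D' = mod_homD[OF dq]
      have dk: "d q k \<in> seq_mult (F q) xs"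
        by (rule mod_hom_seq_mult[OF F0.module_axioms F'.module_axioms dq xs u(3)])
      have "\<zero>\<^bsub>F q\<^esub> = d q (d p w)" using d_d[of w q] Cons.prems(3) \<open>n = Suc p\<close> Suc by (simp del: free_module_simps)
      also have "\<dots> = x \<odot>\<^bsub>F q\<^esub> d q u \<oplus>\<^bsub>F q\<^esub> d q k"
        unfolding u(1) using D'(2)[OF F0.smult_closed[OF xc u(2)] k] D'(3)[OF xc u(2)] by simp
      finally have "x \<odot>\<^bsub>F q\<^esub> d q u = \<ominus>\<^bsub>F q\<^esub> d q k"
        using F'.M.minus_equality[OF _ D'(1)[OF k] F'.smult_closed[OF xc D'(1)[OF u(2)]]] by simp
      then have "d q u \<in> seq_mult (F q) xs"
        using regF[OF D'(1)[OF u(2)]] F'.seq_mult_simps(4)[OF xs dk] by simp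
      then show ?thesis using Suc by simp
    qed simp
    then obtain k' v where v: "k' \<in> seq_mult (F p) xs" "v \<in> carrier (F n)" "u = k' \<oplus>\<^bsub>F p\<^esub> d p v"
      using IH[OF u(2) um] Suc by blast
    have k': "k' \<in> carrier (F p)" using F0.seq_mult_simps(1)[OF xs] v(1) by blast
    \<comment> \<open>The induction one degree lower has given u = k' + d v. Subtracting x v keeps
      the coordinates in the maximal ideal, as \<open>x\<close> lies there, and changes the
      differential to x k' + k, so the induction applies again in degree \<open>n\<close>.\<close>
    define w' where "w' = w \<oplus>\<^bsub>F n\<^esub> (\<ominus> x) \<odot>\<^bsub>F n\<^esub> v"
    have nx: "\<ominus> x \<in> carrier R" using xc by simp
    have w': "w' \<in> carrier (F n)" unfolding w'_def
      by (rule F1.M.a_closed[OF Cons.prems(3) F1.smult_closed[OF nx v(2)]])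
    have w'm: "w' i \<in> \<mm>" if i: "i < b n" for i
    proof -
      have "v i \<in> carrier R" using v(2) i by auto
      then have "w i \<oplus> (\<ominus> x) \<otimes> v i \<in> \<mm>"
        using Cons.prems(4)[OF i] m.I_r_closed[OF m.a_inv_closed[OF x]] by simp
      then show ?thesis unfolding w'_def using i by simp
    qed
    have dv: "d p v \<in> carrier (F p)" by (rule D(1)[OF v(2)])
    have "d p w' = d p w \<oplus>\<^bsub>F p\<^esub> (\<ominus> x) \<odot>\<^bsub>F p\<^esub> d p v"
      unfolding w'_def using D(2)[OF Cons.prems(3) F1.smult_closed[OF nx v(2)]] D(3)[OF nx v(2)] by simp
    also have "\<dots> = x \<odot>\<^bsub>F p\<^esub> k' \<oplus>\<^bsub>F p\<^esub> k"
      unfolding u(1) v(3) using k k' dv xc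
      by (simp add: F0.smult_r_distr F0.smult_l_minus F0.M.a_ac F0.M.r_neg F0.M.r_neg1 F0.M.r_neg2 del: free_module_simps)
    also have "\<dots> \<in> seq_mult (F p) xs"
      using F0.seq_mult_simps(3)[OF xs F0.seq_mult_simps(6)[OF xs v(1) xc] u(3)] .
    finally have "case n of 0 \<Rightarrow> True | Suc p \<Rightarrow> d p w' \<in> seq_mult (F p) xs" using Suc by simp
    then obtain k'' u' where k'': "k'' \<in> seq_mult (F n) xs" "u' \<in> carrier (F (Suc n))" "w' = k'' \<oplus>\<^bsub>F n\<^esub> d n u'"
      using IH[OF w' w'm] by blast
    have k''c: "k'' \<in> carrier (F n)" using F1.seq_mult_simps(1)[OF xs] k''(1) by blast
    have du: "d n u' \<in> carrier (F n)" by (rule mod_homD(1)[OF minimal_resD(2) k''(2)])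
    have "w = x \<odot>\<^bsub>F n\<^esub> v \<oplus>\<^bsub>F n\<^esub> w'"
      unfolding w'_def using Cons.prems(3) v(2) xc
      by (simp add: F1.smult_l_minus F1.M.a_ac F1.M.r_neg F1.M.r_neg1 F1.M.r_neg2 del: free_module_simps)
    also have "\<dots> = (x \<odot>\<^bsub>F n\<^esub> v \<oplus>\<^bsub>F n\<^esub> k'') \<oplus>\<^bsub>F n\<^esub> d n u'"
      unfolding k''(3) using v(2) xc k''c du by (simp add: F1.M.a_assoc del: free_module_simps)
    finally show ?thesis using seq_mult_ConsI[OF v(2) k''(1), of x] k''(2) by blast
  qed
qed

text \<open>As \<open>s\<close> is in the maximal ideal, so are the coordinates of s y. By
  minimality those of d (s y) = s (d y) lie in \<open>s\<close> times the maximal ideal, hence in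
  I.\<close>

lemma socle_cycle_lift:
  assumes "param_seq R xs" "reg_seq (regular_module R) xs" "s \<in> \<mm>"
    and "\<And>a. a \<in> \<mm> \<Longrightarrow> s \<otimes> a \<in> seq_mult (regular_module R) xs" and y: "y \<in> carrier (F n)"
  shows "\<exists>k\<in>seq_mult (F n) xs. \<exists>u\<in>carrier (F (Suc n)). s \<odot>\<^bsub>F n\<^esub> y = k \<oplus>\<^bsub>F n\<^esub> d n u"
proof (rule minimal_cycle_lift[OF assms(1,2)])
  interpret Fn: module R "F n" by (rule free_module_module)
  interpret m: ideal \<mm> R by (rule max_ideal_ideal)
  have s: "s \<in> carrier R" using m.Icarr assms(3) by blast
  show "s \<odot>\<^bsub>F n\<^esub> y \<in> carrier (F n)" by (rule Fn.smult_closed[OF s y])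
  show "(s \<odot>\<^bsub>F n\<^esub> y) i \<in> \<mm>" if "i < b n" for i
    using that m.I_r_closed[OF assms(3), of "y i"] y by auto
  show "case n of 0 \<Rightarrow> True | Suc p \<Rightarrow> d p (s \<odot>\<^bsub>F n\<^esub> y) \<in> seq_mult (F p) xs"
  proof (cases n)
    case (Suc p)
    interpret Fp: module R "F p" by (rule free_module_module)
    have dp: "d p \<in> mod_hom R (F n) (F p)" using minimal_resD(2) Suc by simp
    have dy: "d p y \<in> carrier (F p)" by (rule mod_homD(1)[OF dp y])
    have "s \<odot>\<^bsub>F p\<^esub> d p y \<in> seq_mult (F p) xs"
      unfolding free_module_seq_mult[OF param_seq_subset[OF assms(1)] Fp.smult_closed[OF s dy]]
      using assms(4) minimal_resD(5)[of y p] y Suc by simp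
    then have "d p (s \<odot>\<^bsub>F n\<^esub> y) \<in> seq_mult (F p) xs" using mod_homD(3)[OF dp s y] by simp
    then show ?thesis using Suc by simp
  qed simp
qed

end

text \<open>For positive \<open>n\<close> let \<open>z\<close> correspond to d y. Lifting s y to c +
  d u, with all coordinates of c in I, makes s z correspond to d c because d d = 0. This places s z
  in I times the syzygy itself, not merely in I times the ambient free module. For n = 0 the residue
  field is killed by \<open>s\<close>.\<close>

lemma syzygy_socle:
  assumes "param_seq R xs" "reg_seq (regular_module R) xs" "s \<in> \<mm>"
    and "\<And>a. a \<in> \<mm> \<Longrightarrow> s \<otimes> a \<in> seq_mult (regular_module R) xs"
    and "syzygy_module R (residue_field R) n X" "z \<in> carrier X"
  shows "s \<odot>\<^bsub>X\<^esub> z \<in> seq_mult X xs"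
proof -
  interpret m: ideal \<mm> R by (rule max_ideal_ideal)
  have s: "s \<in> carrier R" using m.Icarr assms(3) by blast
  have xs: "set xs \<subseteq> carrier R" by (rule param_seq_subset[OF assms(1)])
  obtain b d \<epsilon> where X: "module R X" and res: "minimal_free_resolution R (residue_field R) b d \<epsilon>"
    and iso: "case n of 0 \<Rightarrow> mod_iso R X (residue_field R) \<noteq> {}
        | Suc k \<Rightarrow> mod_iso R X
            ((free_module R (b k))\<lparr>carrier := d k ` carrier (free_module R (b (Suc k)))\<rparr>) \<noteq> {}"
    using assms(5) unfolding syzygy_module_def by blast
  interpret X: module R X by fact
  show ?thesis
  proof (cases n)
    case 0
    then obtain h where h: "h \<in> mod_hom R X (residue_field R)" "inj_on h (carrier X)"
      using iso by (auto simp: mod_iso_def bij_betw_def)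
    note D = mod_homD[OF h(1)]
    have zero: "h (r \<odot>\<^bsub>X\<^esub> v) = \<mm>" if "r \<in> \<mm>" "v \<in> carrier X" for r v
      using D(3)[of r v] residue_field_simps(3)[OF that(1) D(1)[OF that(2)]] that m.Icarr by simp
    have "h (s \<odot>\<^bsub>X\<^esub> z) = h (\<zero> \<odot>\<^bsub>X\<^esub> \<zero>\<^bsub>X\<^esub>)"
      unfolding zero[OF assms(3,6)] zero[OF m.zero_closed X.M.zero_closed] by simp
    then have "s \<odot>\<^bsub>X\<^esub> z = \<zero> \<odot>\<^bsub>X\<^esub> \<zero>\<^bsub>X\<^esub>" using inj_onD[OF h(2)] s assms(6) by simp
    then show ?thesis using X.seq_mult_simps(2)[OF xs] by simp
  next
    case (Suc k)
    let ?F = "free_module R (b k)" and ?G = "free_module R (b (Suc k))"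
    let ?I = "?F\<lparr>carrier := d k ` carrier ?G\<rparr>"
    interpret F: module R ?F by (rule free_module_module)
    interpret G: module R ?G by (rule free_module_module)
    obtain h where h: "h \<in> mod_iso R X ?I" using iso Suc by auto
    then have hh: "h \<in> mod_hom R X ?I" unfolding mod_iso_def by simp
    have dk: "d k \<in> mod_hom R ?G ?F" by (rule minimal_resD(2)[OF res])
    have "submodule (d k ` carrier ?G) R ?F"
      by (rule mod_hom_image_submodule[OF G.module_axioms F.module_axioms dk])
    then have I: "module R ?I" by (rule submodule.submodule_is_module[OF _ F.module_axioms])
    \<comment> \<open>Viewing \<open>d k\<close> as a map onto its image makes
      \<open>mod_hom_seq_mult\<close> yield membership in I times the image.\<close>
    have dI: "d k \<in> mod_hom R ?G ?I"
      by (rule mod_homI) (simp_all add: mod_homD[OF dk] del: free_module_simps)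
    have "h z \<in> d k ` carrier ?G" using mod_homD(1)[OF hh assms(6)] by simp
    then obtain y where y: "y \<in> carrier ?G" "h z = d k y" by blast
    obtain c u where c: "c \<in> seq_mult ?G xs" "u \<in> carrier (free_module R (b (Suc (Suc k))))"
      "s \<odot>\<^bsub>?G\<^esub> y = c \<oplus>\<^bsub>?G\<^esub> d (Suc k) u"
      using socle_cycle_lift[OF res assms(1-4) y(1)] by blast
    have cc: "c \<in> carrier ?G" using G.seq_mult_simps(1)[OF xs] c(1) by blast
    have du: "d (Suc k) u \<in> carrier ?G" by (rule mod_homD(1)[OF minimal_resD(2)[OF res] c(2)])
    have "h (s \<odot>\<^bsub>X\<^esub> z) = s \<odot>\<^bsub>?F\<^esub> d k y" using mod_homD(3)[OF hh s assms(6)] y(2) by simp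
    also have "\<dots> = d k (s \<odot>\<^bsub>?G\<^esub> y)" using mod_homD(3)[OF dk s y(1)] by simp
    also have "\<dots> = d k c \<oplus>\<^bsub>?F\<^esub> d k (d (Suc k) u)" unfolding c(3) by (rule mod_homD(2)[OF dk cc du])
    also have "\<dots> = d k c" unfolding d_d[OF res c(2)] by (rule F.M.r_zero[OF mod_homD(1)[OF dk cc]])
    also have "\<dots> \<in> seq_mult ?I xs" by (rule mod_hom_seq_mult[OF G.module_axioms I dI xs c(1)])
    finally show ?thesis
      using mod_iso_seq_mult_iff[OF X I h xs X.smult_closed[OF s assms(6)]] by simp
  qed
qed

end

section \<open>Existence of free resolutions\<close>

lemma (in noetherian_cring) submodule_of_free_image:
  assumes "submodule N R (free_module R n)"
  shows "\<exists>c f. f \<in> mod_hom R (free_module R c) (free_module R n) \<and> f ` carrier (free_module R c) = N"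
proof -
  interpret F: module R "free_module R n" by (rule free_module_module)
  let ?bs = "map (basis_vec R n) [0..<n]"
  have bs: "set ?bs \<subseteq> carrier (free_module R n)" using basis_vec_closed by auto
  have id: "(\<lambda>v. v) \<in> mod_hom R (free_module R n) (free_module R n)" by (rule mod_homI) auto
  have "carrier (free_module R n) \<subseteq> lin_span (carrier R) (free_module R n) ?bs"
  proof
    fix v assume v: "v \<in> carrier (free_module R n)"
    have "v = lin_comb (free_module R n) (\<lambda>i. basis_vec R n i) v n"
      by (rule F.mod_hom_free_eq_lin_comb[OF id v])
    also have "\<dots> = lin_comb (free_module R n) (\<lambda>i. ?bs ! i) v n"
      by (rule lin_comb_cong) simp_all
    also have "\<dots> = lin_comb (free_module R n) (\<lambda>i. ?bs ! i) v (length ?bs)" by simp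
    finally show "v \<in> lin_span (carrier R) (free_module R n) ?bs"
      unfolding F.lin_span_lin_comb[OF bs, symmetric] using v by (intro image_eqI[of _ _ v]) simp_all
  qed
  then obtain ns where ns: "set ns \<subseteq> N" "N = lin_span (carrier R) (free_module R n) ns"
    using F.submodule_of_lin_span[OF noetherian_ring_axioms bs assms] F.submoduleE(1)[OF assms] by blast
  have nsc: "set ns \<subseteq> carrier (free_module R n)" using ns(1) F.submoduleE(1)[OF assms] by blast
  then have "ns ! i \<in> carrier (free_module R n)" if "i < length ns" for i using that nth_mem by blast
  then show ?thesis using F.lin_comb_hom F.lin_span_lin_comb[OF nsc] ns(2) by metis
qed

text \<open>\<open>Ext_module\<close> selects its resolution by choice, so existence is what gives
  its vanishing any content. Free modules are mapped repeatedly onto the last kernel.\<close>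

lemma (in noetherian_cring) ex_free_resolution:
  assumes "module R M" "finitely_generated_module R M"
  shows "\<exists>b d \<epsilon>. free_resolution R M b d \<epsilon>"
proof -
  interpret M: module R M by fact
  let ?F = "free_module R"
  obtain ms where ms: "set ms \<subseteq> carrier M" "carrier M = lin_span (carrier R) M ms"
    using M.finitely_generated_span[OF assms(2)] by blast
  define \<epsilon> where "\<epsilon> v = lin_comb M (\<lambda>i. ms ! i) v (length ms)" for v
  have \<epsilon>: "\<epsilon> \<in> mod_hom R (?F (length ms)) M"
    unfolding \<epsilon>_def by (rule M.lin_comb_hom) (use ms(1) in auto)
  have \<epsilon>_surj: "\<epsilon> ` carrier (?F (length ms)) = carrier M"
    unfolding \<epsilon>_def M.lin_span_lin_comb[OF ms(1)] ms(2)[symmetric] ..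
  \<comment> \<open>A state (p, q, f) records a map \<open>f\<close> from rank \<open>q\<close> to
    rank \<open>p\<close>; \<open>Q\<close> demands exactness between consecutive states.\<close>
  define P where "P = (\<lambda>(p, q, f). f \<in> mod_hom R (?F q) (?F p))"
  define Q where "Q = (\<lambda>(p :: nat, q, f) (p', q', f'). p' = q \<and>
    f' ` carrier (?F q') = {v \<in> carrier (?F q). f v = \<zero>\<^bsub>?F p\<^esub>})"
  have step: "\<exists>y. P y \<and> Q x y" if x: "P x" for x
  proof -
    obtain p q f where x': "x = (p, q, f)" by (cases x)
    obtain c g where "g \<in> mod_hom R (?F c) (?F q)" "g ` carrier (?F c) = {v \<in> carrier (?F q). f v = \<zero>\<^bsub>?F p\<^esub>}"
      using submodule_of_free_image[OF mod_hom_kernel_submodule[OF free_module_module free_module_module, of f q p]]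
        x unfolding x' P_def by auto
    then show ?thesis unfolding x' P_def Q_def by (intro exI[of _ "(q, c, g)"]) simp
  qed
  obtain c g where g: "g \<in> mod_hom R (?F c) (?F (length ms))"
    "g ` carrier (?F c) = {v \<in> carrier (?F (length ms)). \<epsilon> v = \<zero>\<^bsub>M\<^esub>}"
    using submodule_of_free_image[OF mod_hom_kernel_submodule[OF free_module_module assms(1) \<epsilon>]] by blast
  have "\<exists>s. \<forall>n. (P (s n) \<and> (n = 0 \<longrightarrow> s n = (length ms, c, g))) \<and> Q (s n) (s (Suc n))"
    by (rule dependent_nat_choice) (use g step in \<open>auto simp: P_def\<close>)
  then obtain s where s: "\<And>n. P (s n)" "s 0 = (length ms, c, g)" "\<And>n. Q (s n) (s (Suc n))" by blast
  define b where "b n = fst (s n)" for n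
  define d where "d n = snd (snd (s n))" for n
  have sn: "s n = (b n, b (Suc n), d n)" for n
    using s(3)[of n] unfolding Q_def b_def d_def by (auto split: prod.splits)
  have "free_resolution R M b d \<epsilon>"
    unfolding free_resolution_def Let_def
  proof (intro conjI allI)
    have b0: "b 0 = length ms" "b (Suc 0) = c" "d 0 = g" using s(2) sn[of 0] by auto
    show "\<epsilon> \<in> mod_hom R (?F (b 0)) M" "\<epsilon> ` carrier (?F (b 0)) = carrier M"
      unfolding b0 by (rule \<epsilon>, rule \<epsilon>_surj)
    show "d n \<in> mod_hom R (?F (b (Suc n))) (?F (b n))" for n
      using s(1)[of n] unfolding sn P_def by simp
    show "d 0 ` carrier (?F (b 1)) = a_kernel (?F (b 0)) M \<epsilon>"
      unfolding One_nat_def b0 g(2) by (simp add: a_kernel_eq)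
    show "d (Suc n) ` carrier (?F (b (Suc (Suc n)))) = a_kernel (?F (b (Suc n))) (?F (b n)) (d n)" for n
      using s(3)[of n] unfolding sn Q_def by (simp add: a_kernel_eq)
  qed
  then show ?thesis by blast
qed

section \<open>Semidualizing modules\<close>

text \<open>Vanishing makes the coset of \<open>f\<close> equal to the set \<open>B\<close> of
  coboundaries; as \<open>B\<close> contains zero, \<open>f\<close> lies in its own coset and hence
  in \<open>B\<close>.\<close>

lemma Hom_cohomology_vanish:
  assumes "module R N" and d: "\<And>n. d n \<in> mod_hom R (free_module R (b (Suc n))) (free_module R (b n))"
    and van: "carrier (Hom_cohomology R b d N (Suc i)) = {\<zero>\<^bsub>Hom_cohomology R b d N (Suc i)\<^esub>}"
    and f: "f \<in> carrier (Hom_module R (free_module R (b (Suc i))) N)"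
      "compose (carrier (free_module R (b (Suc (Suc i))))) f (d (Suc i)) =
        \<zero>\<^bsub>Hom_module R (free_module R (b (Suc (Suc i)))) N\<^esub>"
  shows "\<exists>g\<in>carrier (Hom_module R (free_module R (b i)) N). f = compose (carrier (free_module R (b (Suc i)))) g (d i)"
proof -
  let ?F = "\<lambda>n. free_module R (b n)"
  let ?H = "\<lambda>n. Hom_module R (?F n) N"
  let ?\<delta> = "\<lambda>n f. compose (carrier (?F (Suc n))) f (d n)"
  define B where "B = ?\<delta> i ` carrier (?H i)"
  define Z where "Z = a_kernel (?H (Suc i)) (?H (Suc (Suc i))) (?\<delta> (Suc i))"
  let ?HZ = "(?H (Suc i))\<lparr>carrier := Z\<rparr>"
  interpret N: module R N by fact
  have F: "module R (?F n)" for n by (rule N.R.free_module_module)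
  interpret H: module R "?H (Suc i)" by (rule Hom_module_module[OF F assms(1)])
  have hc: "Hom_cohomology R b d N (Suc i) = quotient_module ?HZ B"
    unfolding Hom_cohomology_def Let_def B_def Z_def by simp
  have "f \<in> Z" unfolding Z_def a_kernel_eq using f by simp
  then have "B +>\<^bsub>?HZ\<^esub> f \<in> carrier (quotient_module ?HZ B)"
    unfolding quotient_module_def by (auto simp: A_RCOSETS_def')
  then have eq: "B +>\<^bsub>?HZ\<^esub> f = B" using van unfolding hc by (simp add: quotient_module_def)
  have zero: "\<zero>\<^bsub>?H (Suc i)\<^esub> \<in> B"
  proof -
    have z: "\<zero>\<^bsub>?H i\<^esub> \<in> carrier (?H i)"
      using abelian_group.axioms(1)[OF module.axioms(2)[OF Hom_module_module[OF F assms(1)]]]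
      by (rule abelian_monoid.zero_closed)
    have "?\<delta> i \<zero>\<^bsub>?H i\<^esub> = \<zero>\<^bsub>?H (Suc i)\<^esub>"
      using mod_homD(1)[OF d[of i]] by (auto simp: compose_def intro!: restrict_ext simp del: free_module_simps)
    then show ?thesis unfolding B_def using z by (metis imageI)
  qed
  have "f = \<zero>\<^bsub>?H (Suc i)\<^esub> \<oplus>\<^bsub>?H (Suc i)\<^esub> f" using H.M.l_zero[OF f(1)] by simp
  then have "f \<in> (\<Union>h\<in>B. {h \<oplus>\<^bsub>?H (Suc i)\<^esub> f})" using zero by blast
  then have "f \<in> B +>\<^bsub>?HZ\<^esub> f" by (simp add: a_r_coset_def')
  then show ?thesis using eq unfolding B_def by blast
qed

text \<open>
  \<open>Hom(L, L/IL)\<close> consists of homotheties for an ideal \<open>I\<close> generated by an \<open>L\<close>-regular sequence;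
  homomorphisms out of \<open>L\<close> are represented by homomorphisms out of a free module mapping onto \<open>L\<close>.
\<close>

lemma (in noetherian_cring) semidualizing_homothety_lift:
  assumes "semidualizing R L"
  shows "\<exists>n \<epsilon>. \<epsilon> \<in> mod_hom R (free_module R n) L \<and> \<epsilon> ` carrier (free_module R n) = carrier L \<and>
    (\<forall>xs f. set xs \<subseteq> carrier R \<longrightarrow> reg_seq L xs \<longrightarrow> f \<in> mod_hom R (free_module R n) L \<longrightarrow>
       (\<forall>v\<in>carrier (free_module R n). \<epsilon> v = \<zero>\<^bsub>L\<^esub> \<longrightarrow> f v \<in> seq_mult L xs) \<longrightarrow>
       (\<exists>a\<in>carrier R. \<forall>v\<in>carrier (free_module R n). \<exists>k\<in>seq_mult L xs. f v = k \<oplus>\<^bsub>L\<^esub> a \<odot>\<^bsub>L\<^esub> \<epsilon> v))"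
proof -
  have L: "module R L" and fg: "finitely_generated_module R L"
    and hom: "homothety L \<in> mod_iso R (regular_module R) (Hom_module R L L)"
    and ext: "\<And>i. i \<ge> 1 \<Longrightarrow> carrier (Ext_module R i L L) = {\<zero>\<^bsub>Ext_module R i L L\<^esub>}"
    using assms unfolding semidualizing_def by auto
  interpret L: module R L by fact
  \<comment> \<open>The resolution chosen inside \<open>Ext_module\<close> is named, so that
    vanishing of Ext becomes exactness, in positive degrees, of Hom of this very resolution into
    \<open>L\<close>.\<close>
  define X where "X = (SOME X. case X of (b, d, \<epsilon>) \<Rightarrow> free_resolution R L b d \<epsilon>)"
  obtain b d \<epsilon> where X: "X = (b, d, \<epsilon>)" by (cases X)
  have "\<exists>X. case X of (b, d, \<epsilon>) \<Rightarrow> free_resolution R L b d \<epsilon>" using ex_free_resolution[OF L fg] by auto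
  then have "case X of (b, d, \<epsilon>) \<Rightarrow> free_resolution R L b d \<epsilon>" unfolding X_def by (rule someI_ex)
  then have res: "free_resolution R L b d \<epsilon>" unfolding X by simp
  have Ext: "Ext_module R i L L = Hom_cohomology R b d L i" for i
    unfolding Ext_module_def X_def[symmetric] X by simp
  let ?F = "\<lambda>n. free_module R (b n)"
  have \<epsilon>: "\<epsilon> \<in> mod_hom R (?F 0) L" "\<epsilon> ` carrier (?F 0) = carrier L"
    and d: "\<And>n. d n \<in> mod_hom R (?F (Suc n)) (?F n)"
    and ker0: "d 0 ` carrier (?F (Suc 0)) = {v \<in> carrier (?F 0). \<epsilon> v = \<zero>\<^bsub>L\<^esub>}"
    and ker: "\<And>n. d (Suc n) ` carrier (?F (Suc (Suc n))) = {v \<in> carrier (?F (Suc n)). d n v = \<zero>\<^bsub>?F n\<^esub>}"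
    using res unfolding free_resolution_def Let_def a_kernel_eq One_nat_def by auto
  define H where "H n = Hom_module R (?F n) L" for n
  define \<delta> where "\<delta> n f = compose (carrier (?F (Suc n))) f (d n)" for n and f :: "(nat \<Rightarrow> 'a) \<Rightarrow> 'c"
  have F: "module R (?F n)" for n by (rule free_module_module)
  have Hmod: "module R (H n)" for n unfolding H_def by (rule Hom_module_module[OF F L])
  have HD: "f \<in> mod_hom R (?F n) L" if "f \<in> carrier (H n)" for f n using that unfolding H_def by simp
  have \<delta>v: "\<delta> n f v = f (d n v)" if "v \<in> carrier (?F (Suc n))" for n f v
    unfolding \<delta>_def using that by (simp add: compose_def del: free_module_simps)
  have \<delta>c: "\<delta> n f \<in> carrier (H (Suc n))" if f: "f \<in> carrier (H n)" for n f
    using mod_hom_restrict[OF F mod_hom_compose[OF d HD[OF f]]]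
    unfolding H_def \<delta>_def compose_def by simp
  have \<delta>hom: "\<delta> n \<in> mod_hom R (H n) (H (Suc n))" for n
  proof (rule mod_homI)
    show "\<delta> n f \<in> carrier (H (Suc n))" if "f \<in> carrier (H n)" for f using \<delta>c that by blast
    note dc = mod_homD(1)[OF d[of n]]
    show "\<delta> n (f \<oplus>\<^bsub>H n\<^esub> g) = \<delta> n f \<oplus>\<^bsub>H (Suc n)\<^esub> \<delta> n g" for f g
      unfolding \<delta>_def H_def using dc
      by (auto simp: compose_def fun_eq_iff restrict_def simp del: free_module_simps)
    show "\<delta> n (a \<odot>\<^bsub>H n\<^esub> f) = a \<odot>\<^bsub>H (Suc n)\<^esub> \<delta> n f" for a f
      unfolding \<delta>_def H_def using dc
      by (auto simp: compose_def fun_eq_iff restrict_def simp del: free_module_simps)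
  qed
  have \<delta>\<delta>: "\<delta> (Suc n) (\<delta> n f) = \<zero>\<^bsub>H (Suc (Suc n))\<^esub>" if f: "f \<in> carrier (H n)" for n f
  proof (rule Hom_module_eqI[of _ R "?F (Suc (Suc n))" L])
    show "\<delta> (Suc n) (\<delta> n f) \<in> carrier (Hom_module R (?F (Suc (Suc n))) L)"
      using \<delta>c[OF \<delta>c[OF f]] unfolding H_def .
    have "\<zero>\<^bsub>H (Suc (Suc n))\<^esub> \<in> carrier (H (Suc (Suc n)))"
      using abelian_monoid.zero_closed[OF abelian_group.axioms(1)[OF module.axioms(2)[OF Hmod]]] .
    then show "\<zero>\<^bsub>H (Suc (Suc n))\<^esub> \<in> carrier (Hom_module R (?F (Suc (Suc n))) L)" unfolding H_def .
    fix v assume v: "v \<in> carrier (?F (Suc (Suc n)))"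
    have "d n (d (Suc n) v) = \<zero>\<^bsub>?F n\<^esub>" using ker[of n] v by blast
    then have "\<delta> (Suc n) (\<delta> n f) v = f \<zero>\<^bsub>?F n\<^esub>"
      using \<delta>v[OF v] \<delta>v[OF mod_homD(1)[OF d v]] by simp
    also have "\<dots> = \<zero>\<^bsub>L\<^esub>" by (rule mod_hom_zero[OF F L HD[OF f]])
    finally show "\<delta> (Suc n) (\<delta> n f) v = \<zero>\<^bsub>H (Suc (Suc n))\<^esub> v" using v unfolding H_def by simp
  qed
  have exact: "\<exists>u\<in>carrier (H i). z = \<delta> i u"
    if "z \<in> carrier (H (Suc i))" "\<delta> (Suc i) z = \<zero>\<^bsub>H (Suc (Suc i))\<^esub>" for i z
    using Hom_cohomology_vanish[where b = b and d = d and i = i and f = z, OF L d] ext[of "Suc i"] that unfolding Ext H_def \<delta>_def by simp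
  \<comment> \<open>Since \<open>f\<close> is zero modulo I on the kernel of
    \<open>\<epsilon>\<close>, its composite with \<open>d 0\<close> is zero modulo I, so
    \<open>f\<close> is a cocycle modulo I. A lift to a true cocycle kills the kernel of
    \<open>\<epsilon>\<close> and factors through an endomorphism of \<open>L\<close>, which is a
    homothety.\<close>
  have lift: "\<exists>a\<in>carrier R. \<forall>v\<in>carrier (?F 0). \<exists>k\<in>seq_mult L xs. f v = k \<oplus>\<^bsub>L\<^esub> a \<odot>\<^bsub>L\<^esub> \<epsilon> v"
    if xs: "set xs \<subseteq> carrier R" "reg_seq L xs" and f: "f \<in> mod_hom R (?F 0) L"
      and fk: "\<forall>v\<in>carrier (?F 0). \<epsilon> v = \<zero>\<^bsub>L\<^esub> \<longrightarrow> f v \<in> seq_mult L xs" for xs f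
  proof -
    define f' where "f' = restrict f (carrier (?F 0))"
    have f': "f' \<in> carrier (H 0)" using mod_hom_restrict[OF F f] unfolding f'_def H_def by simp
    have regH: "reg_seq (H i) xs" for i unfolding H_def by (rule Hom_free_reg_seq[OF L xs])
    have "\<delta> 0 f' \<in> seq_mult (H (Suc 0)) xs"
      unfolding H_def
    proof (rule Hom_free_seq_mult[OF L xs(1)])
      show "\<delta> 0 f' \<in> carrier (Hom_module R (?F (Suc 0)) L)" using \<delta>c[OF f'] unfolding H_def .
      fix v assume v: "v \<in> carrier (?F (Suc 0))"
      then have dv: "d 0 v \<in> carrier (?F 0)" "\<epsilon> (d 0 v) = \<zero>\<^bsub>L\<^esub>" using ker0 by blast+
      then have "\<delta> 0 f' v = f (d 0 v)" using \<delta>v[OF v] unfolding f'_def by (simp del: free_module_simps)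
      then show "\<delta> 0 f' v \<in> seq_mult L xs" using fk dv by simp
    qed
    then obtain k z where k: "k \<in> seq_mult (H 0) xs" "z \<in> carrier (H 0)" "\<delta> 0 z = \<zero>\<^bsub>H (Suc 0)\<^esub>" "f' = k \<oplus>\<^bsub>H 0\<^esub> z"
      using cocycle_lift[of R H \<delta>, OF Hmod \<delta>hom \<delta>\<delta> exact xs(1) regH f'] by blast
    have z: "z \<in> mod_hom R (?F 0) L" by (rule HD[OF k(2)])
    note Dz = mod_homD[OF z] and D\<epsilon> = mod_homD[OF \<epsilon>(1)]
    interpret F0: module R "?F 0" by (rule F)
    have z0: "z v = \<zero>\<^bsub>L\<^esub>" if v: "v \<in> carrier (?F 0)" "\<epsilon> v = \<zero>\<^bsub>L\<^esub>" for v
    proof -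
      obtain u where u: "u \<in> carrier (?F (Suc 0))" "v = d 0 u" using ker0 v by blast
      have "\<delta> 0 z u = \<zero>\<^bsub>L\<^esub>" unfolding k(3) using u(1) by (simp add: H_def)
      then show ?thesis using \<delta>v[OF u(1)] u(2) by simp
    qed
    have zeq: "z v = z w" if vw: "v \<in> carrier (?F 0)" "w \<in> carrier (?F 0)" "\<epsilon> v = \<epsilon> w" for v w
    proof -
      have "\<epsilon> (v \<ominus>\<^bsub>?F 0\<^esub> w) = \<zero>\<^bsub>L\<^esub>"
        using mod_hom_minus(2)[OF F L \<epsilon>(1) vw(1,2)] vw D\<epsilon>(1) by (simp add: L.M.r_neg a_minus_def)
      then have eq0: "z v \<ominus>\<^bsub>L\<^esub> z w = \<zero>\<^bsub>L\<^esub>"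
        using z0[of "v \<ominus>\<^bsub>?F 0\<^esub> w"] mod_hom_minus(2)[OF F L z vw(1,2)] F0.M.minus_closed[OF vw(1,2)] by simp
      have "z v = (z v \<ominus>\<^bsub>L\<^esub> z w) \<oplus>\<^bsub>L\<^esub> z w"
        using Dz(1)[OF vw(1)] Dz(1)[OF vw(2)] by (simp add: a_minus_def L.M.a_assoc L.M.l_neg)
      also have "\<dots> = z w" unfolding eq0 by (rule L.M.l_zero[OF Dz(1)[OF vw(2)]])
      finally show ?thesis .
    qed
    \<comment> \<open>A set-theoretic section suffices: \<open>z\<close> agrees on vectors with the
      same image, which makes \<open>h\<close> linear.\<close>
    define sec where "sec l = (SOME v. v \<in> carrier (?F 0) \<and> \<epsilon> v = l)" for l
    have sec: "sec l \<in> carrier (?F 0)" "\<epsilon> (sec l) = l" if "l \<in> carrier L" for l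
    proof -
      have "l \<in> \<epsilon> ` carrier (?F 0)" unfolding \<epsilon>(2) by (rule that)
      then have "\<exists>v. v \<in> carrier (?F 0) \<and> \<epsilon> v = l" by (auto simp del: free_module_simps)
      then have "sec l \<in> carrier (?F 0) \<and> \<epsilon> (sec l) = l" unfolding sec_def by (rule someI_ex)
      then show "sec l \<in> carrier (?F 0)" "\<epsilon> (sec l) = l" by auto
    qed
    define h where "h = (\<lambda>l\<in>carrier L. z (sec l))"
    have "h \<in> mod_hom R L L"
    proof (rule mod_homI)
      show "h l \<in> carrier L" if "l \<in> carrier L" for l using that sec Dz(1) unfolding h_def by simp
      fix l l' assume l: "l \<in> carrier L" "l' \<in> carrier L"
      have "z (sec (l \<oplus>\<^bsub>L\<^esub> l')) = z (sec l \<oplus>\<^bsub>?F 0\<^esub> sec l')"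
        by (rule zeq) (use l sec D\<epsilon>(2) F0.M.a_closed in \<open>auto simp del: free_module_simps\<close>)
      then show "h (l \<oplus>\<^bsub>L\<^esub> l') = h l \<oplus>\<^bsub>L\<^esub> h l'" using l sec Dz(2) unfolding h_def by simp
    next
      fix a l assume l: "a \<in> carrier R" "l \<in> carrier L"
      have "z (sec (a \<odot>\<^bsub>L\<^esub> l)) = z (a \<odot>\<^bsub>?F 0\<^esub> sec l)"
        by (rule zeq) (use l sec D\<epsilon>(3) F0.smult_closed in \<open>auto simp del: free_module_simps\<close>)
      then show "h (a \<odot>\<^bsub>L\<^esub> l) = a \<odot>\<^bsub>L\<^esub> h l" using l sec Dz(3) unfolding h_def by simp
    qed
    then have "h \<in> homothety L ` carrier R"
      using hom unfolding mod_iso_def bij_betw_def by (auto simp: h_def)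
    then obtain a where a: "a \<in> carrier R" "h = homothety L a" by blast
    have za: "z v = a \<odot>\<^bsub>L\<^esub> \<epsilon> v" if v: "v \<in> carrier (?F 0)" for v
    proof -
      have "z v = h (\<epsilon> v)" using zeq[OF v, of "sec (\<epsilon> v)"] sec[OF D\<epsilon>(1)[OF v]] D\<epsilon>(1)[OF v] unfolding h_def by simp
      then show ?thesis unfolding a(2) homothety_def using D\<epsilon>(1)[OF v] by simp
    qed
    have "\<exists>k\<in>seq_mult L xs. f v = k \<oplus>\<^bsub>L\<^esub> a \<odot>\<^bsub>L\<^esub> \<epsilon> v" if v: "v \<in> carrier (?F 0)" for v
    proof (rule bexI)
      have "f v = f' v" unfolding f'_def using v by simp
      also have "\<dots> = k v \<oplus>\<^bsub>L\<^esub> z v" unfolding k(4) H_def using v by simp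
      finally show "f v = k v \<oplus>\<^bsub>L\<^esub> a \<odot>\<^bsub>L\<^esub> \<epsilon> v" using za[OF v] by simp
      show "k v \<in> seq_mult L xs"
        using Hom_module_seq_mult_apply[OF F L xs(1) _ v] k(1) unfolding H_def by blast
    qed
    then show ?thesis using a(1) by blast
  qed
  show ?thesis using \<epsilon> lift by (intro exI[of _ "b 0"] exI[of _ \<epsilon>]) blast
qed

text \<open>Injectivity of the homothety map starts an induction on the sequence. If a L lies in (x,
  I') L, then a \<open>\<epsilon>\<close> = x g + k on the free cover, with k valued in I' L. By
  regularity g is zero modulo I' on the kernel of \<open>\<epsilon>\<close>, so modulo I' it is
  multiplication by some c, and a - x c falls under the induction hypothesis.\<close>

lemma (in noetherian_cring) semidualizing_faithful_mod:
  assumes "semidualizing R L" "set xs \<subseteq> carrier R" "reg_seq L xs" "a \<in> carrier R"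
    and "\<And>l. l \<in> carrier L \<Longrightarrow> a \<odot>\<^bsub>L\<^esub> l \<in> seq_mult L xs"
  shows "a \<in> seq_mult (regular_module R) xs"
proof -
  have L: "module R L" and hom: "homothety L \<in> mod_iso R (regular_module R) (Hom_module R L L)"
    using assms(1) unfolding semidualizing_def by auto
  interpret L: module R L by fact
  obtain n \<epsilon> where \<epsilon>: "\<epsilon> \<in> mod_hom R (free_module R n) L" "\<epsilon> ` carrier (free_module R n) = carrier L"
    and lift: "\<And>xs f. set xs \<subseteq> carrier R \<Longrightarrow> reg_seq L xs \<Longrightarrow> f \<in> mod_hom R (free_module R n) L \<Longrightarrow>
       (\<forall>v\<in>carrier (free_module R n). \<epsilon> v = \<zero>\<^bsub>L\<^esub> \<longrightarrow> f v \<in> seq_mult L xs) \<Longrightarrow>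
       \<exists>a\<in>carrier R. \<forall>v\<in>carrier (free_module R n). \<exists>k\<in>seq_mult L xs. f v = k \<oplus>\<^bsub>L\<^esub> a \<odot>\<^bsub>L\<^esub> \<epsilon> v"
    using semidualizing_homothety_lift[OF assms(1)] by metis
  let ?F = "free_module R n" and ?H = "Hom_module R (free_module R n) L"
  note D = mod_homD[OF \<epsilon>(1)]
  have F: "module R ?F" by (rule free_module_module)
  interpret F: module R ?F by (rule F)
  show ?thesis using assms(2-)
  proof (induction xs arbitrary: a)
    case Nil
    interpret H: module R "Hom_module R L L" by (rule Hom_module_module[OF L L])
    have "homothety L a = homothety L \<zero>"
      using Nil by (auto simp: homothety_def)
    moreover have "inj_on (homothety L) (carrier R)" using hom unfolding mod_iso_def bij_betw_def by simp
    ultimately have "a = \<zero>" using Nil(3) by (meson inj_onD zero_closed)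
    then show ?case by simp
  next
    case (Cons x xs)
    have xs: "set xs \<subseteq> carrier R" and x: "x \<in> carrier R" and reg: "reg_seq L xs" using Cons.prems by auto
    have regx: "u \<in> seq_mult L xs" if "u \<in> carrier L" "x \<odot>\<^bsub>L\<^esub> u \<in> seq_mult L xs" for u
      using Cons.prems(2) that by simp
    define f where "f = (\<lambda>v\<in>carrier ?F. a \<odot>\<^bsub>L\<^esub> \<epsilon> v)"
    have "(\<lambda>v. a \<odot>\<^bsub>L\<^esub> \<epsilon> v) \<in> mod_hom R ?F L"
      by (rule mod_homI)
        (use Cons.prems(3) D in \<open>auto simp: L.smult_r_distr L.smult_assoc1[symmetric] m_comm simp del: free_module_simps\<close>)
    then have f: "f \<in> carrier ?H" using mod_hom_restrict[OF F] unfolding f_def by simp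
    have "f \<in> seq_mult ?H (x # xs)"
      by (rule Hom_free_seq_mult[OF L Cons.prems(1) f])
        (use Cons.prems(4) D(1) in \<open>simp add: f_def del: free_module_simps seq_mult.simps\<close>)
    then obtain g k where g: "g \<in> carrier ?H" "k \<in> seq_mult ?H xs" "f = x \<odot>\<^bsub>?H\<^esub> g \<oplus>\<^bsub>?H\<^esub> k" by auto
    have gh: "g \<in> mod_hom R ?F L" using g(1) by simp
    have kv: "k v \<in> seq_mult L xs" if "v \<in> carrier ?F" for v
      by (rule Hom_module_seq_mult_apply[OF F L xs g(2) that])
    have fv: "a \<odot>\<^bsub>L\<^esub> \<epsilon> v = x \<odot>\<^bsub>L\<^esub> g v \<oplus>\<^bsub>L\<^esub> k v" if v: "v \<in> carrier ?F" for v
    proof -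
      have "f v = x \<odot>\<^bsub>L\<^esub> g v \<oplus>\<^bsub>L\<^esub> k v" unfolding g(3) using v by simp
      then show ?thesis unfolding f_def using v by simp
    qed
    note S = L.seq_mult_simps[OF xs]
    have gv: "g v \<in> carrier L" if "v \<in> carrier ?F" for v using mod_homD(1)[OF gh that] .
    have "g v \<in> seq_mult L xs" if v: "v \<in> carrier ?F" "\<epsilon> v = \<zero>\<^bsub>L\<^esub>" for v
    proof (rule regx[OF gv[OF v(1)]])
      have "\<zero>\<^bsub>L\<^esub> = x \<odot>\<^bsub>L\<^esub> g v \<oplus>\<^bsub>L\<^esub> k v" using fv[OF v(1)] v(2) Cons.prems(3) by simp
      then have "x \<odot>\<^bsub>L\<^esub> g v = \<ominus>\<^bsub>L\<^esub> k v"
        using L.M.minus_equality[of "x \<odot>\<^bsub>L\<^esub> g v" "k v"] x gv[OF v(1)] kv[OF v(1)] S(1) by auto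
      then show "x \<odot>\<^bsub>L\<^esub> g v \<in> seq_mult L xs" using S(4)[OF kv[OF v(1)]] by simp
    qed
    then obtain c where c: "c \<in> carrier R"
      "\<And>v. v \<in> carrier ?F \<Longrightarrow> \<exists>k\<in>seq_mult L xs. g v = k \<oplus>\<^bsub>L\<^esub> c \<odot>\<^bsub>L\<^esub> \<epsilon> v"
      using lift[OF xs reg gh] by blast
    have "a \<oplus> (\<ominus> x) \<otimes> c \<in> seq_mult (regular_module R) xs"
    proof (rule Cons.IH[OF xs reg])
      show "a \<oplus> (\<ominus> x) \<otimes> c \<in> carrier R" using Cons.prems(3) x c(1) by simp
      fix l assume "l \<in> carrier L"
      then obtain v where v: "v \<in> carrier ?F" "l = \<epsilon> v" using \<epsilon>(2) by blast
      obtain k' where k': "k' \<in> seq_mult L xs" "g v = k' \<oplus>\<^bsub>L\<^esub> c \<odot>\<^bsub>L\<^esub> \<epsilon> v" using c(2)[OF v(1)] by blast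
      have cc: "k' \<in> carrier L" "k v \<in> carrier L" "\<epsilon> v \<in> carrier L" using k' kv[OF v(1)] S(1) D(1)[OF v(1)] by auto
      have "(a \<oplus> (\<ominus> x) \<otimes> c) \<odot>\<^bsub>L\<^esub> l = a \<odot>\<^bsub>L\<^esub> \<epsilon> v \<oplus>\<^bsub>L\<^esub> \<ominus>\<^bsub>L\<^esub> (x \<odot>\<^bsub>L\<^esub> (c \<odot>\<^bsub>L\<^esub> \<epsilon> v))"
        unfolding v(2) using Cons.prems(3) x c(1) cc by (simp add: L.smult_l_distr L.smult_assoc1 L.smult_l_minus)
      also have "\<dots> = x \<odot>\<^bsub>L\<^esub> k' \<oplus>\<^bsub>L\<^esub> k v"
        unfolding fv[OF v(1)] k'(2) using x c(1) cc
        by (simp add: L.smult_r_distr L.M.a_ac L.M.r_neg L.M.r_neg1 L.M.r_neg2)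
      also have "\<dots> \<in> seq_mult L xs" using S(3)[OF S(6)[OF k'(1) x] kv[OF v(1)]] .
      finally show "(a \<oplus> (\<ominus> x) \<otimes> c) \<odot>\<^bsub>L\<^esub> l \<in> seq_mult L xs" .
    qed
    then have "x \<otimes> c \<oplus> (a \<oplus> (\<ominus> x) \<otimes> c) \<in> seq_mult (regular_module R) (x # xs)"
      using seq_mult_ConsI[of c "regular_module R" "a \<oplus> (\<ominus> x) \<otimes> c" xs x] c(1) by simp
    moreover have "x \<otimes> c \<oplus> (a \<oplus> (\<ominus> x) \<otimes> c) = a" using x c(1) Cons.prems(3) by algebra
    ultimately show ?case by simp
  qed
qed

section \<open>Socle elements and the extension of regular sequences\<close>

lemma (in module) lin_comb_in_submodule:
  assumes "submodule N R M" "\<And>i. i < k \<Longrightarrow> v i \<in> carrier R" "\<And>i. i < k \<Longrightarrow> m i \<in> N"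
  shows "lin_comb M m v k \<in> N"
proof -
  have "\<zero>\<^bsub>M\<^esub> \<in> N" using subgroup.one_closed[OF submodule.axioms(1)[OF assms(1)]] by simp
  then show ?thesis using assms(2,3) by (induction k) (auto intro: submoduleE(4,5)[OF assms(1)])
qed

text \<open>\<open>g\<close> is the first generator outside the span \<open>N\<close> of those after
  it. The quotient by \<open>N\<close> is cyclic and nonzero, and over a local ring the coefficient
  of \<open>g\<close> modulo the maximal ideal gives the projection onto the residue field used in
  \<open>semidualizing_socle\<close>.\<close>

lemma (in module) ex_submodule_corank_one:
  assumes "set ms \<subseteq> carrier M" "lin_span (carrier R) M ms \<noteq> {\<zero>\<^bsub>M\<^esub>}"
  shows "\<exists>N g. submodule N R M \<and> g \<in> carrier M \<and> g \<notin> N \<and>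
    (\<forall>l\<in>lin_span (carrier R) M ms. \<exists>c\<in>carrier R. \<exists>k\<in>N. l = c \<odot>\<^bsub>M\<^esub> g \<oplus>\<^bsub>M\<^esub> k)"
  using assms
proof (induction ms)
  case (Cons m ms)
  let ?L = "lin_span (carrier R) M"
  have m: "m \<in> carrier M" and ms: "set ms \<subseteq> carrier M" using Cons.prems by auto
  have sm: "submodule (?L ms) R M" by (rule lin_span_submodule[OF R.oneideal ms])
  show ?case
  proof (cases "m \<in> ?L ms")
    case False
    then show ?thesis using sm m by (intro exI[of _ "?L ms"] exI[of _ m]) auto
  next
    case True
    then have "?L (m # ms) \<subseteq> ?L ms"
      using lin_span_gens[OF R.oneideal _ ms] by (intro lin_span_least[OF sm]) auto
    moreover have "\<zero>\<^bsub>M\<^esub> \<in> ?L (m # ms)"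
      using subgroup.one_closed[OF submodule.axioms(1)[OF lin_span_submodule[OF R.oneideal Cons.prems(1)]]] by simp
    ultimately have "?L ms \<noteq> {\<zero>\<^bsub>M\<^esub>}" using Cons.prems(2) by blast
    then show ?thesis using Cons.IH[OF ms] \<open>?L (m # ms) \<subseteq> ?L ms\<close> by (meson subsetD)
  qed
qed simp

context noetherian_local_ring
begin

lemma max_ideal_saturated:
  assumes "ideal K R" shows "saturation R \<mm> K \<subseteq> K"
proof
  interpret K: ideal K R by fact
  fix u assume "u \<in> saturation R \<mm> K"
  then obtain s where s: "s \<in> carrier R" "s \<notin> \<mm>" "s \<otimes> u \<in> K" "u \<in> carrier R" unfolding saturation_def by blast
  obtain c where c: "c \<in> carrier R" "c \<otimes> s = \<one>" using unit_of_not_max s by blast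
  have "u = (c \<otimes> s) \<otimes> u" unfolding c(2) using s by simp
  also have "\<dots> = c \<otimes> (s \<otimes> u)" by (rule m_assoc) (use c s in auto)
  finally show "u \<in> K" using K.I_l_closed[OF s(3) c(1)] by simp
qed

lemma max_ideal_nakayama:
  assumes "ideal K R" "\<mm> \<subseteq> set_add R \<mm>2 K"
  shows "\<mm> \<subseteq> K"
proof -
  interpret m: primeideal \<mm> R by (rule max_ideal_prime)
  interpret K: ideal K R by fact
  interpret RM: module R "regular_module R" by (rule regular_module_module)
  obtain gs where gs: "set gs \<subseteq> carrier R" "\<mm> = Idl (set gs)" by (rule ideal_gens[OF max_ideal_ideal])
  have span: "\<mm> = lin_span (carrier R) (regular_module R) gs" using gs Idl_eq_lin_span by simp
  let ?P = "lin_span \<mm> (regular_module R) gs"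
  have P: "ideal ?P R" by (rule lin_span_ideal[OF max_ideal_ideal gs(1)])
  have sq: "\<mm>2 \<subseteq> ?P"
  proof
    fix v assume "v \<in> \<mm>2"
    then show "v \<in> ?P"
    proof induction
      case (prod i j)
      then show ?case using RM.lin_span_smult_coeff[OF max_ideal_ideal, of i gs j] gs(1) span by simp
    next
      case (sum s1 s2)
      then show ?case using additive_subgroup.a_closed[OF ideal.axioms(1)[OF P]] by simp
    qed
  qed
  have "set gs \<subseteq> K"
  proof (rule m.nakayama[OF assms(1) max_ideal_saturated[OF assms(1)] gs(1)])
    fix u assume u: "u \<in> set gs"
    then have uc: "u \<in> carrier R" and "u \<in> \<mm>" using gs genideal_self by auto
    then obtain p k where p: "p \<in> \<mm>2" "k \<in> K" "u = p \<oplus> k" using assms(2) unfolding set_add_def' by blast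
    have "u = k \<oplus> p" unfolding p(3) using p ideal.Icarr[OF max_ideal_sq_ideal] K.Icarr by (simp add: a_comm)
    then show "u \<in> saturation R \<mm> {k \<oplus> q | k q. k \<in> K \<and> q \<in> ?P}"
      using p sq uc m.one_notin by (intro saturationI[of _ _ \<one>]) auto
  qed
  then show ?thesis using gs(2) genideal_minimal[OF assms(1)] by simp
qed

text \<open>
  If \<open>\<mm> y \<subseteq> I L\<close> with \<open>y \<notin> I L\<close>, the composite \<open>L \<rightarrow> k \<rightarrow> L / I L\<close> with image spanned by \<open>y\<close> is a
  homothety, by an element \<open>a\<close> in the socle of \<open>R / I\<close>.
\<close>

lemma semidualizing_socle:
  assumes "semidualizing R L" "set xs \<subseteq> carrier R" "reg_seq L xs"
    and y: "y \<in> carrier L" "y \<notin> seq_mult L xs" "\<And>r. r \<in> \<mm> \<Longrightarrow> r \<odot>\<^bsub>L\<^esub> y \<in> seq_mult L xs"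
  shows "\<exists>a\<in>carrier R. a \<notin> seq_mult (regular_module R) xs \<and>
    (\<forall>r\<in>\<mm>. r \<otimes> a \<in> seq_mult (regular_module R) xs)"
proof -
  have L: "module R L" and fg: "finitely_generated_module R L"
    using assms(1) unfolding semidualizing_def by auto
  interpret L: module R L by fact
  interpret m: primeideal \<mm> R by (rule max_ideal_prime)
  obtain n \<epsilon> where \<epsilon>: "\<epsilon> \<in> mod_hom R (free_module R n) L" "\<epsilon> ` carrier (free_module R n) = carrier L"
    and lift: "\<And>xs f. set xs \<subseteq> carrier R \<Longrightarrow> reg_seq L xs \<Longrightarrow> f \<in> mod_hom R (free_module R n) L \<Longrightarrow>
       (\<forall>v\<in>carrier (free_module R n). \<epsilon> v = \<zero>\<^bsub>L\<^esub> \<longrightarrow> f v \<in> seq_mult L xs) \<Longrightarrow>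
       \<exists>a\<in>carrier R. \<forall>v\<in>carrier (free_module R n). \<exists>k\<in>seq_mult L xs. f v = k \<oplus>\<^bsub>L\<^esub> a \<odot>\<^bsub>L\<^esub> \<epsilon> v"
    using semidualizing_homothety_lift[OF assms(1)] by metis
  let ?F = "free_module R n"
  have F: "module R ?F" by (rule free_module_module)
  note D = mod_homD[OF \<epsilon>(1)] and S = L.seq_mult_simps[OF assms(2)]
  obtain ms where ms: "set ms \<subseteq> carrier L" "carrier L = lin_span (carrier R) L ms"
    using L.finitely_generated_span[OF fg] by blast
  have "lin_span (carrier R) L ms \<noteq> {\<zero>\<^bsub>L\<^esub>}" unfolding ms(2)[symmetric] using y(1,2) S(2) by auto
  then obtain N g where N: "submodule N R L" and g: "g \<in> carrier L" "g \<notin> N"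
    and dec: "\<And>l. l \<in> carrier L \<Longrightarrow> \<exists>c\<in>carrier R. \<exists>k\<in>N. l = c \<odot>\<^bsub>L\<^esub> g \<oplus>\<^bsub>L\<^esub> k"
    using L.ex_submodule_corank_one[OF ms(1)] unfolding ms(2)[symmetric] by blast
  note E = L.submoduleE[OF N]
  \<comment> \<open>A unit coefficient would put \<open>g\<close> into \<open>N\<close>; hence
    coefficients of \<open>g\<close> are determined modulo the maximal ideal.\<close>
  have coeff_max: "c \<in> \<mm>" if c: "c \<in> carrier R" "c \<odot>\<^bsub>L\<^esub> g \<in> N" for c
  proof (rule ccontr)
    assume "c \<notin> \<mm>"
    then obtain e where e: "e \<in> carrier R" "e \<otimes> c = \<one>" using unit_of_not_max c by blast
    have "e \<odot>\<^bsub>L\<^esub> (c \<odot>\<^bsub>L\<^esub> g) = g" using e c g by (simp add: L.smult_assoc1[symmetric])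
    then show False using E(4)[OF e(1) c(2)] g(2) by simp
  qed
  have "\<forall>i. \<exists>c. c \<in> carrier R \<and> (\<exists>k\<in>N. \<epsilon> (basis_vec R n i) = c \<odot>\<^bsub>L\<^esub> g \<oplus>\<^bsub>L\<^esub> k)"
    using dec[OF D(1)[OF basis_vec_closed]] by blast
  then obtain c where c: "\<And>i. c i \<in> carrier R" "\<And>i. \<exists>k\<in>N. \<epsilon> (basis_vec R n i) = c i \<odot>\<^bsub>L\<^esub> g \<oplus>\<^bsub>L\<^esub> k"
    by metis
  interpret RM: module R "regular_module R" by (rule regular_module_module)
  \<comment> \<open>\<open>\<kappa>\<close> lifts the coefficient of \<open>g\<close> to a linear
    form on the free cover, with chosen values on basis vectors. Modulo the maximal ideal it
    represents the projection of \<open>L\<close> onto the residue field.\<close>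
  define \<kappa> where "\<kappa> v = lin_comb (regular_module R) c v n" for v
  have \<kappa>: "\<kappa> \<in> mod_hom R ?F (regular_module R)" unfolding \<kappa>_def by (rule RM.lin_comb_hom) (use c in simp)
  note K = mod_homD[OF \<kappa>, simplified regular_module_simps]
  have scale: "(\<lambda>v. \<kappa> v \<odot>\<^bsub>L\<^esub> l) \<in> mod_hom R ?F L" if l: "l \<in> carrier L" for l
    by (rule mod_homI)
      (use l K in \<open>simp_all add: L.smult_l_distr L.smult_assoc1 del: free_module_simps\<close>)
  have near: "\<epsilon> v \<ominus>\<^bsub>L\<^esub> \<kappa> v \<odot>\<^bsub>L\<^esub> g \<in> N" if v: "v \<in> carrier ?F" for v
  proof -
    let ?f = "\<lambda>v. \<epsilon> v \<ominus>\<^bsub>L\<^esub> \<kappa> v \<odot>\<^bsub>L\<^esub> g"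
    note G = mod_homD[OF scale[OF g(1)]]
    have f: "?f \<in> mod_hom R ?F L"
      by (rule mod_homI)
        (use D G in \<open>simp_all add: a_minus_def L.M.minus_add L.M.a_ac L.smult_r_distr L.smult_r_minus del: free_module_simps\<close>)
    have "?f (basis_vec R n i) \<in> N" if i: "i < n" for i
    proof -
      have "\<kappa> (basis_vec R n i) = c i"
        unfolding \<kappa>_def by (rule RM.lin_comb_basis_vec[OF _ i]) (use c in simp)
      moreover obtain k where k: "k \<in> N" "\<epsilon> (basis_vec R n i) = c i \<odot>\<^bsub>L\<^esub> g \<oplus>\<^bsub>L\<^esub> k" using c(2) by blast
      moreover have "(c i \<odot>\<^bsub>L\<^esub> g \<oplus>\<^bsub>L\<^esub> k) \<ominus>\<^bsub>L\<^esub> c i \<odot>\<^bsub>L\<^esub> g = k"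
        using c(1)[of i] g(1) k(1) E(1) by (auto simp: a_minus_def L.M.a_ac L.M.r_neg L.M.r_neg1 L.M.r_neg2)
      ultimately show ?thesis by simp
    qed
    then show ?thesis
      unfolding L.mod_hom_free_eq_lin_comb[OF f v] using v by (intro L.lin_comb_in_submodule[OF N]) auto
  qed
  \<comment> \<open>So sending v to \<open>\<kappa>\<close> v y is zero modulo I \<open>L\<close> on
    the kernel of \<open>\<epsilon>\<close> and stands for a homomorphism L \<rightarrow> L/IL, to
    which the homothety lemma applies.\<close>
  have "\<kappa> v \<odot>\<^bsub>L\<^esub> y \<in> seq_mult L xs" if v: "v \<in> carrier ?F" "\<epsilon> v = \<zero>\<^bsub>L\<^esub>" for v
  proof -
    have "\<ominus>\<^bsub>L\<^esub> (\<kappa> v \<odot>\<^bsub>L\<^esub> g) \<in> N" using near[OF v(1)] v(2) K(1)[OF v(1)] g(1) by (simp add: a_minus_def)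
    then have "\<kappa> v \<odot>\<^bsub>L\<^esub> g \<in> N" using E(3)[of "\<ominus>\<^bsub>L\<^esub> (\<kappa> v \<odot>\<^bsub>L\<^esub> g)"] K(1)[OF v(1)] g(1) by simp
    then show ?thesis using y(3)[OF coeff_max[OF K(1)[OF v(1)]]] by simp
  qed
  then obtain a where a: "a \<in> carrier R"
    "\<And>v. v \<in> carrier ?F \<Longrightarrow> \<exists>k\<in>seq_mult L xs. \<kappa> v \<odot>\<^bsub>L\<^esub> y = k \<oplus>\<^bsub>L\<^esub> a \<odot>\<^bsub>L\<^esub> \<epsilon> v"
    using lift[OF assms(2,3) scale[OF y(1)]] by blast
  have notin: "a \<notin> seq_mult (regular_module R) xs"
  proof
    assume aI: "a \<in> seq_mult (regular_module R) xs"
    \<comment> \<open>At a preimage of \<open>g\<close> the form \<open>\<kappa>\<close> is one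
      modulo the maximal ideal. With a in I, both \<open>\<kappa>\<close> v y and (1 -
      \<open>\<kappa>\<close> v) y would lie in I \<open>L\<close>, and so would y.\<close>
    obtain v where v: "v \<in> carrier ?F" "g = \<epsilon> v" using g(1) \<epsilon>(2) by blast
    note Kv = K(1)[OF v(1)]
    have "(\<lambda>r. r \<odot>\<^bsub>L\<^esub> g) \<in> mod_hom R (regular_module R) L"
      by (rule mod_homI) (use g(1) in \<open>simp_all add: L.smult_l_distr L.smult_assoc1\<close>)
    from mod_hom_seq_mult[OF RM.module_axioms L this assms(2) aI]
    have ag: "a \<odot>\<^bsub>L\<^esub> g \<in> seq_mult L xs" .
    obtain k where "k \<in> seq_mult L xs" "\<kappa> v \<odot>\<^bsub>L\<^esub> y = k \<oplus>\<^bsub>L\<^esub> a \<odot>\<^bsub>L\<^esub> g" using a(2)[OF v(1)] v(2) by blast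
    then have 1: "\<kappa> v \<odot>\<^bsub>L\<^esub> y \<in> seq_mult L xs" using S(3) ag by simp
    have "(\<one> \<ominus> \<kappa> v) \<odot>\<^bsub>L\<^esub> g = \<epsilon> v \<ominus>\<^bsub>L\<^esub> \<kappa> v \<odot>\<^bsub>L\<^esub> g"
      unfolding v(2)[symmetric] using Kv g(1) by (simp add: a_minus_def L.smult_l_distr L.smult_l_minus)
    then have "\<one> \<ominus> \<kappa> v \<in> \<mm>" using near[OF v(1)] Kv by (intro coeff_max) auto
    then have 2: "(\<one> \<ominus> \<kappa> v) \<odot>\<^bsub>L\<^esub> y \<in> seq_mult L xs" by (rule y(3))
    have "(\<one> \<ominus> \<kappa> v) \<odot>\<^bsub>L\<^esub> y \<oplus>\<^bsub>L\<^esub> \<kappa> v \<odot>\<^bsub>L\<^esub> y = ((\<one> \<ominus> \<kappa> v) \<oplus> \<kappa> v) \<odot>\<^bsub>L\<^esub> y"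
      using Kv y(1) by (simp add: L.smult_l_distr)
    also have "(\<one> \<ominus> \<kappa> v) \<oplus> \<kappa> v = \<one>" using Kv by algebra
    finally show False using S(3)[OF 2 1] y(1,2) by simp
  qed
  \<comment> \<open>The homomorphism has image spanned by y, and r moves y into I \<open>L\<close>;
    thus r a acts as zero on L/IL and faithfulness applies.\<close>
  have "r \<otimes> a \<in> seq_mult (regular_module R) xs" if r: "r \<in> \<mm>" for r
  proof (rule semidualizing_faithful_mod[OF assms(1-3)])
    have rc: "r \<in> carrier R" using r m.Icarr by blast
    show "r \<otimes> a \<in> carrier R" using rc a(1) by simp
    fix l assume "l \<in> carrier L"
    then obtain v where v: "v \<in> carrier ?F" "l = \<epsilon> v" using \<epsilon>(2) by blast
    obtain k where k: "k \<in> seq_mult L xs" "\<kappa> v \<odot>\<^bsub>L\<^esub> y = k \<oplus>\<^bsub>L\<^esub> a \<odot>\<^bsub>L\<^esub> l" using a(2)[OF v(1)] v(2) by blast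
    have kc: "k \<in> carrier L" "l \<in> carrier L" "\<kappa> v \<in> carrier R" using k S(1) v D(1) K(1) by auto
    have "\<kappa> v \<odot>\<^bsub>L\<^esub> (r \<odot>\<^bsub>L\<^esub> y) = r \<odot>\<^bsub>L\<^esub> (\<kappa> v \<odot>\<^bsub>L\<^esub> y)"
      using rc kc y(1) by (simp add: L.smult_assoc1[symmetric] m_comm)
    also have "\<dots> = r \<odot>\<^bsub>L\<^esub> k \<oplus>\<^bsub>L\<^esub> (r \<otimes> a) \<odot>\<^bsub>L\<^esub> l"
      unfolding k(2) using rc a(1) kc by (simp add: L.smult_r_distr L.smult_assoc1)
    finally have "(r \<otimes> a) \<odot>\<^bsub>L\<^esub> l = \<kappa> v \<odot>\<^bsub>L\<^esub> (r \<odot>\<^bsub>L\<^esub> y) \<oplus>\<^bsub>L\<^esub> \<ominus>\<^bsub>L\<^esub> (r \<odot>\<^bsub>L\<^esub> k)"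
      using rc a(1) kc y(1) by (simp add: L.M.a_ac L.M.r_neg L.M.r_neg1 L.M.r_neg2)
    also have "\<dots> \<in> seq_mult L xs"
      using S(3)[OF S(6)[OF y(3)[OF r] kc(3)] S(4)[OF S(6)[OF k(1) rc]]] .
    finally show "(r \<otimes> a) \<odot>\<^bsub>L\<^esub> l \<in> seq_mult L xs" .
  qed
  then show ?thesis using a(1) notin by blast
qed

text \<open>A covering prime that contains the maximal ideal comes with an element it annihilates:
  in R/I this is the required \<open>s\<close>, in L/IL it is converted by
  \<open>semidualizing_socle\<close>. If there is no such prime, avoidance supplies
  \<open>x\<close>.\<close>

lemma ex_socle_or_extension:
  assumes "semidualizing R L" "param_seq R xs" "reg_seq (regular_module R) xs" "reg_seq L xs"
    and ne: "seq_mult (regular_module R) xs \<noteq> \<mm>"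
  shows "(\<exists>s\<in>carrier R. s \<notin> seq_mult (regular_module R) xs \<and> (\<forall>r\<in>\<mm>. r \<otimes> s \<in> seq_mult (regular_module R) xs)) \<or>
    (\<exists>x. param_seq R (x # xs) \<and> reg_seq (regular_module R) (x # xs) \<and> reg_seq L (x # xs))"
proof (rule disjCI)
  assume no: "\<not> (\<exists>x. param_seq R (x # xs) \<and> reg_seq (regular_module R) (x # xs) \<and> reg_seq L (x # xs))"
  have L: "module R L" and fg: "finitely_generated_module R L"
    using assms(1) unfolding semidualizing_def by auto
  interpret L: module R L by fact
  interpret RM: module R "regular_module R" by (rule regular_module_module)
  interpret m: primeideal \<mm> R by (rule max_ideal_prime)
  have xs: "set xs \<subseteq> carrier R" by (rule param_seq_subset[OF assms(2)])
  let ?I = "seq_mult (regular_module R) xs"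
  let ?q = "set_add R \<mm>2 ?I"
  have I: "ideal ?I R" by (rule seq_mult_ideal[OF xs])
  have q: "ideal ?q R" by (rule add_ideals[OF max_ideal_sq_ideal I])
  have Im: "?I \<subseteq> \<mm>"
  proof -
    have "set xs \<subseteq> \<mm>" using assms(2) by (induction xs) auto
    then show ?thesis using seq_mult_eq_Idl[OF xs] genideal_minimal[OF max_ideal_ideal] by simp
  qed
  \<comment> \<open>By Nakayama's lemma, I different from the maximal ideal leaves room for an
    element independent modulo the square.\<close>
  have mq: "\<not> \<mm> \<subseteq> ?q" using max_ideal_nakayama[OF I] Im ne by blast
  have fgR: "\<exists>ns. set ns \<subseteq> carrier (regular_module R) \<and> N = lin_span (carrier R) (regular_module R) ns"
    if "submodule N R (regular_module R)" for N
    using ideal_gens[of N] that Idl_eq_lin_span submodule_regular_iff_ideal by (metis regular_module_simps(1))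
  obtain P1 where "finite P1 \<and>
    (\<forall>p\<in>P1. primeideal p R \<and> (\<exists>y\<in>carrier R - ?I. p = {a \<in> carrier R. a \<otimes> y \<in> ?I})) \<and>
    (\<forall>x\<in>carrier R. (\<exists>u\<in>carrier R - ?I. x \<otimes> u \<in> ?I) \<longrightarrow> (\<exists>p\<in>P1. x \<in> p))"
    using RM.finite_primes_cover_zero_divisors[OF noetherian_ring_axioms RM.seq_mult_submodule[OF xs] fgR,
        unfolded regular_module_simps] by (rule exE)
  then have P1: "finite P1"
    "\<And>p. p \<in> P1 \<Longrightarrow> primeideal p R \<and> (\<exists>y\<in>carrier R - ?I. p = {a \<in> carrier R. a \<otimes> y \<in> ?I})"
    "\<And>x. x \<in> carrier R \<Longrightarrow> \<exists>u\<in>carrier R - ?I. x \<otimes> u \<in> ?I \<Longrightarrow> \<exists>p\<in>P1. x \<in> p"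
    by simp_all
  obtain P2 where "finite P2 \<and>
    (\<forall>p\<in>P2. primeideal p R \<and> (\<exists>y\<in>carrier L - seq_mult L xs. p = {a \<in> carrier R. a \<odot>\<^bsub>L\<^esub> y \<in> seq_mult L xs})) \<and>
    (\<forall>x\<in>carrier R. (\<exists>u\<in>carrier L - seq_mult L xs. x \<odot>\<^bsub>L\<^esub> u \<in> seq_mult L xs) \<longrightarrow> (\<exists>p\<in>P2. x \<in> p))"
    using L.finite_primes_cover_zero_divisors[OF noetherian_ring_axioms L.seq_mult_submodule[OF xs]
        L.submodules_finitely_generated[OF noetherian_ring_axioms fg]] by (rule exE)
  then have P2: "finite P2"
    "\<And>p. p \<in> P2 \<Longrightarrow> primeideal p R \<and> (\<exists>y\<in>carrier L - seq_mult L xs. p = {a \<in> carrier R. a \<odot>\<^bsub>L\<^esub> y \<in> seq_mult L xs})"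
    "\<And>x. x \<in> carrier R \<Longrightarrow> \<exists>u\<in>carrier L - seq_mult L xs. x \<odot>\<^bsub>L\<^esub> u \<in> seq_mult L xs \<Longrightarrow> \<exists>p\<in>P2. x \<in> p"
    by simp_all
  have "\<exists>p\<in>P1 \<union> P2. \<mm> \<subseteq> p"
  proof (rule ccontr)
    assume "\<not> ?thesis"
    then have nm: "\<not> \<mm> \<subseteq> p" if "p \<in> P1 \<union> P2" for p using that by blast
    have pr: "primeideal p R" if "p \<in> P1 \<union> P2" for p using that P1(2) P2(2) by blast
    have "\<exists>x\<in>\<mm>. x \<notin> ?q \<and> (\<forall>p\<in>P1 \<union> P2. x \<notin> p)"
    proof (rule prime_avoidance[OF _ pr max_ideal_ideal q mq nm])
      show "finite (P1 \<union> P2)" using P1(1) P2(1) by simp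
      fix p assume p: "p \<in> P1 \<union> P2"
      interpret p: primeideal p R by (rule pr[OF p])
      obtain a where a: "a \<in> \<mm>" "a \<notin> p" using nm[OF p] by blast
      have ac: "a \<in> carrier R" using a m.Icarr by blast
      \<comment> \<open>A prime omitting a also omits its square, which lies in \<open>?q\<close>;
        this is the condition that \<open>prime_avoidance\<close> puts on the non-prime
        ideal.\<close>
      have "a \<otimes> a \<in> \<mm>2" by (rule ideal_prod.prod[OF a(1) a(1)])
      moreover have "a \<otimes> a = a \<otimes> a \<oplus> \<zero>" using ac by simp
      moreover have "\<zero> \<in> ?I" using additive_subgroup.zero_closed[OF ideal.axioms(1)[OF I]] .
      ultimately have "a \<otimes> a \<in> ?q" unfolding set_add_def' by blast
      then show "\<not> ?q \<subseteq> p" using p.I_prime[OF ac ac] a(2) by blast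
    qed
    then obtain x where x: "x \<in> \<mm>" "x \<notin> ?q" "\<And>p. p \<in> P1 \<Longrightarrow> x \<notin> p" "\<And>p. p \<in> P2 \<Longrightarrow> x \<notin> p" by blast
    have xc: "x \<in> carrier R" using x m.Icarr by blast
    have "reg_seq (regular_module R) (x # xs)" using assms(3) P1(3)[OF xc] x(3) by auto
    moreover have "reg_seq L (x # xs)" using assms(4) P2(3)[OF xc] x(4) by auto
    ultimately show False using no assms(2) x(1,2) by auto
  qed
  then obtain p where p: "p \<in> P1 \<union> P2" "\<mm> \<subseteq> p" by blast
  show "\<exists>s\<in>carrier R. s \<notin> ?I \<and> (\<forall>r\<in>\<mm>. r \<otimes> s \<in> ?I)"
  proof (cases "p \<in> P1")
    case True
    then obtain y where "y \<in> carrier R - ?I" "p = {a \<in> carrier R. a \<otimes> y \<in> ?I}" using P1(2) by blast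
    then show ?thesis using p(2) by (intro bexI[of _ y]) auto
  next
    case False
    then obtain y where y: "y \<in> carrier L - seq_mult L xs" "p = {a \<in> carrier R. a \<odot>\<^bsub>L\<^esub> y \<in> seq_mult L xs}"
      using P2(2) p(1) by blast
    show ?thesis using semidualizing_socle[OF assms(1) xs assms(4), of y] y p(2) by blast
  qed
qed

text \<open>The syzygies and the surjection are condensed into \<open>kill\<close>; what remains
  concerns a single semidualizing module.\<close>

lemma regular_if_socle_kills:
  assumes "semidualizing R L"
    and kill: "\<And>xs s l. param_seq R xs \<Longrightarrow> reg_seq (regular_module R) xs \<Longrightarrow> s \<in> \<mm> \<Longrightarrow>
      (\<And>a. a \<in> \<mm> \<Longrightarrow> s \<otimes> a \<in> seq_mult (regular_module R) xs) \<Longrightarrow> l \<in> carrier L \<Longrightarrow> s \<odot>\<^bsub>L\<^esub> l \<in> seq_mult L xs"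
  shows "regular_local_ring R"
proof -
  interpret m: primeideal \<mm> R by (rule max_ideal_prime)
  interpret RM: module R "regular_module R" by (rule regular_module_module)
  define good where "good xs \<longleftrightarrow> param_seq R xs \<and> reg_seq (regular_module R) xs \<and> reg_seq L xs" for xs
  let ?I = "seq_mult (regular_module R)"
  have Q0: "\<exists>xs. good xs \<and> ?I [] = ?I xs" unfolding good_def by (intro exI[of _ "[]"]) simp
  have I0: "ideal (?I []) R" by (rule seq_mult_ideal) simp
  \<comment> \<open>Maximality is imposed on the generated ideal rather than on the length of the
    list, so the ascending chain condition provides it. A further element enlarges the ideal
    strictly because it lies outside the square plus I.\<close>
  obtain J where J: "ideal J R" "\<exists>xs. good xs \<and> J = ?I xs"
    and max: "\<And>K. ideal K R \<Longrightarrow> \<exists>xs. good xs \<and> K = ?I xs \<Longrightarrow> J \<subseteq> K \<Longrightarrow> K = J"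
    by (rule obtain_maximal_ideal[of "?I []" "\<lambda>J. \<exists>xs. good xs \<and> J = ?I xs", OF I0 Q0]) (rule that)
  then obtain xs where xs: "good xs" "J = ?I xs" by blast
  have par: "param_seq R xs" and reg: "reg_seq (regular_module R) xs" "reg_seq L xs" using xs(1) unfolding good_def by auto
  have xsc: "set xs \<subseteq> carrier R" by (rule param_seq_subset[OF par])
  interpret I: ideal "?I xs" R by (rule seq_mult_ideal[OF xsc])
  have "?I xs = \<mm>"
  proof (rule ccontr)
    assume ne: "?I xs \<noteq> \<mm>"
    have "set xs \<subseteq> \<mm>" using par by (induction xs) auto
    then have Im: "?I xs \<subseteq> \<mm>" using seq_mult_eq_Idl[OF xsc] genideal_minimal[OF max_ideal_ideal] by simp
    have "\<not> good (x # xs)" for x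
    proof
      assume g: "good (x # xs)"
      then have xxs: "set (x # xs) \<subseteq> carrier R" using param_seq_subset unfolding good_def by blast
      then have x: "x \<in> carrier R" by simp
      have "?I (x # xs) = J"
        using max[OF seq_mult_ideal[OF xxs]] g RM.seq_mult_Cons_le[OF xsc x] xs(2) by blast
      moreover have "x \<in> ?I (x # xs)"
        using seq_mult_ConsI[of \<one> "regular_module R" \<zero> xs x] I.zero_closed x by simp
      ultimately have "x \<in> ?I xs" using xs(2) by simp
      moreover have "\<zero> \<in> \<mm>2" using additive_subgroup.zero_closed[OF ideal.axioms(1)[OF max_ideal_sq_ideal]] .
      moreover have "x = \<zero> \<oplus> x" using x by simp
      ultimately have "x \<in> set_add R \<mm>2 (?I xs)" unfolding set_add_def' by blast
      then show False using g unfolding good_def by simp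
    qed
    then obtain s where s: "s \<in> carrier R" "s \<notin> ?I xs" "\<And>r. r \<in> \<mm> \<Longrightarrow> r \<otimes> s \<in> ?I xs"
      using ex_socle_or_extension[OF assms(1) par reg ne] unfolding good_def by blast
    have sm: "s \<otimes> r \<in> ?I xs" if "r \<in> \<mm>" for r using s(3)[OF that] s(1) m.Icarr[OF that] by (simp add: m_comm)
    show False
    proof (cases "s \<in> \<mm>")
      case True
      have "s \<in> ?I xs"
        by (rule semidualizing_faithful_mod[OF assms(1) xsc reg(2) s(1) kill[OF par reg(1) True sm]])
      then show False using s(2) by simp
    next
      case False
      then obtain c where c: "c \<in> carrier R" "c \<otimes> s = \<one>" using unit_of_not_max s(1) by blast
      \<comment> \<open>Here \<open>s\<close> is a unit, so dividing by it brings the whole maximal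
        ideal into I.\<close>
      have "\<mm> \<subseteq> ?I xs"
      proof
        fix r assume r: "r \<in> \<mm>"
        have "c \<otimes> (s \<otimes> r) = r" using c s(1) m.Icarr[OF r] by (simp add: m_assoc[symmetric])
        then show "r \<in> ?I xs" using I.I_l_closed[OF sm[OF r] c(1)] by simp
      qed
      then show False using Im ne by blast
    qed
  qed
  then show ?thesis using regular_if_max_ideal_reg_seq[OF xsc reg(1)] by simp
qed

end

theorem theorem1p4p7:
  fixes R :: "'a ring"
    and \<Lambda> :: "nat set"
    and j :: "nat \<Rightarrow> nat"
    and \<Omega> :: "nat \<Rightarrow> ('a, 'c) module"
    and L :: "('a, 'b) module"
    and f :: "(nat \<times> nat \<Rightarrow> 'c) \<Rightarrow> 'b"
  assumes "noetherian_local_ring R"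
    and "finite \<Lambda>"
    and "\<And>n. n \<in> \<Lambda> \<Longrightarrow> j n \<ge> 1"
    and "\<And>n. n \<in> \<Lambda> \<Longrightarrow> syzygy_module R (residue_field R) n (\<Omega> n)"
    and "semidualizing R L"
    and "f \<in> mod_hom R (finite_direct_sum (SIGMA n:\<Lambda>. {..<j n}) (\<lambda>(n, i). \<Omega> n)) L"
    and "f ` carrier (finite_direct_sum (SIGMA n:\<Lambda>. {..<j n}) (\<lambda>(n, i). \<Omega> n)) = carrier L"
  shows "regular_local_ring R"
proof -
  interpret noetherian_local_ring R by fact
  let ?I = "SIGMA n:\<Lambda>. {..<j n}" and ?M = "\<lambda>(n, i :: nat). \<Omega> n"
  let ?D = "finite_direct_sum ?I ?M"
  have M: "module R (?M p)" if "p \<in> ?I" for p using that assms(4) unfolding syzygy_module_def by auto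
  have D: "module R ?D" by (rule finite_direct_sum_module[OF is_cring M])
  have L: "module R L" using assms(5) unfolding semidualizing_def by blast
  interpret D: module R ?D by (rule D)
  show ?thesis
  proof (rule regular_if_socle_kills[OF assms(5)])
    fix xs s l
    assume par: "param_seq R xs" and reg: "reg_seq (regular_module R) xs" and s: "s \<in> max_ideal R"
      and soc: "\<And>a. a \<in> max_ideal R \<Longrightarrow> s \<otimes>\<^bsub>R\<^esub> a \<in> seq_mult (regular_module R) xs" and l: "l \<in> carrier L"
    have sc: "s \<in> carrier R" using s ideal.Icarr[OF max_ideal_ideal] by blast
    have xs: "set xs \<subseteq> carrier R" by (rule param_seq_subset[OF par])
    obtain v where v: "v \<in> carrier ?D" "l = f v" using l assms(7) by blast
    have sv: "s \<odot>\<^bsub>?D\<^esub> v \<in> carrier ?D" by (rule D.smult_closed[OF sc v(1)])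
    have "(s \<odot>\<^bsub>?D\<^esub> v) p \<in> seq_mult (?M p) xs" if p: "p \<in> ?I" for p
    proof -
      obtain n i where ni: "p = (n, i)" "n \<in> \<Lambda>" using p by auto
      have "v p \<in> carrier (?M p)" using v(1) p by auto
      then have "s \<odot>\<^bsub>\<Omega> n\<^esub> v p \<in> seq_mult (\<Omega> n) xs"
        using syzygy_socle[OF par reg s soc assms(4)[OF ni(2)]] ni by simp
      then show ?thesis using p ni by simp
    qed
    then have "s \<odot>\<^bsub>?D\<^esub> v \<in> seq_mult ?D xs" using finite_direct_sum_seq_mult[OF is_cring M xs sv] by blast
    \<comment> \<open>\<open>f\<close> maps I times the direct sum into I \<open>L\<close>, and
      every element of \<open>L\<close> is some \<open>f v\<close>, so the inclusion passes from the
      syzygies to \<open>L\<close>.\<close>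
    then have "f (s \<odot>\<^bsub>?D\<^esub> v) \<in> seq_mult L xs" by (rule mod_hom_seq_mult[OF D L assms(6) xs])
    then show "s \<odot>\<^bsub>L\<^esub> l \<in> seq_mult L xs" using mod_homD(3)[OF assms(6) sc v(1)] v(2) by simp
  qed
qed

end
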